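(* Let $(K,\sigma)$ be a difference field, i.e.\ a field $K$ with an automorphism $\sigma$. Then $(K,\sigma)$ is existentially closed among all difference fields (that is, every finite system of equations and inequations in the language $\{+,-,\times,0,1,\sigma\}$ with parameters from $K$ that has a solution in some difference field extending $(K,\sigma)$ already has a solution in $K$) if and only if the following holds: for all natural numbers $m\le n$, for every injective function $\tau\colon\{0,\dots,m-1\}\to\{0,\dots,n-1\}$, and for every finite subset $I_0$ of the polynomial ring $K[X_j : j<n]$, if the ideal $(I_0)$ generated by $I_0$ in $K[X_j: j<n]$ is prime and \[ \bigl\{f(X_{\tau(i)} : i<m) : f\in (I_0)\cap K[X_i : i<m]\bigr\} = (I_0)\cap K[X_{\tau(i)} : i<m], \] then there is a tuple $(b_j : j<n)\in K^n$ such that $f(b_0,\dots,b_{n-1})=0$ for all $f\in I_0$ and $\sigma(b_i)=b_{\tau(i)}$ for all $i<m$.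
   Context: Here $f(X_{\tau(i)} : i<m)$ denotes the polynomial obtained from $f\in K[X_0,\dots,X_{m-1}]$ by substituting $X_{\tau(i)}$ for $X_i$ for each $i<m$.
   Formalization: The condition on I_0 is stated with σ also applied to the coefficients of f, i.e. f^σ(X_{τ(i)}) instead of f(X_{τ(i)}); with plain substitution the claim is false, since {X_0−a} and {X_1−X_0−1} would force both σ=id and σ(b)=b+1 for some b. *)

theory Defs
  imports "HOL-Algebra.Algebraic_Closure_Type" "HOL-Library.Poly_Mapping"
begin

section \<open>Difference fields and existential closedness\<close>

definition difference_field :: "('a, 'm) ring_scheme \<Rightarrow> ('a \<Rightarrow> 'a) \<Rightarrow> bool" where
  "difference_field R s \<longleftrightarrow> field R \<and> s \<in> ring_iso R R"

text \<open>An extension is given by an embedding \<open>h\<close>; it need not be an inclusion, so that the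
  extension may live on another type. As \<open>R\<close> is a field, \<open>h\<close> is automatically injective.\<close>

definition difference_field_extension ::
  "('a, 'm) ring_scheme \<Rightarrow> ('a \<Rightarrow> 'a) \<Rightarrow> ('b, 'n) ring_scheme \<Rightarrow> ('b \<Rightarrow> 'b) \<Rightarrow> ('a \<Rightarrow> 'b) \<Rightarrow> bool"
where
  "difference_field_extension R s L t h \<longleftrightarrow>
     difference_field L t \<and> h \<in> ring_hom R L \<and> (\<forall>x\<in>carrier R. h (s x) = t (h x))"

text \<open>Terms of the language \<open>{+, -, \<times>, 0, 1, \<sigma>}\<close>, with parameters from \<open>'a\<close> (\<open>Param\<close>) and
  variables indexed by natural numbers. Subtraction is binary.\<close>

datatype 'a dterm =
    Variable nat
  | Param 'a
  | Zero
  | One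
  | Plus "'a dterm" "'a dterm"
  | Minus "'a dterm" "'a dterm"
  | Times "'a dterm" "'a dterm"
  | Sigma_app "'a dterm"

primrec dterm_value ::
  "('b, 'n) ring_scheme \<Rightarrow> ('b \<Rightarrow> 'b) \<Rightarrow> ('a \<Rightarrow> 'b) \<Rightarrow> (nat \<Rightarrow> 'b) \<Rightarrow> 'a dterm \<Rightarrow> 'b"
where
  "dterm_value L t h v (Variable i) = v i"
| "dterm_value L t h v (Param c) = h c"
| "dterm_value L t h v Zero = \<zero>\<^bsub>L\<^esub>"
| "dterm_value L t h v One = \<one>\<^bsub>L\<^esub>"
| "dterm_value L t h v (Plus p q) = dterm_value L t h v p \<oplus>\<^bsub>L\<^esub> dterm_value L t h v q"
| "dterm_value L t h v (Minus p q) = dterm_value L t h v p \<ominus>\<^bsub>L\<^esub> dterm_value L t h v q"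
| "dterm_value L t h v (Times p q) = dterm_value L t h v p \<otimes>\<^bsub>L\<^esub> dterm_value L t h v q"
| "dterm_value L t h v (Sigma_app p) = t (dterm_value L t h v p)"

text \<open>A system consists of a set \<open>E\<close> of equations and a set \<open>N\<close> of inequations, both given as pairs
  of terms; the parameters are interpreted along \<open>h\<close>.\<close>

definition system_solvable ::
  "('b, 'n) ring_scheme \<Rightarrow> ('b \<Rightarrow> 'b) \<Rightarrow> ('a \<Rightarrow> 'b) \<Rightarrow>
     ('a dterm \<times> 'a dterm) set \<Rightarrow> ('a dterm \<times> 'a dterm) set \<Rightarrow> bool"
where
  "system_solvable L t h E N \<longleftrightarrow>
     (\<exists>v. (\<forall>i. v i \<in> carrier L) \<and>
          (\<forall>(p, q)\<in>E. dterm_value L t h v p = dterm_value L t h v q) \<and>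
          (\<forall>(p, q)\<in>N. dterm_value L t h v p \<noteq> dterm_value L t h v q))"

text \<open>HOL has no quantifier over types inside a formula, so the extensions considered are those whose
  underlying set is a subset of a given type \<open>'b\<close>. By the downward Loewenheim--Skolem theorem,
  a system solvable in some extension of \<open>R\<close> is solvable in one of cardinality at most
  \<open>max |R| \<aleph>\<^sub>0\<close>; hence, once \<open>'b\<close> is infinite and at least as large as \<open>R\<close>, all difference
  field extensions are accounted for.\<close>

definition existentially_closed ::
  "'b itself \<Rightarrow> ('a, 'm) ring_scheme \<Rightarrow> ('a \<Rightarrow> 'a) \<Rightarrow> bool"
where
  "existentially_closed (_ :: 'b itself) R s \<longleftrightarrow>
     (\<forall>E N. finite E \<longrightarrow> finite N \<longrightarrow>
        (\<forall>(p, q)\<in>E \<union> N. set_dterm p \<subseteq> carrier R \<and> set_dterm q \<subseteq> carrier R) \<longrightarrow>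
        (\<exists>(L :: 'b ring) t h. difference_field_extension R s L t h \<and> system_solvable L t h E N) \<longrightarrow>
        system_solvable R s (\<lambda>x. x) E N)"


section \<open>Multivariate polynomials\<close>

text \<open>A polynomial maps each monomial (a finitely supported map from variable indices to exponents)
  to its coefficient.\<close>

type_synonym 'a mpoly = "(nat \<Rightarrow>\<^sub>0 nat) \<Rightarrow>\<^sub>0 'a"

definition mvar :: "nat \<Rightarrow> 'a::comm_ring_1 mpoly" where
  "mvar i = Poly_Mapping.single (Poly_Mapping.single i 1) 1"

definition mconst :: "'a::comm_ring_1 \<Rightarrow> 'a mpoly" where
  "mconst c = Poly_Mapping.single 0 c"

text \<open>The ring \<open>K[X\<^sub>j : j \<in> V]\<close>.\<close>

definition mpoly_ring :: "nat set \<Rightarrow> 'a::comm_ring_1 mpoly ring" where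
  "mpoly_ring V =
     ring_of_type_algebra\<lparr>carrier := {p. \<forall>m\<in>Poly_Mapping.keys p. Poly_Mapping.keys m \<subseteq> V}\<rparr>"

definition meval :: "(nat \<Rightarrow> 'a) \<Rightarrow> 'a::comm_ring_1 mpoly \<Rightarrow> 'a" where
  "meval v p = (\<Sum>m\<in>Poly_Mapping.keys p. Poly_Mapping.lookup p m *
                  (\<Prod>i\<in>Poly_Mapping.keys m. v i ^ Poly_Mapping.lookup m i))"

text \<open>\<open>f(X\<^bsub>\<tau>(i)\<^esub>)\<close>: substitution of \<open>X\<^bsub>\<tau>(i)\<^esub>\<close> for \<open>X\<^sub>i\<close>.\<close>

definition msubst :: "(nat \<Rightarrow> nat) \<Rightarrow> 'a::comm_ring_1 mpoly \<Rightarrow> 'a mpoly" where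
  "msubst \<tau> p = (\<Sum>m\<in>Poly_Mapping.keys p. mconst (Poly_Mapping.lookup p m) *
                   (\<Prod>i\<in>Poly_Mapping.keys m. mvar (\<tau> i) ^ Poly_Mapping.lookup m i))"

text \<open>\<open>f\<^sup>\<sigma>\<close>: the automorphism applied to the coefficients. The compatibility condition on an ideal
  \<open>I\<close> of \<open>K[X\<^sub>j : j < n]\<close> says that \<open>\<sigma>\<close> together with \<open>X\<^sub>i \<mapsto> X\<^bsub>\<tau>(i)\<^esub>\<close> induces an isomorphism of the
  subrings of \<open>K[X\<^sub>j : j < n]/I\<close> generated by the \<open>X\<^sub>i\<close> and by the \<open>X\<^bsub>\<tau>(i)\<^esub>\<close>, \<open>i < m\<close>. So the
  coefficients have to be moved by \<open>\<sigma>\<close> as well: with the bare substitution \<open>f(X\<^bsub>\<tau>(i)\<^esub>)\<close> the ideal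
  \<open>(X\<^sub>0 - a)\<close>, with \<open>m = n = 1\<close> and \<open>\<tau> = id\<close>, would meet the condition for every \<open>a\<close>, and the
  required point \<open>b\<^sub>0 = a = \<sigma>(a)\<close> would force \<open>\<sigma>\<close> to be the identity.\<close>

definition mtwist :: "('a \<Rightarrow> 'a) \<Rightarrow> 'a::comm_ring_1 mpoly \<Rightarrow> 'a mpoly" where
  "mtwist \<sigma> p = Poly_Mapping.map \<sigma> p"

end

theory Submission
  imports Defs "HOL-Library.Countable"
begin

text \<open>Suppose first that \<open>(K, \<sigma>)\<close> is existentially closed, and let \<open>I\<close> be the prime ideal generated by
  \<open>I\<^sub>0\<close>. It suffices to extend the partial automorphism \<open>X\<^sub>i \<mapsto> X\<^bsub>\<tau>(i)\<^esub>\<close> of \<open>K[X\<^sub>j : j < n]/I\<close> to an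
  automorphism of a larger domain, whose fraction field is then a difference field with a generic
  point of \<open>I\<close>. The larger domain is a quotient of the polynomial ring in variables \<open>X\<^bsub>j,k\<^esub>\<close>, \<open>j\<close> a natural
  number and \<open>k\<close> an integer, on which \<open>\<tau>\<close> extends to a bijective shift of the variables. The prime ideal
  is built by adding iterated images and preimages in turn; each step amalgamates two primes that
  agree on the common variables, which is possible because the tensor product of two field extensions
  is nonzero.

  Conversely, name the values of all subterms of a system solved in an extension, together with their
  images under the automorphism. By Hilbert's basis theorem the ideal of polynomials vanishing at this tuple
  is finitely generated. It is prime, and it satisfies the compatibility condition for the map sending each value
  to its image. A point of it as provided by the hypothesis is a solution in \<open>K\<close>.\<close>

section \<open>Polynomials over an arbitrary index type\<close>

text \<open>In the first direction the obstacle is that a partial isomorphism has no canonical total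
  extension. Making the shift of the variables total from the outset moves the whole difficulty into
  finding a prime ideal invariant under it. A prime that is invariant as far as the variables of
  times a to b can tell agrees with its own image, which lives at times a + 1 to b + 1, on the
  overlap; this is what makes the amalgamation applicable again and again. Primes are taken in the
  full polynomial ring throughout and only their traces on subrings matter, so no quotient is formed
  before the last step. In the same spirit, the nonvanishing of the tensor product becomes an
  argument with denominators inside the polynomial ring. The fraction field is finally coded into
  \<open>'b\<close>, because extensions are sought on that type. In the converse direction the
  geometric condition yields zeros only, so inequations have to become equations: the inverse of the
  difference of the two sides is named as a further coordinate (Rabinowitsch's trick).\<close>

definition pvar :: "'i \<Rightarrow> ('i \<Rightarrow>\<^sub>0 nat) \<Rightarrow>\<^sub>0 'a::comm_ring_1" where
  "pvar i = Poly_Mapping.single (Poly_Mapping.single i 1) 1"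

definition pconst :: "'a::comm_ring_1 \<Rightarrow> ('i \<Rightarrow>\<^sub>0 nat) \<Rightarrow>\<^sub>0 'a" where
  "pconst c = Poly_Mapping.single 0 c"

definition psub :: "'i set \<Rightarrow> (('i \<Rightarrow>\<^sub>0 nat) \<Rightarrow>\<^sub>0 'a::comm_ring_1) set" where
  "psub A = {p. \<forall>m\<in>Poly_Mapping.keys p. Poly_Mapping.keys m \<subseteq> A}"

definition rhom :: "('a::comm_ring_1 \<Rightarrow> 'b::comm_ring_1) \<Rightarrow> bool" where
  "rhom f \<longleftrightarrow> f 1 = 1 \<and> (\<forall>x y. f (x + y) = f x + f y) \<and> (\<forall>x y. f (x * y) = f x * f y)"

lemma rhom_1: "rhom f \<Longrightarrow> f 1 = 1"
  and rhom_add: "rhom f \<Longrightarrow> f (x + y) = f x + f y"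
  and rhom_mult: "rhom f \<Longrightarrow> f (x * y) = f x * f y"
  by (auto simp: rhom_def)

lemma rhom_0: "rhom f \<Longrightarrow> f 0 = 0"
  by (metis add_cancel_right_left rhom_add)

lemma rhom_uminus: "rhom f \<Longrightarrow> f (- x) = - f x"
  by (metis add.right_inverse minus_unique rhom_0 rhom_add)

lemma rhom_diff: "rhom f \<Longrightarrow> f (x - y) = f x - f y"
  by (metis diff_conv_add_uminus rhom_add rhom_uminus)

lemmas rhom_simps = rhom_1 rhom_0 rhom_add rhom_mult rhom_uminus rhom_diff

lemma rhom_comp: "rhom f \<Longrightarrow> rhom g \<Longrightarrow> rhom (\<lambda>x. f (g x))"
  by (simp add: rhom_def)

lemma rhom_id: "rhom (\<lambda>x. x)"
  by (simp add: rhom_def)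

lemma rhom_pconst: "rhom pconst"
  by (simp add: rhom_def pconst_def single_add mult_single)

lemma poly_mapping_sum_singles:
  "f = (\<Sum>m\<in>Poly_Mapping.keys f. Poly_Mapping.single m (Poly_Mapping.lookup f m))"
  by (rule poly_mapping_eqI)
    (simp add: lookup_sum lookup_single when_def in_keys_iff)

lemma poly_mapping_induct [case_names zero single add]:
  assumes "P 0" and "\<And>m c. P (Poly_Mapping.single m c)"
    and "\<And>p q. P p \<Longrightarrow> P q \<Longrightarrow> P (p + q)"
  shows "P (f :: 'k \<Rightarrow>\<^sub>0 'c::comm_monoid_add)"
proof -
  have "P (\<Sum>m\<in>A. Poly_Mapping.single m (Poly_Mapping.lookup f m))" if "finite A" for A
    using that by induction (use assms in auto)
  then show ?thesis
    by (metis finite_keys poly_mapping_sum_singles)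
qed

lemma single_eq_pconst_mult:
  "Poly_Mapping.single m c = pconst c * Poly_Mapping.single m 1"
  by (simp add: pconst_def mult_single)

lemma pvar_power: "pvar i ^ k = Poly_Mapping.single (Poly_Mapping.single i k) 1"
  by (induction k) (simp_all add: pvar_def mult_single flip: single_add)

lemma update_eq_add_single:
  fixes m :: "'i \<Rightarrow>\<^sub>0 nat"
  assumes "k \<notin> Poly_Mapping.keys m"
  shows "Poly_Mapping.update k v m = m + Poly_Mapping.single k v"
  using assms
  by (intro poly_mapping_eqI) (auto simp: lookup_update lookup_add lookup_single when_def in_keys_iff)

lemma psub_single: "Poly_Mapping.keys m \<subseteq> A \<Longrightarrow> Poly_Mapping.single m c \<in> psub A"
  by (simp add: psub_def)

lemma psub_pconst [simp, intro]: "pconst c \<in> psub A"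
  by (simp add: pconst_def psub_single)

lemma psub_0 [simp, intro]: "0 \<in> psub A"
  and psub_1 [simp, intro]: "1 \<in> psub A"
  by (auto simp: psub_def)

lemma psub_pvar: "i \<in> A \<Longrightarrow> pvar i \<in> psub A"
  by (simp add: pvar_def psub_single)

lemma psub_add: "p \<in> psub A \<Longrightarrow> q \<in> psub A \<Longrightarrow> p + q \<in> psub A"
  using keys_add[of p q] by (auto simp: psub_def)

lemma psub_mult: "p \<in> psub A \<Longrightarrow> q \<in> psub A \<Longrightarrow> p * q \<in> psub A"
proof -
  assume *: "p \<in> psub A" "q \<in> psub A"
  show ?thesis unfolding psub_def
  proof (intro CollectI ballI)
    fix m assume "m \<in> Poly_Mapping.keys (p * q)"
    then obtain a b where "m = a + b" "a \<in> Poly_Mapping.keys p" "b \<in> Poly_Mapping.keys q"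
      using keys_mult[of p q] by auto
    then show "Poly_Mapping.keys m \<subseteq> A"
      using * keys_add[of a b] by (fastforce simp: psub_def)
  qed
qed

lemma psub_uminus: "p \<in> psub A \<Longrightarrow> - p \<in> psub A"
  by (simp add: psub_def in_keys_iff)

lemma psub_diff: "p \<in> psub A \<Longrightarrow> q \<in> psub A \<Longrightarrow> p - q \<in> psub A"
  using psub_add[of p A "- q"] psub_uminus by force

lemma psub_mono: "A \<subseteq> B \<Longrightarrow> psub A \<subseteq> psub B"
  by (auto simp: psub_def)

lemma psub_UNIV: "psub UNIV = UNIV"
  by (auto simp: psub_def)

text \<open>Monomials are built up one variable at a time by \<open>update_induct\<close>, and
  polynomials as sums of constants times monomials. Membership in \<open>psub A\<close> is carried
  along because the cases for sums and products assume it of both operands.\<close>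

lemma psub_induct [consumes 1, case_names pconst pvar add mult]:
  assumes f: "f \<in> psub A"
    and 1: "\<And>c. P (pconst c)" and 2: "\<And>i. i \<in> A \<Longrightarrow> P (pvar i)"
    and 3: "\<And>p q. p \<in> psub A \<Longrightarrow> q \<in> psub A \<Longrightarrow> P p \<Longrightarrow> P q \<Longrightarrow> P (p + q)"
    and 4: "\<And>p q. p \<in> psub A \<Longrightarrow> q \<in> psub A \<Longrightarrow> P p \<Longrightarrow> P q \<Longrightarrow> P (p * q)"
  shows "P (f :: ('i \<Rightarrow>\<^sub>0 nat) \<Rightarrow>\<^sub>0 'a::comm_ring_1)"
proof -
  have P0: "P 0" using 1[of 0] by (simp add: pconst_def)
  have P1: "P 1" using 1[of 1] by (simp add: pconst_def)
  have pow: "P (pvar i ^ k)" "(pvar i :: ('i \<Rightarrow>\<^sub>0 nat) \<Rightarrow>\<^sub>0 'a) ^ k \<in> psub A" if "i \<in> A" for i k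
  proof (induction k)
    case (Suc k)
    { case 1 show ?case using 4[OF psub_pvar[OF that] Suc(2) 2[OF that] Suc(1)] by simp }
    { case 2 show ?case using psub_mult[OF psub_pvar[OF that] Suc(2)] by simp }
  qed (use P1 in auto)
  have mon: "P (Poly_Mapping.single m 1)" if "Poly_Mapping.keys m \<subseteq> A" for m
    using that
  proof (induction m rule: update_induct)
    case const
    then show ?case using P1 by simp
  next
    case (update m k v)
    then have *: "Poly_Mapping.keys m \<subseteq> A" "k \<in> A"
      by (auto simp: keys_update)
    have "Poly_Mapping.single (Poly_Mapping.update k v m) 1
            = Poly_Mapping.single m 1 * (pvar k ^ v :: ('i \<Rightarrow>\<^sub>0 nat) \<Rightarrow>\<^sub>0 'a)"
      using update by (simp add: update_eq_add_single pvar_power mult_single)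
    then show ?case
      using 4[OF psub_single[OF *(1)] pow(2)[OF *(2)]] update.IH * pow by simp
  qed
  have "P (\<Sum>m\<in>M. Poly_Mapping.single m (Poly_Mapping.lookup f m))
      \<and> (\<Sum>m\<in>M. Poly_Mapping.single m (Poly_Mapping.lookup f m)) \<in> psub A"
    if "finite M" "M \<subseteq> Poly_Mapping.keys f" for M
    using that
  proof induction
    case (insert m M)
    then have m: "Poly_Mapping.keys m \<subseteq> A" using f by (auto simp: psub_def)
    have "P (Poly_Mapping.single m (Poly_Mapping.lookup f m))"
      by (subst single_eq_pconst_mult) (intro 4 1 mon m psub_single psub_pconst)
    with insert m show ?case
      by (simp add: 3 psub_single psub_add)
  qed (use P0 in auto)
  from this[OF finite_keys order_refl] show ?thesis
    by (metis poly_mapping_sum_singles)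
qed

text \<open>Uniqueness half of the universal property of the polynomial ring. Identities between
  substitutions, such as \<open>S (S' p) = p\<close>, are checked on constants and variables through
  it.\<close>

lemma rhom_eq_on_psub:
  assumes "rhom f" "rhom g" "\<And>c. f (pconst c) = g (pconst c)"
    "\<And>i. i \<in> A \<Longrightarrow> f (pvar i) = g (pvar i)" "p \<in> psub A"
  shows "f p = g p"
  using assms(5) by (induction rule: psub_induct) (use assms in \<open>auto simp: rhom_simps\<close>)

text \<open>Common generalisation of two operations: \<open>meval\<close> is the case where
  \<open>h\<close> is the identity, and \<open>msubst\<close> after \<open>mtwist\<close> is the
  case where \<open>h\<close> applies \<sigma> and embeds the result as a constant
  polynomial.\<close>

definition ev :: "('a \<Rightarrow> 'c) \<Rightarrow> ('i \<Rightarrow> 'c) \<Rightarrow> (('i \<Rightarrow>\<^sub>0 nat) \<Rightarrow>\<^sub>0 'a::comm_ring_1) \<Rightarrow> 'c::comm_ring_1" where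
  "ev h v p = (\<Sum>m\<in>Poly_Mapping.keys p. h (Poly_Mapping.lookup p m) *
                  (\<Prod>i\<in>Poly_Mapping.keys m. v i ^ Poly_Mapping.lookup m i))"

lemma prod_keys_add:
  fixes v :: "'i \<Rightarrow> 'c::comm_ring_1" and m m' :: "'i \<Rightarrow>\<^sub>0 nat"
  shows "(\<Prod>i\<in>Poly_Mapping.keys (m + m'). v i ^ Poly_Mapping.lookup (m + m') i) =
    (\<Prod>i\<in>Poly_Mapping.keys m. v i ^ Poly_Mapping.lookup m i) *
    (\<Prod>i\<in>Poly_Mapping.keys m'. v i ^ Poly_Mapping.lookup m' i)" (is "?l = ?a * ?b")
proof -
  let ?S = "Poly_Mapping.keys m \<union> Poly_Mapping.keys m'"
  have "?l = (\<Prod>i\<in>?S. v i ^ Poly_Mapping.lookup (m + m') i)"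
    by (intro prod.mono_neutral_left) (auto simp: in_keys_iff lookup_add)
  moreover have "?a = (\<Prod>i\<in>?S. v i ^ Poly_Mapping.lookup m i)"
    by (intro prod.mono_neutral_left) (auto simp: in_keys_iff)
  moreover have "?b = (\<Prod>i\<in>?S. v i ^ Poly_Mapping.lookup m' i)"
    by (intro prod.mono_neutral_left) (auto simp: in_keys_iff)
  ultimately show ?thesis
    by (simp add: lookup_add power_add prod.distrib)
qed

lemma ev_add: "rhom h \<Longrightarrow> ev h v (p + q) = ev h v p + ev h v q"
  unfolding ev_def by (intro setsum_keys_plus_distrib) (auto simp: rhom_simps distrib_right)

lemma ev_0: "ev h v 0 = 0"
  by (simp add: ev_def)

lemma ev_single: "rhom h \<Longrightarrow>
   ev h v (Poly_Mapping.single m c) = h c * (\<Prod>i\<in>Poly_Mapping.keys m. v i ^ Poly_Mapping.lookup m i)"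
  by (cases "c = 0") (auto simp: ev_def rhom_simps)

lemma ev_pconst: "rhom h \<Longrightarrow> ev h v (pconst c) = h c"
  by (simp add: pconst_def ev_single)

lemma ev_pvar: "rhom h \<Longrightarrow> ev h v (pvar i) = v i"
  by (simp add: pvar_def ev_single rhom_simps)

lemma rhom_ev:
  assumes h: "rhom h"
  shows "rhom (ev h v)"
proof -
  \<comment> \<open>Both sides are additive in \<open>p\<close> and in \<open>q\<close>, so single
    monomials suffice.\<close>
  have mult: "ev h v (p * q) = ev h v p * ev h v q" for p q
  proof (induction p rule: poly_mapping_induct)
    case (single m c)
    show ?case
    proof (induction q rule: poly_mapping_induct)
      case (single m' c')
      then show ?case
        by (simp add: mult_single ev_single h rhom_mult[OF h] prod_keys_add)
    qed (simp_all add: ev_add[OF h] distrib_left ev_0)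
  qed (simp_all add: ev_add[OF h] distrib_right ev_0)
  show ?thesis
    using ev_pconst[OF h, of v 1] by (simp add: rhom_def mult ev_add[OF h] rhom_1[OF h] pconst_def)
qed

lemma ev_in_psub:
  assumes "rhom h" "p \<in> psub A" "\<And>c. h c \<in> psub B" "\<And>i. i \<in> A \<Longrightarrow> v i \<in> psub B"
  shows "ev h v p \<in> psub B"
  using assms(2)
  by (induction rule: psub_induct)
    (auto simp: assms ev_pconst ev_pvar rhom_simps[OF rhom_ev[OF assms(1)]] psub_add psub_mult)

section \<open>Prime ideals and amalgamation\<close>

definition is_ideal :: "'r::comm_ring_1 set \<Rightarrow> bool" where
  "is_ideal I \<longleftrightarrow> 0 \<in> I \<and> (\<forall>x\<in>I. \<forall>y\<in>I. x + y \<in> I) \<and> (\<forall>r. \<forall>x\<in>I. r * x \<in> I)"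

definition is_prime_ideal :: "'r::comm_ring_1 set \<Rightarrow> bool" where
  "is_prime_ideal I \<longleftrightarrow> is_ideal I \<and> 1 \<notin> I \<and> (\<forall>x y. x * y \<in> I \<longrightarrow> x \<in> I \<or> y \<in> I)"

lemma is_ideal_0: "is_ideal I \<Longrightarrow> 0 \<in> I"
  and is_ideal_add: "is_ideal I \<Longrightarrow> x \<in> I \<Longrightarrow> y \<in> I \<Longrightarrow> x + y \<in> I"
  and is_ideal_mult: "is_ideal I \<Longrightarrow> x \<in> I \<Longrightarrow> r * x \<in> I"
  and is_ideal_mult2: "is_ideal I \<Longrightarrow> x \<in> I \<Longrightarrow> x * r \<in> I"
  by (auto simp: is_ideal_def mult.commute)

lemma is_ideal_uminus: "is_ideal I \<Longrightarrow> x \<in> I \<Longrightarrow> - x \<in> I"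
  using is_ideal_mult[of I x "- 1"] by simp

lemma is_ideal_sum: "is_ideal I \<Longrightarrow> (\<And>a. a \<in> A \<Longrightarrow> g a \<in> I) \<Longrightarrow> sum g A \<in> I"
  by (induction A rule: infinite_finite_induct) (auto simp: is_ideal_0 is_ideal_add)

lemma is_prime_idealD:
  assumes "is_prime_ideal I"
  shows "is_ideal I" "1 \<notin> I" "x * y \<in> I \<longleftrightarrow> x \<in> I \<or> y \<in> I"
  using assms unfolding is_prime_ideal_def by (blast intro: is_ideal_mult is_ideal_mult2)+

lemma subset_chain_2:
  "subset.chain A C \<Longrightarrow> x \<in> \<Union>C \<Longrightarrow> y \<in> \<Union>C \<Longrightarrow> \<exists>I\<in>C. x \<in> I \<and> y \<in> I"
  unfolding subset_chain_def by blast

text \<open>Krull's argument: an ideal that is maximal among those containing \<open>J\<close> and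
  avoiding the multiplicative set \<open>M\<close> is automatically prime.\<close>

lemma exists_prime_ideal_disjoint:
  fixes J M :: "'r::comm_ring_1 set"
  assumes J: "is_ideal J" and M: "1 \<in> M" "\<And>x y. x \<in> M \<Longrightarrow> y \<in> M \<Longrightarrow> x * y \<in> M"
    and JM: "J \<inter> M = {}"
  shows "\<exists>Q. is_prime_ideal Q \<and> J \<subseteq> Q \<and> Q \<inter> M = {}"
proof -
  define A where "A = {Q. is_ideal Q \<and> J \<subseteq> Q \<and> Q \<inter> M = {}}"
  have "\<exists>Q\<in>A. \<forall>U\<in>A. Q \<subseteq> U \<longrightarrow> U = Q"
  proof (rule subset_Zorn_nonempty)
    show "A \<noteq> {}" using J JM by (auto simp: A_def)
    fix C assume C: "C \<noteq> {}" "subset.chain A C"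
    then have CA: "C \<subseteq> A" by (simp add: subset_chain_def)
    have "is_ideal (\<Union>C)"
      unfolding is_ideal_def
    proof (intro conjI ballI allI)
      show "0 \<in> \<Union>C" using C(1) CA is_ideal_0 unfolding A_def by blast
      show "r * x \<in> \<Union>C" if "x \<in> \<Union>C" for r x
        using that CA is_ideal_mult unfolding A_def by blast
      fix x y assume "x \<in> \<Union>C" "y \<in> \<Union>C"
      from subset_chain_2[OF C(2) this] obtain I where "I \<in> C" "x \<in> I" "y \<in> I" by blast
      then show "x + y \<in> \<Union>C" using CA is_ideal_add unfolding A_def by blast
    qed
    then show "\<Union>C \<in> A" using C CA by (auto simp: A_def)
  qed
  then obtain Q where Q: "Q \<in> A" and max: "\<And>U. U \<in> A \<Longrightarrow> Q \<subseteq> U \<Longrightarrow> U = Q" by blast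
  have iQ: "is_ideal Q" "J \<subseteq> Q" "Q \<inter> M = {}" using Q by (auto simp: A_def)
  \<comment> \<open>Maximality: the ideal \<open>U\<close> generated by \<open>Q\<close> and
    \<open>x\<close> is strictly larger than \<open>Q\<close>, hence meets \<open>M\<close>.\<close>
  have ext: "\<exists>q\<in>Q. \<exists>r. q + r * x \<in> M" if x: "x \<notin> Q" for x
  proof (rule ccontr)
    assume no: "\<not> ?thesis"
    define U where "U = {q + r * x | q r. q \<in> Q}"
    have QU: "Q \<subseteq> U"
    proof
      fix q assume "q \<in> Q"
      then show "q \<in> U" unfolding U_def by (intro CollectI exI[of _ q] exI[of _ 0]) simp
    qed
    have "x \<in> U" unfolding U_def
      using is_ideal_0[OF iQ(1)] by (intro CollectI exI[of _ 0] exI[of _ 1]) simp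
    have "is_ideal U" unfolding is_ideal_def
    proof (intro conjI ballI allI)
      show "0 \<in> U" using QU is_ideal_0[OF iQ(1)] by auto
      fix a assume "a \<in> U"
      then obtain q r where a: "a = q + r * x" "q \<in> Q" by (auto simp: U_def)
      have "s * a = s * q + (s * r) * x" for s by (simp add: a algebra_simps)
      then show "s * a \<in> U" for s unfolding U_def using is_ideal_mult[OF iQ(1) a(2)] by blast
      fix b assume "b \<in> U"
      then obtain q' r' where b: "b = q' + r' * x" "q' \<in> Q" by (auto simp: U_def)
      have "a + b = (q + q') + (r + r') * x" by (simp add: a b algebra_simps)
      then show "a + b \<in> U" unfolding U_def using is_ideal_add[OF iQ(1) a(2) b(2)] by blast
    qed
    moreover have "U \<inter> M = {}" using no by (auto simp: U_def)
    ultimately have "U \<in> A" using QU iQ by (auto simp: A_def)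
    from max[OF this QU] \<open>x \<in> U\<close> x show False by simp
  qed
  have "x \<in> Q \<or> y \<in> Q" if xy: "x * y \<in> Q" for x y
  proof (rule ccontr)
    assume "\<not> ?thesis"
    then obtain q r q' r' where m: "q \<in> Q" "q' \<in> Q" "q + r * x \<in> M" "q' + r' * y \<in> M"
      using ext[of x] ext[of y] by blast
    \<comment> \<open>The product of the two elements of \<open>M\<close> expands into multiples of
      \<open>q\<close>, \<open>q'\<close> and \<open>x * y\<close>, all of them in
      \<open>Q\<close>.\<close>
    have "(q + r * x) * (q' + r' * y) = (q' + r' * y) * q + (r * x) * q' + (r * r') * (x * y)"
      by (simp add: algebra_simps)
    also have "\<dots> \<in> Q" using m(1,2) xy by (simp only: is_ideal_add is_ideal_mult iQ)
    finally show False using M(2)[OF m(3,4)] iQ(3) by blast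
  qed
  then have "is_prime_ideal Q" using iQ M(1) unfolding is_prime_ideal_def by blast
  then show ?thesis using iQ by blast
qed

text \<open>Sums without scalars: stability of the generating set under multiplication is supplied
  separately in \<open>addspan_mult\<close>, so that the same notion serves for ideals and for
  modules over different subrings.\<close>

inductive_set addspan :: "'r::comm_ring_1 set \<Rightarrow> 'r set" for S where
  zero: "0 \<in> addspan S"
| step: "x \<in> S \<Longrightarrow> y \<in> addspan S \<Longrightarrow> x + y \<in> addspan S"

lemma addspan_incl: "x \<in> S \<Longrightarrow> x \<in> addspan S"
  using addspan.step[OF _ addspan.zero] by force

lemma addspan_add: "x \<in> addspan S \<Longrightarrow> y \<in> addspan S \<Longrightarrow> x + y \<in> addspan S"
  by (induction rule: addspan.induct) (auto simp: add.assoc intro: addspan.step)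

lemma addspan_subset:
  assumes "S \<subseteq> N" "0 \<in> N" "\<And>x y. x \<in> N \<Longrightarrow> y \<in> N \<Longrightarrow> x + y \<in> N"
  shows "addspan S \<subseteq> N"
proof
  fix x assume "x \<in> addspan S" then show "x \<in> N" by induction (use assms in auto)
qed

lemma addspan_mult:
  assumes "\<And>x. x \<in> S \<Longrightarrow> r * x \<in> S" "x \<in> addspan S"
  shows "r * x \<in> addspan S"
  using assms(2) by induction (auto simp: distrib_left intro: assms(1) addspan.intros)

section \<open>Splitting monomials along a set of variables\<close>

definition res :: "'i set \<Rightarrow> ('i \<Rightarrow>\<^sub>0 nat) \<Rightarrow> ('i \<Rightarrow>\<^sub>0 nat)" where
  "res A m = Poly_Mapping.mapp (\<lambda>i k. if i \<in> A then k else 0) m"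

lemma lookup_res: "Poly_Mapping.lookup (res A m) i = (if i \<in> A then Poly_Mapping.lookup m i else 0)"
  by (auto simp: res_def lookup_mapp in_keys_iff when_def)

lemma res_add: "res A (m + m') = res A m + res A m'"
  by (rule poly_mapping_eqI) (simp add: lookup_res lookup_add)

lemma res_split: "res A m + res (- A) m = m"
  by (rule poly_mapping_eqI) (simp add: lookup_res lookup_add)

lemma keys_res: "Poly_Mapping.keys (res A m) = A \<inter> Poly_Mapping.keys m"
  by (auto simp: in_keys_iff lookup_res split: if_splits)

lemma res_eq: "Poly_Mapping.keys m \<subseteq> A \<Longrightarrow> res A m = m"
  by (rule poly_mapping_eqI) (auto simp: lookup_res in_keys_iff)

lemma res_eq_0: "Poly_Mapping.keys m \<subseteq> - A \<Longrightarrow> res A m = 0"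
  by (rule poly_mapping_eqI) (auto simp: lookup_res in_keys_iff)

text \<open>The coefficient of the monomial \<open>w\<close> when \<open>K[X\<^sub>i : i]\<close> is viewed as the ring of polynomials in
  the \<open>X\<^sub>i\<close>, \<open>i \<notin> A\<close>, over \<open>K[X\<^sub>i : i \<in> A]\<close>.\<close>

definition coef :: "'i set \<Rightarrow> ('i \<Rightarrow>\<^sub>0 nat) \<Rightarrow> (('i \<Rightarrow>\<^sub>0 nat) \<Rightarrow>\<^sub>0 'a::comm_ring_1) \<Rightarrow> ('i \<Rightarrow>\<^sub>0 nat) \<Rightarrow>\<^sub>0 'a" where
  "coef A w p = (\<Sum>m\<in>Poly_Mapping.keys p.
     Poly_Mapping.single (res A m) (if res (- A) m = w then Poly_Mapping.lookup p m else 0))"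

lemma coef_add: "coef A w (p + q) = coef A w p + coef A w q"
  unfolding coef_def by (intro setsum_keys_plus_distrib) (auto simp: single_add)

lemma coef_0: "coef A w 0 = 0"
  by (simp add: coef_def)

lemma coef_single:
  "coef A w (Poly_Mapping.single m c) = Poly_Mapping.single (res A m) (if res (- A) m = w then c else 0)"
  by (auto simp: coef_def)

text \<open>A factor from \<open>psub A\<close> does not change the part of a monomial outside
  \<open>A\<close>, so \<open>coef A w\<close> is linear over \<open>psub A\<close>.\<close>

lemma coef_mult:
  assumes "x \<in> psub A"
  shows "coef A w (x * y) = x * coef A w y"
  using assms
proof (induction arbitrary: y rule: psub_induct)
  case (pconst c)
  show ?case
    by (induction y rule: poly_mapping_induct)
      (auto simp: coef_0 coef_add distrib_left coef_single pconst_def mult_single)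
next
  case (pvar i)
  then have "res A (Poly_Mapping.single i (1::nat)) = Poly_Mapping.single i 1"
    "res (- A) (Poly_Mapping.single i (1::nat)) = 0"
    by (auto intro!: res_eq res_eq_0)
  then show ?case
    by (induction y rule: poly_mapping_induct)
      (auto simp: coef_0 coef_add distrib_left coef_single pvar_def mult_single res_add)
next
  case (add p q)
  then show ?case by (simp add: coef_add distrib_right)
next
  case (mult p q)
  then show ?case by (simp add: mult.assoc)
qed

lemma psub_sum: "(\<And>a. a \<in> S \<Longrightarrow> g a \<in> psub A) \<Longrightarrow> sum g S \<in> psub A"
  by (induction S rule: infinite_finite_induct) (auto simp: psub_add)

text \<open>For \<open>A = U\<close> and \<open>B = Y\<close> the coefficients involve common
  variables only, which is where the two primes to be amalgamated can be compared.\<close>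

lemma coef_psub: "y \<in> psub B \<Longrightarrow> coef A w y \<in> psub (A \<inter> B)"
  unfolding coef_def by (intro psub_sum psub_single) (auto simp: keys_res psub_def)

lemma sum_coef:
  "y = (\<Sum>w\<in>res (- A) ` Poly_Mapping.keys y. coef A w y * Poly_Mapping.single w 1)"
proof -
  have "(\<Sum>w\<in>res (- A) ` Poly_Mapping.keys y. coef A w y * Poly_Mapping.single w 1)
     = (\<Sum>m\<in>Poly_Mapping.keys y. \<Sum>w\<in>res (- A) ` Poly_Mapping.keys y.
          Poly_Mapping.single (res A m) (if res (- A) m = w then Poly_Mapping.lookup y m else 0)
            * Poly_Mapping.single w 1)"
    by (subst sum.swap) (simp add: coef_def sum_distrib_right)
  also have "\<dots> = (\<Sum>m\<in>Poly_Mapping.keys y. Poly_Mapping.single m (Poly_Mapping.lookup y m))"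
  proof (intro sum.cong refl)
    fix m assume m: "m \<in> Poly_Mapping.keys y"
    have "(\<Sum>w\<in>res (- A) ` Poly_Mapping.keys y.
          Poly_Mapping.single (res A m) (if res (- A) m = w then Poly_Mapping.lookup y m else 0)
            * Poly_Mapping.single w 1)
       = (\<Sum>w\<in>res (- A) ` Poly_Mapping.keys y. if res (- A) m = w then
            Poly_Mapping.single (res A m + w) (Poly_Mapping.lookup y m) else 0)"
      by (intro sum.cong refl) (simp add: mult_single)
    also have "\<dots> = Poly_Mapping.single m (Poly_Mapping.lookup y m)"
      using m by (simp add: sum.delta res_split)
    finally show "(\<Sum>w\<in>res (- A) ` Poly_Mapping.keys y.
          Poly_Mapping.single (res A m) (if res (- A) m = w then Poly_Mapping.lookup y m else 0)
            * Poly_Mapping.single w 1) = Poly_Mapping.single m (Poly_Mapping.lookup y m)" .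
  qed
  finally show ?thesis by (simp flip: poly_mapping_sum_singles)
qed

text \<open>Each monomial is its part in \<open>U\<close> times its part outside \<open>U\<close>,
  which lies in \<open>Y\<close>. This reduces claims about arbitrary multiples of an element to
  multiples by such products.\<close>

lemma addspan_psub_mult:
  assumes "U \<union> Y = UNIV"
  shows "(r :: ('i \<Rightarrow>\<^sub>0 nat) \<Rightarrow>\<^sub>0 'a::comm_ring_1) \<in> addspan {x * y | x y. x \<in> psub U \<and> y \<in> psub Y}"
proof (induction r rule: poly_mapping_induct)
  case (single m c)
  have "Poly_Mapping.single m c = Poly_Mapping.single (res U m) c * Poly_Mapping.single (res (- U) m) 1"
    by (simp add: mult_single res_split)
  moreover have "Poly_Mapping.single (res U m) c \<in> psub U" "Poly_Mapping.single (res (- U) m) (1::'a) \<in> psub Y"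
    using assms by (auto intro!: psub_single simp: keys_res)
  ultimately show ?case by (intro addspan_incl) blast
qed (auto intro: addspan.zero addspan_add)

text \<open>Stand-in for a linear retraction of the fraction field of \<open>K[U]/P\<close> onto that of \<open>K[V]/P\<close>:
  \<open>H\<close> is the kernel of a functional normalised at \<open>f\<close>.\<close>

lemma exists_complement:
  fixes P :: "(('i \<Rightarrow>\<^sub>0 nat) \<Rightarrow>\<^sub>0 'a::comm_ring_1) set"
  assumes P: "is_prime_ideal P" and f: "f \<in> psub U" "f \<notin> P" and V: "V \<subseteq> U"
  shows "\<exists>H. P \<inter> psub U \<subseteq> H \<and> (\<forall>x\<in>H. \<forall>y\<in>H. x + y \<in> H) \<and> (\<forall>x\<in>H. \<forall>d\<in>psub V. d * x \<in> H)
    \<and> (\<forall>d\<in>psub V. f * d \<in> H \<longrightarrow> d \<in> P)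
    \<and> (\<forall>x\<in>psub U. \<exists>c\<in>psub V - P. \<exists>d\<in>psub V. c * x - f * d \<in> H)"
proof -
  have VU: "c \<in> psub U" if "c \<in> psub V" for c :: "('i \<Rightarrow>\<^sub>0 nat) \<Rightarrow>\<^sub>0 'a"
    using that psub_mono[OF V] by blast
  note iP = is_prime_idealD(1)[OF P]
  define A where "A = {H. P \<inter> psub U \<subseteq> H \<and> (\<forall>x\<in>H. \<forall>y\<in>H. x + y \<in> H) \<and> (\<forall>x\<in>H. \<forall>d\<in>psub V. d * x \<in> H)
    \<and> (\<forall>d\<in>psub V. f * d \<in> H \<longrightarrow> d \<in> P)}"
  have "\<exists>H\<in>A. \<forall>U\<in>A. H \<subseteq> U \<longrightarrow> U = H"
  proof (rule subset_Zorn_nonempty)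
    \<comment> \<open>\<open>P \<inter> psub U\<close> is itself a candidate: primality and
      \<open>f \<notin> P\<close> give the condition concerning \<open>f\<close>.\<close>
    have "d \<in> P" if "f * d \<in> P" for d
      using that f by (simp add: is_prime_idealD(3)[OF P])
    moreover have "x + y \<in> P \<inter> psub U" if "x \<in> P \<inter> psub U" "y \<in> P \<inter> psub U" for x y
      using that by (simp add: is_ideal_add[OF iP] psub_add)
    moreover have "d * x \<in> P \<inter> psub U" if "x \<in> P \<inter> psub U" "d \<in> psub V" for d x
      using that VU by (simp add: is_ideal_mult[OF iP] psub_mult)
    ultimately have "P \<inter> psub U \<in> A" unfolding A_def by blast
    then show "A \<noteq> {}" by blast
    fix C assume C: "C \<noteq> {}" "subset.chain A C"
    then have CA: "C \<subseteq> A" by (simp add: subset_chain_def)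
    have "x + y \<in> \<Union>C" if xy: "x \<in> \<Union>C" "y \<in> \<Union>C" for x y
    proof -
      obtain I where "I \<in> C" "x \<in> I" "y \<in> I" using subset_chain_2[OF C(2) xy] by blast
      then show ?thesis using CA unfolding A_def by blast
    qed
    moreover have "P \<inter> psub U \<subseteq> \<Union>C" using C(1) CA unfolding A_def by blast
    moreover have "d * x \<in> \<Union>C" if "x \<in> \<Union>C" "d \<in> psub V" for d x
      using that CA unfolding A_def by blast
    moreover have "d \<in> P" if "d \<in> psub V" "f * d \<in> \<Union>C" for d
      using that CA unfolding A_def by blast
    ultimately show "\<Union>C \<in> A" unfolding A_def by blast
  qed
  then obtain H where H: "H \<in> A" and max: "\<And>U. U \<in> A \<Longrightarrow> H \<subseteq> U \<Longrightarrow> U = H" by blast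
  have H0: "P \<inter> psub U \<subseteq> H" and Hadd: "\<And>x y. x \<in> H \<Longrightarrow> y \<in> H \<Longrightarrow> x + y \<in> H"
    and Hm: "\<And>x d. x \<in> H \<Longrightarrow> d \<in> psub V \<Longrightarrow> d * x \<in> H"
    and Hf: "\<And>d. d \<in> psub V \<Longrightarrow> f * d \<in> H \<Longrightarrow> d \<in> P"
    using H by (auto simp: A_def)
  have H00: "0 \<in> H" using H0 is_ideal_0[OF iP] by auto
  have "\<exists>c\<in>psub V - P. \<exists>d\<in>psub V. c * x - f * d \<in> H" if x: "x \<in> psub U" for x
  proof (cases "x \<in> H")
    case True
    then show ?thesis using is_prime_idealD(2)[OF P]
      by (intro bexI[of _ 1] bexI[of _ 0]) auto
  next
    case False
    \<comment> \<open>Adding the multiples of \<open>x\<close> must violate a condition by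
      maximality, and only the one concerning \<open>f\<close> can fail. The failure is a relation
      between \<open>f\<close> and \<open>x\<close> with coefficients in
      \<open>psub V\<close>.\<close>
    define Z where "Z = {h + c * x | h c. h \<in> H \<and> c \<in> psub V}"
    have HZ: "H \<subseteq> Z"
    proof
      fix h assume "h \<in> H"
      then show "h \<in> Z" unfolding Z_def by (intro CollectI exI[of _ h] exI[of _ 0]) simp
    qed
    have "x \<in> Z" unfolding Z_def
      using H00 by (intro CollectI exI[of _ 0] exI[of _ 1]) simp
    with False max HZ have "Z \<notin> A" by blast
    moreover have "P \<inter> psub U \<subseteq> Z" using H0 HZ by blast
    moreover have "a + b \<in> Z" if "a \<in> Z" "b \<in> Z" for a b
    proof -
      from that obtain h c h' c' where *: "a = h + c * x" "b = h' + c' * x" "h \<in> H" "h' \<in> H"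
        "c \<in> psub V" "c' \<in> psub V" by (auto simp: Z_def)
      have "a + b = (h + h') + (c + c') * x" by (simp add: * algebra_simps)
      then show ?thesis unfolding Z_def
        using Hadd[OF *(3,4)] psub_add[OF *(5,6)] by blast
    qed
    moreover have "d * a \<in> Z" if "a \<in> Z" "d \<in> psub V" for a d
    proof -
      from that obtain h c where *: "a = h + c * x" "h \<in> H" "c \<in> psub V" by (auto simp: Z_def)
      have "d * a = d * h + (d * c) * x" by (simp add: * algebra_simps)
      then show ?thesis unfolding Z_def
        using Hm[OF *(2) that(2)] psub_mult[OF that(2) *(3)] by blast
    qed
    ultimately obtain d where d: "d \<in> psub V" "f * d \<in> Z" "d \<notin> P"
      unfolding A_def by blast
    then obtain h c where hc: "f * d = h + c * x" "h \<in> H" "c \<in> psub V" by (auto simp: Z_def)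
    \<comment> \<open>Otherwise \<open>c * x\<close> would already be in \<open>H\<close>, hence
      also \<open>f * d\<close>, which forces \<open>d\<close> into \<open>P\<close>.\<close>
    have "c \<notin> P"
    proof
      assume "c \<in> P"
      then have "c * x \<in> P \<inter> psub U"
        using is_ideal_mult2[OF iP] psub_mult[OF VU[OF hc(3)] x] by blast
      with H0 hc Hadd have "f * d \<in> H" by auto
      with Hf d show False by blast
    qed
    have "- h \<in> H" using Hm[OF hc(2) psub_uminus[OF psub_1]] by simp
    then have "c * x - f * d \<in> H" using hc(1) by simp
    then show ?thesis using \<open>c \<notin> P\<close> hc(3) d by blast
  qed
  then show ?thesis using H unfolding A_def
    by (intro exI[of _ H] conjI) simp_all
qed

text \<open>Take \<open>V = U \<inter> Y\<close> and \<open>H\<close> as above. Modulo \<open>H\<close>, and up to a denominator in \<open>K[V]\<close>, every element of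
  the ideal generated by the two primes is \<open>f\<close> times an element of \<open>P'\<close>. So \<open>f * g\<close> in this ideal would
  force \<open>g\<close> into \<open>P'\<close>.\<close>

lemma amalgamation_disjoint:
  fixes P P' :: "(('i \<Rightarrow>\<^sub>0 nat) \<Rightarrow>\<^sub>0 'a::comm_ring_1) set"
  assumes P: "is_prime_ideal P" and P': "is_prime_ideal P'" and UY: "U \<union> Y = UNIV"
    and eq: "P \<inter> psub (U \<inter> Y) = P' \<inter> psub (U \<inter> Y)"
    and f: "f \<in> psub U" "f \<notin> P" and g: "g \<in> psub Y" "g \<notin> P'"
  shows "f * g \<notin> addspan {r * a | r a. a \<in> P \<inter> psub U \<or> a \<in> P' \<inter> psub Y}"
proof
  define V where "V = U \<inter> Y"
  have V: "V \<subseteq> U" "V \<subseteq> Y" by (auto simp: V_def)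
  have VU: "c \<in> psub U" if "c \<in> psub V" for c :: "('i \<Rightarrow>\<^sub>0 nat) \<Rightarrow>\<^sub>0 'a"
    using that psub_mono[OF V(1)] by blast
  have VY: "c \<in> psub Y" if "c \<in> psub V" for c :: "('i \<Rightarrow>\<^sub>0 nat) \<Rightarrow>\<^sub>0 'a"
    using that psub_mono[OF V(2)] by blast
  note iP = is_prime_idealD(1)[OF P] and iP' = is_prime_idealD(1)[OF P']
  have PP: "c \<in> P \<longleftrightarrow> c \<in> P'" if "c \<in> psub V" for c using that eq V_def by auto
  obtain H where H0: "P \<inter> psub U \<subseteq> H" and Hadd: "\<And>x y. x \<in> H \<Longrightarrow> y \<in> H \<Longrightarrow> x + y \<in> H"
    and Hm: "\<And>x d. x \<in> H \<Longrightarrow> d \<in> psub V \<Longrightarrow> d * x \<in> H"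
    and Hf: "\<And>d. d \<in> psub V \<Longrightarrow> f * d \<in> H \<Longrightarrow> d \<in> P"
    and Hx: "\<And>x :: ('i \<Rightarrow>\<^sub>0 nat) \<Rightarrow>\<^sub>0 'a. x \<in> psub U \<Longrightarrow> \<exists>c\<in>psub V - P. \<exists>d\<in>psub V. c * x - f * d \<in> H"
    and HU: "H \<subseteq> psub U"
  proof -
    from exists_complement[OF P f V(1)] obtain H0 where
      H0: "P \<inter> psub U \<subseteq> H0" "(\<forall>x\<in>H0. \<forall>y\<in>H0. x + y \<in> H0)" "(\<forall>x\<in>H0. \<forall>d\<in>psub V. d * x \<in> H0)"
        "(\<forall>d\<in>psub V. f * d \<in> H0 \<longrightarrow> d \<in> P)"
        "(\<forall>x\<in>psub U. \<exists>c\<in>psub V - P. \<exists>d\<in>psub V. c * x - f * d \<in> H0)" by blast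
    \<comment> \<open>\<open>exists_complement\<close> does not confine its set to
      \<open>psub U\<close>, but \<open>coef_mult\<close> will require this of the elements of
      \<open>H\<close>. Intersecting loses nothing, because \<open>c * x - f * d\<close> lies in
      \<open>psub U\<close> anyway.\<close>
    show ?thesis
    proof (rule that[of "H0 \<inter> psub U"])
      show "x + y \<in> H0 \<inter> psub U" if "x \<in> H0 \<inter> psub U" "y \<in> H0 \<inter> psub U" for x y
        using that H0(2) by (simp add: psub_add)
      show "d * x \<in> H0 \<inter> psub U" if "x \<in> H0 \<inter> psub U" "d \<in> psub V" for x d
        using that H0(3) by (simp add: psub_mult VU)
      show "d \<in> P" if "d \<in> psub V" "f * d \<in> H0 \<inter> psub U" for d
        using that H0(4) by simp
      fix x :: "('i \<Rightarrow>\<^sub>0 nat) \<Rightarrow>\<^sub>0 'a" assume x: "x \<in> psub U"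
      with H0(5) obtain c d where "c \<in> psub V - P" "d \<in> psub V" "c * x - f * d \<in> H0" by blast
      moreover from this have "c * x - f * d \<in> psub U"
        using x f by (auto intro!: psub_diff psub_mult dest: VU)
      ultimately show "\<exists>c\<in>psub V - P. \<exists>d\<in>psub V. c * x - f * d \<in> H0 \<inter> psub U" by blast
    qed (use H0(1) in auto)
  qed
  \<comment> \<open>The module over \<open>psub Y\<close> generated by \<open>H\<close>, in place of
    the kernel of the functional after extension of scalars.\<close>
  define HW where "HW = addspan {h * y | h y. h \<in> H \<and> y \<in> psub Y}"
  have HWadd: "a + b \<in> HW" if "a \<in> HW" "b \<in> HW" for a b
    using that by (simp add: HW_def addspan_add)
  have HW0: "0 \<in> HW" by (simp add: HW_def addspan.zero)
  have HWm: "d * a \<in> HW" if "a \<in> HW" "d \<in> psub Y" for a d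
    unfolding HW_def
  proof (rule addspan_mult)
    fix x assume "x \<in> {h * y | h y. h \<in> H \<and> y \<in> psub Y}"
    then obtain h y where hy: "x = h * y" "h \<in> H" "y \<in> psub Y" by blast
    then have "d * x = h * (d * y)" "d * y \<in> psub Y"
      using that psub_mult by (auto simp: mult.left_commute)
    then show "d * x \<in> {h * y | h y. h \<in> H \<and> y \<in> psub Y}" using hy by blast
  qed (use that HW_def in auto)
  \<comment> \<open>By linearity over \<open>psub U\<close>, a generator \<open>h * y\<close> has
    coefficients \<open>coef U w y * h\<close>; the first factor involves common variables only, and
    \<open>H\<close> is stable under multiplication by those.\<close>
  have coefH: "coef U w F \<in> H" if "F \<in> HW" for F w
  proof -
    have H0': "0 \<in> H" using H0 is_ideal_0[OF iP] by auto
    have "{h * y | h y. h \<in> H \<and> y \<in> psub Y} \<subseteq> {F. coef U w F \<in> H}"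
    proof clarify
      fix h y :: "('i \<Rightarrow>\<^sub>0 nat) \<Rightarrow>\<^sub>0 'a" assume hy: "h \<in> H" "y \<in> psub Y"
      have "coef U w (h * y) = coef U w y * h"
        using hy HU by (subst coef_mult) (auto simp: mult.commute)
      then show "coef U w (h * y) \<in> H"
        using Hm[OF hy(1)] coef_psub[OF hy(2), of U w] by (simp add: V_def)
    qed
    then have "HW \<subseteq> {F. coef U w F \<in> H}"
      unfolding HW_def by (rule addspan_subset) (auto simp: coef_0 coef_add Hadd H0')
    then show ?thesis using that by blast
  qed
  \<comment> \<open>Here the agreement of the two primes enters. Each coefficient of
    \<open>e\<close> is in \<open>P\<close> by the normalisation of \<open>H\<close> at
    \<open>f\<close>, hence in \<open>P'\<close>, and \<open>e\<close> is a combination of its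
    coefficients.\<close>
  have key: "e \<in> P'" if "f * e \<in> HW" "e \<in> psub Y" for e
  proof -
    have "coef U w e \<in> P'" for w
    proof -
      have "f * coef U w e \<in> H" using coefH[OF that(1), of w] f by (simp add: coef_mult)
      moreover have "coef U w e \<in> psub V" using coef_psub[OF that(2)] by (simp add: V_def)
      ultimately show ?thesis using Hf PP by blast
    qed
    then show ?thesis
      by (subst sum_coef[of e U]) (intro is_ideal_sum is_ideal_mult2 iP')
  qed
  \<comment> \<open>The denominator \<open>c\<close> appears because the functional takes its values
    in the fraction field of \<open>psub V\<close> modulo \<open>P\<close>.\<close>
  define N where "N = {F. \<exists>c\<in>psub V - P. \<exists>G\<in>P' \<inter> psub Y. c * F - f * G \<in> HW}"
  have N0: "0 \<in> N" unfolding N_def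
    using is_prime_idealD(2)[OF P] is_ideal_0[OF iP'] HW0
    by (intro CollectI bexI[of _ 1] bexI[of _ 0]) auto
  have Nadd: "a + b \<in> N" if "a \<in> N" "b \<in> N" for a b
  proof -
    from that obtain c G c' G' where *: "c \<in> psub V - P" "c' \<in> psub V - P" "G \<in> P' \<inter> psub Y"
      "G' \<in> P' \<inter> psub Y" "c * a - f * G \<in> HW" "c' * b - f * G' \<in> HW"
      unfolding N_def by blast
    have "c * c' * (a + b) - f * (c' * G + c * G') = c' * (c * a - f * G) + c * (c' * b - f * G')"
      by (simp add: algebra_simps)
    also have "\<dots> \<in> HW" using * VY by (intro HWadd HWm) auto
    finally have "c * c' * (a + b) - f * (c' * G + c * G') \<in> HW" .
    moreover have "c * c' \<in> psub V - P" using * P by (auto simp: is_prime_idealD(3) psub_mult)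
    moreover have "c' * G + c * G' \<in> P' \<inter> psub Y"
      using * VY by (simp add: is_ideal_add[OF iP'] is_ideal_mult[OF iP'] psub_add psub_mult)
    ultimately show ?thesis unfolding N_def by blast
  qed
  \<comment> \<open>If \<open>a\<close> is in \<open>P\<close>, the functional kills
    \<open>x * a\<close> and \<open>G = 0\<close> works. If \<open>a\<close> is in
    \<open>P'\<close>, \<open>Hx\<close> trades \<open>c * x\<close> for \<open>f * d\<close> modulo
    \<open>H\<close>, and \<open>G\<close> becomes a multiple of \<open>a\<close>.\<close>
  have gen: "x * y * a \<in> N" if "a \<in> P \<inter> psub U \<or> a \<in> P' \<inter> psub Y" "x \<in> psub U" "y \<in> psub Y" for a x y
    using that(1)
  proof
    assume "a \<in> P \<inter> psub U"
    then have "x * a \<in> P \<inter> psub U" using that by (simp add: psub_mult is_ideal_mult[OF iP])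
    then have "x * a \<in> H" using H0 by blast
    then have "(x * a) * y \<in> HW" unfolding HW_def using that by (intro addspan_incl) blast
    then have "1 * (x * y * a) - f * 0 \<in> HW" by (simp add: mult_ac)
    then show ?thesis unfolding N_def
      using is_prime_idealD(2)[OF P] is_ideal_0[OF iP'] by (intro CollectI bexI[of _ 1] bexI[of _ 0]) auto
  next
    assume a: "a \<in> P' \<inter> psub Y"
    from Hx[OF that(2)] obtain c d where cd: "c \<in> psub V - P" "d \<in> psub V" "c * x - f * d \<in> H" by blast
    have "c * (x * y * a) - f * (d * y * a) = (c * x - f * d) * (y * a)" by (simp add: algebra_simps)
    also have "\<dots> \<in> HW" unfolding HW_def using cd a that psub_mult
      by (intro addspan_incl) blast
    finally have "c * (x * y * a) - f * (d * y * a) \<in> HW" .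
    moreover have "d * y * a \<in> P' \<inter> psub Y"
      using a cd VY that by (simp add: is_ideal_mult[OF iP'] psub_mult)
    ultimately show ?thesis unfolding N_def using cd by blast
  qed
  have "r * a \<in> N" if "a \<in> P \<inter> psub U \<or> a \<in> P' \<inter> psub Y" for r a
  proof -
    have "addspan {x * y | x y. x \<in> psub U \<and> y \<in> psub Y} \<subseteq> {r. r * a \<in> N}"
      by (rule addspan_subset) (use gen[OF that] N0 Nadd in \<open>auto simp: distrib_right\<close>)
    then show ?thesis using addspan_psub_mult[OF UY] by blast
  qed
  then have "addspan {r * a | r a. a \<in> P \<inter> psub U \<or> a \<in> P' \<inter> psub Y} \<subseteq> N"
    by (intro addspan_subset) (auto simp: N0 Nadd)
  moreover assume "f * g \<in> addspan {r * a | r a. a \<in> P \<inter> psub U \<or> a \<in> P' \<inter> psub Y}"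
  ultimately have "f * g \<in> N" by blast
  then obtain c G where c: "c \<in> psub V - P" "G \<in> P' \<inter> psub Y" "c * (f * g) - f * G \<in> HW"
    unfolding N_def by blast
  \<comment> \<open>For the element \<open>f * g\<close> the factor \<open>f\<close> can be pulled
    out, which is the form that \<open>key\<close> needs.\<close>
  have "f * (c * g - G) \<in> HW" using c(3) by (simp add: algebra_simps)
  moreover have "c * g - G \<in> psub Y" using c g VY by (simp add: psub_diff psub_mult)
  ultimately have "c * g - G \<in> P'" by (rule key)
  then have "c * g \<in> P'" using c(2) is_ideal_add[OF iP', of "c * g - G" G] by auto
  then show False using c PP g by (auto simp: is_prime_idealD(3)[OF P'])
qed

text \<open>A prime that contains both traces and avoids all products of an element of
  \<open>psub U\<close> outside \<open>P\<close> with one of the other side outside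
  \<open>P'\<close> restricts to exactly these traces. The products are closed under multiplication
  since both ideals are prime.\<close>

lemma amalgamation:
  fixes P P' :: "(('i \<Rightarrow>\<^sub>0 nat) \<Rightarrow>\<^sub>0 'a::comm_ring_1) set"
  assumes P: "is_prime_ideal P" and P': "is_prime_ideal P'"
    and eq: "P \<inter> psub (U \<inter> Y) = P' \<inter> psub (U \<inter> Y)"
  obtains Q where "is_prime_ideal Q" "\<And>f. f \<in> psub U \<Longrightarrow> f \<in> Q \<longleftrightarrow> f \<in> P"
    "\<And>f. f \<in> psub Y \<Longrightarrow> f \<in> Q \<longleftrightarrow> f \<in> P'"
proof -
  \<comment> \<open>Variables in neither set are added to the second side; the two sides then cover
    all variables, and their intersection is unchanged.\<close>
  define Z where "Z = Y \<union> - U"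
  have eq': "P \<inter> psub (U \<inter> Z) = P' \<inter> psub (U \<inter> Z)"
    using eq by (simp add: Z_def Int_Un_distrib)
  have UZ: "U \<union> Z = UNIV" by (auto simp: Z_def)
  define J where "J = addspan {r * a | r a. a \<in> P \<inter> psub U \<or> a \<in> P' \<inter> psub Z}"
  define M where "M = {f * g | f g. f \<in> psub U \<and> f \<notin> P \<and> g \<in> psub Z \<and> g \<notin> P'}"
  have J: "is_ideal J" unfolding is_ideal_def
  proof (intro conjI ballI allI)
    fix r x assume "x \<in> J"
    then show "r * x \<in> J" unfolding J_def
    proof (rule addspan_mult[rotated])
      fix y assume "y \<in> {r * a | r a. a \<in> P \<inter> psub U \<or> a \<in> P' \<inter> psub Z}"
      then obtain s a where "y = s * a" "a \<in> P \<inter> psub U \<or> a \<in> P' \<inter> psub Z" by blast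
      moreover from this have "r * y = (r * s) * a" by (simp add: mult.assoc)
      ultimately show "r * y \<in> {r * a | r a. a \<in> P \<inter> psub U \<or> a \<in> P' \<inter> psub Z}" by blast
    qed
  qed (auto simp: J_def addspan.zero addspan_add)
  have M1: "f \<in> M" if "f \<in> psub U" "f \<notin> P" for f
    unfolding M_def using that is_prime_idealD(2)[OF P']
    by (intro CollectI exI[of _ f] exI[of _ 1]) auto
  have M2: "g \<in> M" if "g \<in> psub Z" "g \<notin> P'" for g
    unfolding M_def using that is_prime_idealD(2)[OF P]
    by (intro CollectI exI[of _ 1] exI[of _ g]) auto
  have "x * y \<in> M" if xy: "x \<in> M" "y \<in> M" for x y
  proof -
    from xy obtain f g f' g' where *: "x = f * g" "y = f' * g'" "f \<in> psub U" "f \<notin> P" "g \<in> psub Z" "g \<notin> P'"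
      "f' \<in> psub U" "f' \<notin> P" "g' \<in> psub Z" "g' \<notin> P'" by (auto simp: M_def)
    have "x * y = (f * f') * (g * g')" by (simp add: * mult_ac)
    then show ?thesis unfolding M_def
      using * by (intro CollectI exI[of _ "f * f'"] exI[of _ "g * g'"])
        (auto simp: psub_mult is_prime_idealD(3)[OF P] is_prime_idealD(3)[OF P'])
  qed
  moreover have "J \<inter> M = {}"
    using amalgamation_disjoint[OF P P' UZ eq'] by (auto simp: J_def M_def)
  moreover have "1 \<in> M" using M1[of 1] is_prime_idealD(2)[OF P] by auto
  ultimately obtain Q where Q: "is_prime_ideal Q" "J \<subseteq> Q" "Q \<inter> M = {}"
    using exists_prime_ideal_disjoint[OF J] by blast
  have JP: "a \<in> J" if "a \<in> P \<inter> psub U \<or> a \<in> P' \<inter> psub Z" for a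
    unfolding J_def using that by (intro addspan_incl CollectI exI[of _ 1] exI[of _ a]) auto
  show ?thesis
  proof (rule that[OF Q(1)])
    show "f \<in> Q \<longleftrightarrow> f \<in> P" if "f \<in> psub U" for f
      using that JP[of f] M1[of f] Q by auto
    show "f \<in> Q \<longleftrightarrow> f \<in> P'" if "f \<in> psub Y" for f
    proof -
      have "f \<in> psub Z" using that psub_mono[of Y Z] by (auto simp: Z_def)
      then show ?thesis using JP[of f] M2[of f] Q by auto
    qed
  qed
qed

section \<open>Extending a partial shift to an automorphism\<close>

text \<open>The variable \<open>(j, k)\<close> stands for the formal image of \<open>X\<^sub>j\<close> under the \<open>k\<close>-th power of the automorphism
  to be built. The shift \<open>(j, k) \<mapsto> (j, k + 1)\<close> is followed by the involution exchanging
  \<open>(i, 1)\<close> and \<open>(\<tau> i, 0)\<close>, so that \<open>(i, 0) \<mapsto> (\<tau> i, 0)\<close> for \<open>i < m\<close>. The set \<open>window a b\<close> omits the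
  iterated preimages of the \<open>(j, 0)\<close> from before time \<open>a\<close> and the iterated images from after time \<open>b\<close>.\<close>

locale partial_shift =
  fixes \<sigma> \<sigma>' :: "'a::comm_ring_1 \<Rightarrow> 'a" and m n :: nat and \<tau> :: "nat \<Rightarrow> nat"
  assumes \<sigma>: "rhom \<sigma>" and \<sigma>': "rhom \<sigma>'" and \<sigma>\<sigma>': "\<And>x. \<sigma> (\<sigma>' x) = x" and \<sigma>'\<sigma>: "\<And>x. \<sigma>' (\<sigma> x) = x"
    and mn: "m \<le> n" and \<tau>: "\<And>i. i < m \<Longrightarrow> \<tau> i < n" and inj\<tau>: "inj_on \<tau> {..<m}"
begin

text \<open>Redirecting \<open>(i, 0)\<close> to \<open>(\<tau> i, 0)\<close> leaves
  \<open>(i, 1)\<close> without a preimage and \<open>(\<tau> i, - 1)\<close> without an image of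
  its own. The exchange sends the latter to the former, which keeps the shift bijective. The orbits
  through these two variables contain no variable at time 0 with first index below
  \<open>n\<close>.\<close>

definition exchange :: "nat \<times> int \<Rightarrow> nat \<times> int" where
  "exchange = (\<lambda>(j, k). if k = 1 \<and> j < m then (\<tau> j, 0)
     else if k = 0 \<and> j \<in> \<tau> ` {..<m} then (inv_into {..<m} \<tau> j, 1) else (j, k))"

definition shift :: "nat \<times> int \<Rightarrow> nat \<times> int" where
  "shift = (\<lambda>(j, k). exchange (j, k + 1))"

definition unshift :: "nat \<times> int \<Rightarrow> nat \<times> int" where
  "unshift x = (fst (exchange x), snd (exchange x) - 1)"

definition window :: "int \<Rightarrow> int \<Rightarrow> (nat \<times> int) set" where
  "window a b = {(j, l). \<not> (l < a \<and> j < n \<and> j \<notin> \<tau> ` {..<m}) \<and> \<not> (b < l \<and> m \<le> j \<and> j < n)}"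

lemma inv_into_\<tau>: "j \<in> \<tau> ` {..<m} \<Longrightarrow> inv_into {..<m} \<tau> j < m \<and> \<tau> (inv_into {..<m} \<tau> j) = j"
  using f_inv_into_f[of j \<tau> "{..<m}"] inv_into_into[of j \<tau> "{..<m}"] by simp

lemma exchange_exchange: "exchange (exchange x) = x"
proof (cases x)
  case (Pair j k)
  then show ?thesis
    using inv_into_\<tau>[of j] inv_into_f_f[OF inj\<tau>, of j] by (auto simp: exchange_def)
qed

lemma shift_unshift: "shift (unshift x) = x"
  by (simp add: shift_def unshift_def exchange_exchange)

lemma unshift_shift: "unshift (shift x) = x"
  by (cases x) (simp add: shift_def unshift_def exchange_exchange)

lemma shift_0: "i < m \<Longrightarrow> shift (i, 0) = (\<tau> i, 0)"
  by (simp add: shift_def exchange_def)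

lemma shift_window:
  assumes "a \<le> 0" "- 1 \<le> b"
  shows "shift x \<in> window (a + 1) (b + 1) \<longleftrightarrow> x \<in> window a b"
proof (cases x)
  case (Pair j k)
  show ?thesis
  proof (cases "k = 0 \<and> j < m")
    case True
    then show ?thesis using assms Pair by (auto simp: shift_0 window_def)
  next
    case False
    show ?thesis
    proof (cases "k = - 1 \<and> j \<in> \<tau> ` {..<m}")
      case True
      then have "shift x = (inv_into {..<m} \<tau> j, 1)"
        using Pair by (auto simp: shift_def exchange_def)
      then show ?thesis
        using inv_into_\<tau>[of j] True assms Pair by (auto simp: window_def)
    next
      case F: False
      then have "shift x = (j, k + 1)" using False Pair by (auto simp: shift_def exchange_def)
      then show ?thesis using F False assms Pair by (auto simp: window_def)
    qed
  qed
qed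

section \<open>The automorphism of the polynomial ring induced by the shift\<close>

definition S :: "((nat \<times> int \<Rightarrow>\<^sub>0 nat) \<Rightarrow>\<^sub>0 'a) \<Rightarrow> (nat \<times> int \<Rightarrow>\<^sub>0 nat) \<Rightarrow>\<^sub>0 'a" where
  "S = ev (\<lambda>c. pconst (\<sigma> c)) (\<lambda>x. pvar (shift x))"

definition S' :: "((nat \<times> int \<Rightarrow>\<^sub>0 nat) \<Rightarrow>\<^sub>0 'a) \<Rightarrow> (nat \<times> int \<Rightarrow>\<^sub>0 nat) \<Rightarrow>\<^sub>0 'a" where
  "S' = ev (\<lambda>c. pconst (\<sigma>' c)) (\<lambda>x. pvar (unshift x))"

lemma rhom_pconst_\<sigma>: "rhom (\<lambda>c. pconst (\<sigma> c))" "rhom (\<lambda>c. pconst (\<sigma>' c))"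
  by (rule rhom_comp[OF rhom_pconst] \<sigma> \<sigma>')+

lemma rhom_S: "rhom S" and rhom_S': "rhom S'"
  by (auto simp: S_def S'_def rhom_ev rhom_pconst_\<sigma>)

lemma S_pconst: "S (pconst c) = pconst (\<sigma> c)" and S_pvar: "S (pvar x) = pvar (shift x)"
  by (simp_all add: S_def ev_pconst ev_pvar rhom_pconst_\<sigma>)

lemma S'_pconst: "S' (pconst c) = pconst (\<sigma>' c)" and S'_pvar: "S' (pvar x) = pvar (unshift x)"
  by (simp_all add: S'_def ev_pconst ev_pvar rhom_pconst_\<sigma>)

lemma S_S': "S (S' p) = p"
  by (rule rhom_eq_on_psub[OF rhom_comp[OF rhom_S rhom_S'] rhom_id, where A = UNIV])
    (simp_all add: S_pconst S'_pconst S_pvar S'_pvar \<sigma>\<sigma>' shift_unshift psub_UNIV)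

lemma S'_S: "S' (S p) = p"
  by (rule rhom_eq_on_psub[OF rhom_comp[OF rhom_S' rhom_S] rhom_id, where A = UNIV])
    (simp_all add: S_pconst S'_pconst S_pvar S'_pvar \<sigma>'\<sigma> unshift_shift psub_UNIV)

lemma S_psub:
  assumes "a \<le> 0" "- 1 \<le> b"
  shows "S p \<in> psub (window (a + 1) (b + 1)) \<longleftrightarrow> p \<in> psub (window a b)"
proof
  assume "p \<in> psub (window a b)"
  then show "S p \<in> psub (window (a + 1) (b + 1))"
    unfolding S_def by (rule ev_in_psub[OF rhom_pconst_\<sigma>(1)]) (use assms in \<open>auto intro!: psub_pvar simp: shift_window\<close>)
next
  have "unshift i \<in> window a b" if "i \<in> window (a + 1) (b + 1)" for i
    using shift_window[OF assms, of "unshift i"] that by (simp add: shift_unshift)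
  moreover assume "S p \<in> psub (window (a + 1) (b + 1))"
  ultimately have "S' (S p) \<in> psub (window a b)"
    unfolding S'_def by (intro ev_in_psub[OF rhom_pconst_\<sigma>(2)]) (auto intro!: psub_pvar)
  then show "p \<in> psub (window a b)" by (simp add: S'_S)
qed

lemma is_prime_ideal_vimage:
  assumes "rhom f" "is_prime_ideal P"
  shows "is_prime_ideal {x. f x \<in> P}"
  using assms(2) unfolding is_prime_ideal_def is_ideal_def mem_Collect_eq Ball_def rhom_simps[OF assms(1)]
  by blast

text \<open>\<open>S\<close> maps polynomials over \<open>window a (b - 1)\<close> to polynomials
  over \<open>window (a + 1) b\<close>. Both windows are contained in \<open>window a b\<close>, so
  the invariance is required exactly where it concerns the trace of \<open>P\<close> on that
  window.\<close>

definition stable :: "int \<Rightarrow> int \<Rightarrow> ((nat \<times> int \<Rightarrow>\<^sub>0 nat) \<Rightarrow>\<^sub>0 'a) set \<Rightarrow> bool" where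
  "stable a b P \<longleftrightarrow> is_prime_ideal P \<and> (\<forall>f\<in>psub (window a (b - 1)). S f \<in> P \<longleftrightarrow> f \<in> P)"

text \<open>Amalgamates \<open>P\<close> over \<open>window a b\<close> with its image under
  \<open>S\<close> over \<open>window (a + 1) (b + 1)\<close>. They agree on the overlap
  \<open>window (a + 1) b\<close> by the invariance already achieved.\<close>

lemma stable_forward:
  assumes "stable a b P" "a \<le> 0" "0 \<le> b"
  shows "\<exists>Q. stable a (b + 1) Q \<and> (\<forall>f\<in>psub (window a b). f \<in> Q \<longleftrightarrow> f \<in> P)"
proof -
  have P: "is_prime_ideal P" "\<And>f. f \<in> psub (window a (b - 1)) \<Longrightarrow> S f \<in> P \<longleftrightarrow> f \<in> P"
    using assms(1) by (auto simp: stable_def)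
  have inter: "window a b \<inter> window (a + 1) (b + 1) = window (a + 1) b" by (auto simp: window_def)
  have "g \<in> P \<longleftrightarrow> S' g \<in> P" if "g \<in> psub (window (a + 1) b)" for g
    using S_psub[of a "b - 1" "S' g"] that assms P(2)[of "S' g"] by (simp add: S_S')
  then have "P \<inter> psub (window a b \<inter> window (a + 1) (b + 1))
      = {f. S' f \<in> P} \<inter> psub (window a b \<inter> window (a + 1) (b + 1))"
    unfolding inter by blast
  from amalgamation[OF P(1) is_prime_ideal_vimage[OF rhom_S' P(1)] this]
  obtain Q where Q: "is_prime_ideal Q" "\<And>f. f \<in> psub (window a b) \<Longrightarrow> f \<in> Q \<longleftrightarrow> f \<in> P"
    "\<And>f. f \<in> psub (window (a + 1) (b + 1)) \<Longrightarrow> f \<in> Q \<longleftrightarrow> S' f \<in> P" by auto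
  have "S f \<in> Q \<longleftrightarrow> f \<in> Q" if "f \<in> psub (window a b)" for f
    using Q(2)[OF that] Q(3)[of "S f"] S_psub[of a b f] that assms by (simp add: S'_S)
  then show ?thesis using Q by (auto simp: stable_def)
qed

text \<open>Mirror image of \<open>stable_forward\<close>, with the preimage of \<open>P\<close>
  under \<open>S\<close> over \<open>window (a - 1) (b - 1)\<close>.\<close>

lemma stable_backward:
  assumes "stable a b P" "a \<le> 0" "0 \<le> b"
  shows "\<exists>Q. stable (a - 1) b Q \<and> (\<forall>f\<in>psub (window a b). f \<in> Q \<longleftrightarrow> f \<in> P)"
proof -
  have P: "is_prime_ideal P" "\<And>f. f \<in> psub (window a (b - 1)) \<Longrightarrow> S f \<in> P \<longleftrightarrow> f \<in> P"
    using assms(1) by (auto simp: stable_def)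
  have inter: "window a b \<inter> window (a - 1) (b - 1) = window a (b - 1)" by (auto simp: window_def)
  have "P \<inter> psub (window a b \<inter> window (a - 1) (b - 1))
      = {f. S f \<in> P} \<inter> psub (window a b \<inter> window (a - 1) (b - 1))"
    unfolding inter using P(2) by blast
  from amalgamation[OF P(1) is_prime_ideal_vimage[OF rhom_S P(1)] this]
  obtain Q where Q: "is_prime_ideal Q" "\<And>f. f \<in> psub (window a b) \<Longrightarrow> f \<in> Q \<longleftrightarrow> f \<in> P"
    "\<And>f. f \<in> psub (window (a - 1) (b - 1)) \<Longrightarrow> f \<in> Q \<longleftrightarrow> S f \<in> P" by auto
  have "S f \<in> Q \<longleftrightarrow> f \<in> Q" if "f \<in> psub (window (a - 1) (b - 1))" for f
    using Q(3)[OF that] Q(2)[of "S f"] S_psub[of "a - 1" "b - 1" f] that assms by simp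
  then show ?thesis using Q by (auto simp: stable_def)
qed

lemma stable_extend:
  assumes "stable (- int k) (int k) P"
  shows "\<exists>Q. stable (- int (Suc k)) (int (Suc k)) Q \<and> (\<forall>f\<in>psub (window (- int k) (int k)). f \<in> Q \<longleftrightarrow> f \<in> P)"
proof -
  from stable_forward[OF assms] obtain Q where Q: "stable (- int k) (int k + 1) Q"
    "\<forall>f\<in>psub (window (- int k) (int k)). f \<in> Q \<longleftrightarrow> f \<in> P" by auto
  from stable_backward[OF Q(1)] obtain R where R: "stable (- int k - 1) (int k + 1) R"
    "\<forall>f\<in>psub (window (- int k) (int k + 1)). f \<in> R \<longleftrightarrow> f \<in> Q" by auto
  have "(psub (window (- int k) (int k)) :: ((nat \<times> int \<Rightarrow>\<^sub>0 nat) \<Rightarrow>\<^sub>0 'a) set) \<subseteq> psub (window (- int k) (int k + 1))"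
    by (rule psub_mono) (auto simp: window_def)
  moreover have "stable (- int (Suc k)) (int (Suc k)) R"
    using R(1) by (metis minus_add_distrib of_nat_Suc add.commute diff_conv_add_uminus)
  ultimately show ?thesis using Q(2) R by (intro exI[of _ R]) (auto simp: subset_iff simp del: of_nat_Suc)
qed

lemma psub_window_mono: "k \<le> l \<Longrightarrow> psub (window (- int k) (int k)) \<subseteq> psub (window (- int l) (int l))"
  by (rule psub_mono) (auto simp: window_def)

lemma ex_psub_window: "\<exists>k. (f :: (nat \<times> int \<Rightarrow>\<^sub>0 nat) \<Rightarrow>\<^sub>0 'a) \<in> psub (window (- int k) (int k))"
proof (rule psub_induct[of f UNIV])
  fix i :: "nat \<times> int"
  have "i \<in> window (- int (nat \<bar>snd i\<bar>)) (int (nat \<bar>snd i\<bar>))" by (cases i) (auto simp: window_def)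
  then show "\<exists>k. (pvar i :: (nat \<times> int \<Rightarrow>\<^sub>0 nat) \<Rightarrow>\<^sub>0 'a) \<in> psub (window (- int k) (int k))" by (intro exI psub_pvar)
next
  fix p q :: "(nat \<times> int \<Rightarrow>\<^sub>0 nat) \<Rightarrow>\<^sub>0 'a"
  assume "\<exists>k. p \<in> psub (window (- int k) (int k))" "\<exists>k. q \<in> psub (window (- int k) (int k))"
  then obtain k l where "p \<in> psub (window (- int k) (int k))" "q \<in> psub (window (- int l) (int l))" by blast
  then have *: "p \<in> psub (window (- int (max k l)) (int (max k l)))" "q \<in> psub (window (- int (max k l)) (int (max k l)))"
    using psub_window_mono[of k "max k l"] psub_window_mono[of l "max k l"] by auto
  show "\<exists>k. p + q \<in> psub (window (- int k) (int k))" using psub_add[OF *] by blast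
  show "\<exists>k. p * q \<in> psub (window (- int k) (int k))" using psub_mult[OF *] by blast
qed (auto simp: psub_UNIV)

text \<open>The traces on growing windows are coherent, and each polynomial, having finitely many
  variables, lies over some window. So the union of the traces inherits primality and invariance
  from the stages.\<close>

lemma exists_S_invariant_prime:
  assumes "stable 0 0 P"
  obtains Q where "is_prime_ideal Q" "\<And>f. S f \<in> Q \<longleftrightarrow> f \<in> Q"
    "\<And>f. f \<in> psub (window 0 0) \<Longrightarrow> f \<in> Q \<longleftrightarrow> f \<in> P"
proof -
  define R where "R k = window (- int k) (int k)" for k
  have "\<exists>p. \<forall>k. (stable (- int k) (int k) (p k) \<and> (k = 0 \<longrightarrow> p k = P)) \<and> (\<forall>f\<in>psub (R k). f \<in> p (Suc k) \<longleftrightarrow> f \<in> p k)"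
    by (rule dependent_nat_choice) (use assms stable_extend in \<open>auto simp: R_def\<close>)
  then obtain p where p: "\<And>k. stable (- int k) (int k) (p k)" "p 0 = P"
    "\<And>k f. f \<in> psub (R k) \<Longrightarrow> f \<in> p (Suc k) \<longleftrightarrow> f \<in> p k" by blast
  have pp: "is_prime_ideal (p k)" for k using p(1) by (simp add: stable_def)
  have mono: "(psub (R k) :: ((nat \<times> int \<Rightarrow>\<^sub>0 nat) \<Rightarrow>\<^sub>0 'a) set) \<subseteq> psub (R l)" if "k \<le> l" for k l
    using psub_window_mono[OF that] by (simp add: R_def)
  have pl: "f \<in> p l \<longleftrightarrow> f \<in> p k" if "f \<in> psub (R k)" "k \<le> l" for f k l
    using that(2)
  proof (induction l rule: dec_induct)
    case (step l)
    then show ?case using p(3)[of f l] mono[of k l] that(1) by auto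
  qed simp
  define Q where "Q = {f. \<exists>k. f \<in> psub (R k) \<and> f \<in> p k}"
  have Qk: "f \<in> Q \<longleftrightarrow> f \<in> p k" if f: "f \<in> psub (R k)" for f k
  proof
    assume "f \<in> Q"
    then obtain l where l: "f \<in> psub (R l)" "f \<in> p l" by (auto simp: Q_def)
    then show "f \<in> p k" using pl[OF f, of "max k l"] pl[OF l(1), of "max k l"] by auto
  qed (use f in \<open>auto simp: Q_def\<close>)
  have ex: "\<exists>k. f \<in> psub (R k) \<and> g \<in> psub (R k)" for f g :: "(nat \<times> int \<Rightarrow>\<^sub>0 nat) \<Rightarrow>\<^sub>0 'a"
  proof -
    obtain k l where "f \<in> psub (R k)" "g \<in> psub (R l)" using ex_psub_window[of f] ex_psub_window[of g] R_def by auto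
    then show ?thesis using mono[of k "max k l"] mono[of l "max k l"] by (intro exI[of _ "max k l"]) auto
  qed
  show ?thesis
  proof (rule that)
    show "is_prime_ideal Q" unfolding is_prime_ideal_def is_ideal_def
    proof (intro conjI allI ballI impI)
      show "0 \<in> Q" using Qk[of 0 0] is_ideal_0[OF is_prime_idealD(1)[OF pp]] by simp
      show "1 \<notin> Q" using Qk[of 1 0] is_prime_idealD(2)[OF pp] by simp
    next
      fix x y assume "x \<in> Q" "y \<in> Q"
      moreover obtain k where k: "x \<in> psub (R k)" "y \<in> psub (R k)" using ex by blast
      ultimately show "x + y \<in> Q"
        using is_ideal_add[OF is_prime_idealD(1)[OF pp[of k]], of x y]
        by (simp add: Qk[OF k(1)] Qk[OF k(2)] Qk[OF psub_add[OF k]])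
    next
      fix r x :: "(nat \<times> int \<Rightarrow>\<^sub>0 nat) \<Rightarrow>\<^sub>0 'a" assume "x \<in> Q"
      moreover obtain k where k: "r \<in> psub (R k)" "x \<in> psub (R k)" using ex by blast
      ultimately show "r * x \<in> Q"
        using is_ideal_mult[OF is_prime_idealD(1)[OF pp[of k]], of x r]
        by (simp add: Qk[OF k(2)] Qk[OF psub_mult[OF k]])
    next
      fix x y assume "x * y \<in> Q"
      moreover obtain k where k: "x \<in> psub (R k)" "y \<in> psub (R k)" using ex by blast
      ultimately show "x \<in> Q \<or> y \<in> Q"
        using is_prime_idealD(3)[OF pp[of k], of x y]
        by (simp add: Qk[OF k(1)] Qk[OF k(2)] Qk[OF psub_mult[OF k]])
    qed
    show "f \<in> Q \<longleftrightarrow> f \<in> P" if "f \<in> psub (window 0 0)" for f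
      using Qk[of f 0] that p(2) by (simp add: R_def)
    show "S f \<in> Q \<longleftrightarrow> f \<in> Q" for f
    proof -
      obtain k where k: "f \<in> psub (R k)" "S f \<in> psub (R k)" using ex by blast
      then have "f \<in> psub (R (Suc k))" "S f \<in> psub (R (Suc k))" using mono[of k "Suc k"] by auto
      \<comment> \<open>Stage \<open>k\<close> controls \<open>S\<close> only up to time
        \<open>k - 1\<close>; the next stage controls it on all of \<open>R k\<close>.\<close>
      moreover have "psub (R k) \<subseteq> (psub (window (- int (Suc k)) (int (Suc k) - 1)) :: ((nat \<times> int \<Rightarrow>\<^sub>0 nat) \<Rightarrow>\<^sub>0 'a) set)"
        by (rule psub_mono) (auto simp: window_def R_def)
      then have "S f \<in> p (Suc k) \<longleftrightarrow> f \<in> p (Suc k)"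
        using p(1)[of "Suc k"] k unfolding stable_def by blast
      ultimately show ?thesis using Qk by blast
    qed
  qed
qed

section \<open>The prime ideal at the base of the tower\<close>

definition T :: "((nat \<Rightarrow>\<^sub>0 nat) \<Rightarrow>\<^sub>0 'a) \<Rightarrow> (nat \<Rightarrow>\<^sub>0 nat) \<Rightarrow>\<^sub>0 'a" where
  "T = ev (\<lambda>c. pconst (\<sigma> c)) (\<lambda>i. pvar (\<tau> i))"

text \<open>\<open>I\<close> is pulled back to the large ring along \<open>\<rho>\<close>, which
  kills every variable except the \<open>(j, 0)\<close> with \<open>j < n\<close>. The pullback is
  prime because \<open>\<rho>\<close> has values in \<open>psub {..<n}\<close>, and the
  compatibility of \<open>I\<close> makes it \<open>stable 0 0\<close>.\<close>

lemma exists_invariant_prime_extending: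
  assumes I0: "0 \<in> I" and Iadd: "\<And>x y. x \<in> I \<Longrightarrow> y \<in> I \<Longrightarrow> x + y \<in> I"
    and Imult: "\<And>r x. r \<in> psub {..<n} \<Longrightarrow> x \<in> I \<Longrightarrow> r * x \<in> I" and I1: "1 \<notin> I"
    and Iprime: "\<And>x y. x \<in> psub {..<n} \<Longrightarrow> y \<in> psub {..<n} \<Longrightarrow> x * y \<in> I \<Longrightarrow> x \<in> I \<or> y \<in> I"
    and In: "I \<subseteq> psub {..<n}"
    and comp: "\<And>f. f \<in> psub {..<m} \<Longrightarrow> T f \<in> I \<longleftrightarrow> f \<in> I"
  obtains Q where "is_prime_ideal Q" "\<And>f. S f \<in> Q \<longleftrightarrow> f \<in> Q"
    "\<And>f. f \<in> I \<Longrightarrow> ev pconst (\<lambda>j. pvar (j, 0)) f \<in> Q"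
proof -
  define v where "v = (\<lambda>(j, k::int). if k = 0 \<and> j < n then pvar j else (0 :: (nat \<Rightarrow>\<^sub>0 nat) \<Rightarrow>\<^sub>0 'a))"
  define \<rho> where "\<rho> = ev pconst v"
  have \<rho>: "rhom \<rho>" by (simp add: \<rho>_def rhom_ev rhom_pconst)
  have \<rho>c: "\<rho> (pconst c) = pconst c" and \<rho>v: "\<rho> (pvar x) = v x" for c x
    by (simp_all add: \<rho>_def ev_pconst ev_pvar rhom_pconst)
  have \<rho>n: "\<rho> f \<in> psub {..<n}" for f
    unfolding \<rho>_def
    by (rule ev_in_psub[OF rhom_pconst, of _ UNIV]) (auto simp: psub_UNIV v_def intro: psub_pvar split: prod.splits)
  have T: "rhom T" by (simp add: T_def rhom_ev rhom_pconst_\<sigma>)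
  have Tc: "T (pconst c) = pconst (\<sigma> c)" and Tv: "T (pvar i) = pvar (\<tau> i)" for c i
    by (simp_all add: T_def ev_pconst ev_pvar rhom_pconst_\<sigma>)
  \<comment> \<open>Outside the exchanged variables both sides vanish: in this window,
    \<open>(j, 0)\<close> with \<open>m \<le> j\<close> and \<open>(j, - 1)\<close> with
    \<open>j\<close> not a value of \<tau> on \<open>{..<m}\<close> occur only for
    \<open>n \<le> j\<close>.\<close>
  have vS: "T (v x) = v (shift x)" "v x \<in> psub {..<m}" if "x \<in> window 0 (- 1)" for x
  proof -
    obtain j k where x: "x = (j, k)" by (cases x)
    consider "k = 0 \<and> j < m" | "k = - 1 \<and> j \<in> \<tau> ` {..<m}" | "\<not> (k = 0 \<and> j < m)" "\<not> (k = - 1 \<and> j \<in> \<tau> ` {..<m})"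
      by blast
    then have "T (v x) = v (shift x) \<and> v x \<in> psub {..<m}"
    proof cases
      case 1
      then show ?thesis using x \<tau> mn by (auto simp: v_def shift_0 Tv intro: psub_pvar)
    next
      case 2
      then have "shift x = (inv_into {..<m} \<tau> j, 1)"
        using x by (auto simp: shift_def exchange_def)
      then show ?thesis using x 2 by (auto simp: v_def rhom_0[OF T])
    next
      case 3
      then have "shift x = (j, k + 1)" using x by (auto simp: shift_def exchange_def)
      then show ?thesis using x 3 that by (auto simp: v_def window_def rhom_0[OF T])
    qed
    then show "T (v x) = v (shift x)" "v x \<in> psub {..<m}" by auto
  qed
  have \<rho>S: "\<rho> (S f) = T (\<rho> f)" if "f \<in> psub (window 0 (- 1))" for f
    by (rule rhom_eq_on_psub[OF rhom_comp[OF \<rho> rhom_S] rhom_comp[OF T \<rho>] _ _ that])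
      (simp_all add: S_pconst S_pvar \<rho>c \<rho>v Tc vS)
  have \<rho>m: "\<rho> f \<in> psub {..<m}" if "f \<in> psub (window 0 (- 1))" for f
    unfolding \<rho>_def using that by (rule ev_in_psub[OF rhom_pconst]) (auto simp: vS)
  have "is_prime_ideal {f. \<rho> f \<in> I}"
    unfolding is_prime_ideal_def is_ideal_def
    using I0 Iadd Imult I1 Iprime \<rho>n by (auto simp: rhom_simps[OF \<rho>])
  then have "stable 0 0 {f. \<rho> f \<in> I}"
    using \<rho>S \<rho>m comp by (simp add: stable_def)
  from exists_S_invariant_prime[OF this] obtain Q where Q: "is_prime_ideal Q" "\<And>f. S f \<in> Q \<longleftrightarrow> f \<in> Q"
    "\<And>f. f \<in> psub (window 0 0) \<Longrightarrow> f \<in> Q \<longleftrightarrow> \<rho> f \<in> I" by auto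
  show ?thesis
  proof (rule that[OF Q(1,2)])
    fix f assume f: "f \<in> I"
    let ?\<iota> = "ev pconst (\<lambda>j. pvar (j, 0 :: int)) :: ((nat \<Rightarrow>\<^sub>0 nat) \<Rightarrow>\<^sub>0 'a) \<Rightarrow> _"
    have \<iota>: "rhom ?\<iota>" by (simp add: rhom_ev rhom_pconst)
    have "\<rho> (?\<iota> f) = f"
      by (rule rhom_eq_on_psub[OF rhom_comp[OF \<rho> \<iota>] rhom_id _ _ subsetD[OF In f]])
        (simp_all add: ev_pconst ev_pvar rhom_pconst \<rho>c \<rho>v v_def)
    moreover have "?\<iota> f \<in> psub (window 0 0)"
      by (rule ev_in_psub[OF rhom_pconst, of _ UNIV]) (auto simp: psub_UNIV window_def intro!: psub_pvar)
    ultimately show "?\<iota> f \<in> Q" using Q(3) f by simp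
  qed
qed

end

section \<open>Coding the fraction field of a prime quotient into a large enough type\<close>

lemma inj_list_if_infinite:
  assumes "infinite (UNIV :: 'b set)"
  shows "\<exists>g :: 'b list \<Rightarrow> 'b. inj g"
proof -
  obtain p :: "'b \<times> 'b \<Rightarrow> 'b" where "bij_betw p (UNIV \<times> UNIV) UNIV"
    using card_of_Times_same_infinite[OF assms] unfolding card_of_ordIso[symmetric] by blast
  then have p: "p x = p y \<longleftrightarrow> x = y" for x y
    by (simp add: bij_betw_def inj_eq)
  obtain \<nu> :: "nat \<Rightarrow> 'b" where \<nu>: "inj \<nu>"
    using infinite_countable_subset[OF assms] by blast
  \<comment> \<open>Iterated pairing with a fixed end marker separates only lists of equal length,
    so the length is recorded as well.\<close>
  define e where "e = (\<lambda>xs. foldr (\<lambda>x y. p (x, y)) xs (\<nu> 0))"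
  have e: "xs = ys" if "length xs = length ys" "e xs = e ys" for xs ys
    using that by (induction rule: list_induct2) (auto simp: e_def p)
  have "inj (\<lambda>xs. p (\<nu> (length xs), e xs))"
    by (rule injI) (simp add: p inj_eq[OF \<nu>] e)
  then show ?thesis by blast
qed

lemma inj_pair_if_infinite:
  assumes "infinite (UNIV :: 'b set)" "inj (a :: 'k \<Rightarrow> 'b)" "inj (c :: 'v \<Rightarrow> 'b)"
  shows "\<exists>g :: 'k \<times> 'v \<Rightarrow> 'b. inj g"
proof -
  obtain l :: "'b list \<Rightarrow> 'b" where l: "inj l" using inj_list_if_infinite[OF assms(1)] by blast
  have "inj (\<lambda>(x, y). l [a x, c y])"
    by (rule injI) (auto simp: inj_eq[OF l] inj_eq[OF assms(2)] inj_eq[OF assms(3)])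
  then show ?thesis by blast
qed

text \<open>A finitely supported map is determined by its finite graph over the support. The graph
  is coded by one chosen list enumerating it.\<close>

lemma inj_poly_mapping_if_infinite:
  assumes "infinite (UNIV :: 'b set)" "inj (a :: 'k \<Rightarrow> 'b)" "inj (c :: 'v::zero \<Rightarrow> 'b)"
  shows "\<exists>g :: ('k \<Rightarrow>\<^sub>0 'v) \<Rightarrow> 'b. inj g"
proof -
  obtain l :: "'b list \<Rightarrow> 'b" where l: "inj l" using inj_list_if_infinite[OF assms(1)] by blast
  obtain p :: "'k \<times> 'v \<Rightarrow> 'b" where p: "inj p" using inj_pair_if_infinite[OF assms] by blast
  define s where "s f = (\<lambda>m. p (m, Poly_Mapping.lookup f m)) ` Poly_Mapping.keys f" for f
  define r where "r f = (SOME xs. set xs = s f)" for f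
  have r: "set (r f) = s f" for f
    unfolding r_def by (rule someI_ex, rule finite_list) (simp add: s_def)
  have eq: "Poly_Mapping.lookup f m = Poly_Mapping.lookup f' m"
    if "s f = s f'" "m \<in> Poly_Mapping.keys f" for f f' m
  proof -
    from that have "p (m, Poly_Mapping.lookup f m) \<in> s f'" by (auto simp: s_def)
    then show ?thesis by (auto simp: s_def inj_eq[OF p])
  qed
  have "inj (\<lambda>f. l (r f))"
  proof (rule injI, rule poly_mapping_eqI)
    fix f f' m assume "l (r f) = l (r f')"
    then have "r f = r f'" by (rule injD[OF l])
    then have s: "s f = s f'" using r[of f] r[of f'] by simp
    consider "m \<in> Poly_Mapping.keys f" | "m \<in> Poly_Mapping.keys f'"
      | "m \<notin> Poly_Mapping.keys f" "m \<notin> Poly_Mapping.keys f'" by blast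
    then show "Poly_Mapping.lookup f m = Poly_Mapping.lookup f' m"
    proof cases
      case 1
      then show ?thesis by (rule eq[OF s])
    next
      case 2
      then show ?thesis by (rule eq[OF s[symmetric], symmetric])
    qed (simp add: in_keys_iff)
  qed
  then show ?thesis by blast
qed

locale coded_fractions =
  fixes P :: "'r::comm_ring_1 set" and g :: "'r \<times> 'r \<Rightarrow> 'b"
  assumes P: "is_prime_ideal P" and g: "inj g"
begin

definition eqv :: "'r \<times> 'r \<Rightarrow> 'r \<times> 'r \<Rightarrow> bool" where
  "eqv x y \<longleftrightarrow> fst x * snd y - fst y * snd x \<in> P"

text \<open>A class of fractions is coded by one chosen member. The choice depends on the class
  only, so equivalent fractions receive equal codes; injectivity of \<open>g\<close> gives the
  converse.\<close>

definition code :: "'r \<times> 'r \<Rightarrow> 'b" where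
  "code x = g (SOME y. snd y \<notin> P \<and> eqv y x)"

definition decode :: "'b \<Rightarrow> 'r \<times> 'r" where
  "decode u = (SOME x. snd x \<notin> P \<and> code x = u)"

definition fmul :: "'r \<times> 'r \<Rightarrow> 'r \<times> 'r \<Rightarrow> 'r \<times> 'r" where
  "fmul x y = (fst x * fst y, snd x * snd y)"

definition fadd :: "'r \<times> 'r \<Rightarrow> 'r \<times> 'r \<Rightarrow> 'r \<times> 'r" where
  "fadd x y = (fst x * snd y + fst y * snd x, snd x * snd y)"

definition L :: "'b ring" where
  "L = \<lparr>carrier = code ` {x. snd x \<notin> P}, monoid.mult = \<lambda>u v. code (fmul (decode u) (decode v)),
     one = code (1, 1), ring.zero = code (0, 1), add = \<lambda>u v. code (fadd (decode u) (decode v))\<rparr>"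

lemma ideal_P: "is_ideal P" and one_P: "1 \<notin> P" and mult_P: "x * y \<in> P \<longleftrightarrow> x \<in> P \<or> y \<in> P"
  using is_prime_idealD[OF P] by blast+

lemma eqv_refl: "eqv x x"
  using is_ideal_0[OF ideal_P] by (simp add: eqv_def)

lemma eqv_sym: "eqv x y \<Longrightarrow> eqv y x"
  using is_ideal_uminus[OF ideal_P] by (fastforce simp: eqv_def)

lemma eqv_trans:
  assumes "eqv x y" "eqv y z" "snd y \<notin> P"
  shows "eqv x z"
proof -
  \<comment> \<open>The difference lies in \<open>P\<close> only after multiplication by
    \<open>snd y\<close>; primality allows this factor to be cancelled.\<close>
  have "snd y * (fst x * snd z - fst z * snd x)
      = snd z * (fst x * snd y - fst y * snd x) + snd x * (fst y * snd z - fst z * snd y)"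
    by (simp add: algebra_simps)
  also have "\<dots> \<in> P"
    using assms by (simp add: eqv_def is_ideal_add[OF ideal_P] is_ideal_mult[OF ideal_P])
  finally show ?thesis using assms(3) by (simp add: eqv_def mult_P)
qed

lemma code_eq_iff:
  assumes "snd x \<notin> P" "snd y \<notin> P"
  shows "code x = code y \<longleftrightarrow> eqv x y"
proof
  have ex: "snd (SOME y. snd y \<notin> P \<and> eqv y x) \<notin> P \<and> eqv (SOME y. snd y \<notin> P \<and> eqv y x) x"
    if "snd x \<notin> P" for x
    by (rule someI[of _ x]) (simp add: that eqv_refl)
  assume "code x = code y"
  then have "(SOME z. snd z \<notin> P \<and> eqv z x) = (SOME z. snd z \<notin> P \<and> eqv z y)"
    unfolding code_def by (rule injD[OF g])
  then show "eqv x y" using ex[OF assms(1)] ex[OF assms(2)]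
    by (auto intro: eqv_trans[OF eqv_sym])
next
  assume xy: "eqv x y"
  have "(snd z \<notin> P \<and> eqv z x) = (snd z \<notin> P \<and> eqv z y)" for z
    using xy eqv_sym[OF xy] eqv_trans[of z x y] eqv_trans[of z y x] assms by blast
  then show "code x = code y" by (simp add: code_def)
qed

lemma code_eqI:
  "snd x \<notin> P \<Longrightarrow> snd y \<notin> P \<Longrightarrow> fst x * snd y = fst y * snd x \<Longrightarrow> code x = code y"
  using is_ideal_0[OF ideal_P] by (simp add: code_eq_iff eqv_def)

lemma decode_code:
  assumes "snd x \<notin> P"
  shows "snd (decode (code x)) \<notin> P" "eqv (decode (code x)) x"
proof -
  have "snd (decode (code x)) \<notin> P \<and> code (decode (code x)) = code x"
    unfolding decode_def by (rule someI[of _ x]) (use assms in auto)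
  then show "snd (decode (code x)) \<notin> P" "eqv (decode (code x)) x"
    using code_eq_iff[of "decode (code x)" x] assms by auto
qed

lemma mult_L:
  assumes "snd x \<notin> P" "snd y \<notin> P"
  shows "code x \<otimes>\<^bsub>L\<^esub> code y = code (fmul x y)"
proof -
  have "eqv (fmul x' y') (fmul x y)" if "eqv x' x" "eqv y' y" for x' y'
  proof -
    have "fst x' * fst y' * (snd x * snd y) - fst x * fst y * (snd x' * snd y')
        = (fst y' * snd y) * (fst x' * snd x - fst x * snd x') + (fst x * snd x') * (fst y' * snd y - fst y * snd y')"
      by (simp add: algebra_simps)
    also have "\<dots> \<in> P"
      using that by (simp add: eqv_def is_ideal_add[OF ideal_P] is_ideal_mult[OF ideal_P])
    finally show ?thesis by (simp add: eqv_def fmul_def)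
  qed
  then show ?thesis
    using decode_code[OF assms(1)] decode_code[OF assms(2)] assms
    by (simp add: L_def code_eq_iff fmul_def mult_P)
qed

lemma add_L:
  assumes "snd x \<notin> P" "snd y \<notin> P"
  shows "code x \<oplus>\<^bsub>L\<^esub> code y = code (fadd x y)"
proof -
  have "eqv (fadd x' y') (fadd x y)" if "eqv x' x" "eqv y' y" for x' y'
  proof -
    have "(fst x' * snd y' + fst y' * snd x') * (snd x * snd y) - (fst x * snd y + fst y * snd x) * (snd x' * snd y')
        = (snd y' * snd y) * (fst x' * snd x - fst x * snd x') + (snd x * snd x') * (fst y' * snd y - fst y * snd y')"
      by (simp add: algebra_simps)
    also have "\<dots> \<in> P"
      using that by (simp add: eqv_def is_ideal_add[OF ideal_P] is_ideal_mult[OF ideal_P])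
    finally show ?thesis by (simp add: eqv_def fadd_def)
  qed
  then show ?thesis
    using decode_code[OF assms(1)] decode_code[OF assms(2)] assms
    by (simp add: L_def code_eq_iff fadd_def mult_P)
qed

lemma carrier_L: "carrier L = code ` {x. snd x \<notin> P}" and one_L: "\<one>\<^bsub>L\<^esub> = code (1, 1)"
  and zero_L: "\<zero>\<^bsub>L\<^esub> = code (0, 1)"
  by (simp_all add: L_def)

lemma code_in_L: "snd x \<notin> P \<Longrightarrow> code x \<in> carrier L"
  by (simp add: carrier_L)

lemma code_eq_zero_iff: "snd x \<notin> P \<Longrightarrow> code x = \<zero>\<^bsub>L\<^esub> \<longleftrightarrow> fst x \<in> P"
  by (simp add: zero_L code_eq_iff one_P eqv_def)

lemmas L_simps = mult_L add_L one_L zero_L one_P mult_P code_in_L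

lemma cring_L: "cring L"
proof -
  have cl: "snd (fmul x y) \<notin> P" "snd (fadd x y) \<notin> P" if "snd x \<notin> P" "snd y \<notin> P" for x y
    using that by (simp_all add: fmul_def fadd_def mult_P)
  note simps = carrier_L mult_L add_L one_L zero_L one_P cl
  have "\<exists>v\<in>carrier L. v \<oplus>\<^bsub>L\<^esub> u = \<zero>\<^bsub>L\<^esub>" if u: "u \<in> carrier L" for u
  proof -
    obtain x where x: "u = code x" "snd x \<notin> P" using u by (auto simp: carrier_L)
    have "code (- fst x, snd x) \<oplus>\<^bsub>L\<^esub> u = code (fadd (- fst x, snd x) x)"
      unfolding x(1) by (rule add_L) (simp_all add: x)
    also have "\<dots> = \<zero>\<^bsub>L\<^esub>"
      unfolding zero_L by (rule code_eqI) (simp_all add: fadd_def x one_P mult_P)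
    finally show ?thesis using x by (intro bexI[of _ "code (- fst x, snd x)"] code_in_L) simp_all
  qed
  note ex = this
  have pairs: "fadd (fadd x y) z = fadd x (fadd y z)" "fadd x y = fadd y x" "fadd (0, 1) x = x"
    "fmul (fmul x y) z = fmul x (fmul y z)" "fmul x y = fmul y x" "fmul (1, 1) x = x" for x y z
    by (simp_all add: fadd_def fmul_def algebra_simps)
  have distr: "code (fmul (fadd x y) z) = code (fadd (fmul x z) (fmul y z))"
    if "snd x \<notin> P" "snd y \<notin> P" "snd z \<notin> P" for x y z
    by (rule code_eqI) (use that in \<open>simp_all add: cl\<close>, simp add: fadd_def fmul_def algebra_simps)
  show ?thesis
  proof (intro cringI abelian_groupI comm_monoidI ex)
    fix u v w assume "u \<in> carrier L" "v \<in> carrier L" "w \<in> carrier L"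
    then obtain x y z where *: "u = code x" "v = code y" "w = code z" "snd x \<notin> P" "snd y \<notin> P" "snd z \<notin> P"
      by (auto simp: carrier_L)
    show "u \<oplus>\<^bsub>L\<^esub> v \<oplus>\<^bsub>L\<^esub> w = u \<oplus>\<^bsub>L\<^esub> (v \<oplus>\<^bsub>L\<^esub> w)" "u \<otimes>\<^bsub>L\<^esub> v \<otimes>\<^bsub>L\<^esub> w = u \<otimes>\<^bsub>L\<^esub> (v \<otimes>\<^bsub>L\<^esub> w)"
      using * by (simp_all add: simps pairs(1,4))
    show "(u \<oplus>\<^bsub>L\<^esub> v) \<otimes>\<^bsub>L\<^esub> w = u \<otimes>\<^bsub>L\<^esub> w \<oplus>\<^bsub>L\<^esub> v \<otimes>\<^bsub>L\<^esub> w"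
      using * by (simp add: simps distr)
  next
    fix u v assume "u \<in> carrier L" "v \<in> carrier L"
    then obtain x y where *: "u = code x" "v = code y" "snd x \<notin> P" "snd y \<notin> P" by (auto simp: carrier_L)
    show "u \<oplus>\<^bsub>L\<^esub> v = v \<oplus>\<^bsub>L\<^esub> u" "u \<otimes>\<^bsub>L\<^esub> v = v \<otimes>\<^bsub>L\<^esub> u"
      using * pairs(2)[of x y] pairs(5)[of x y] by (simp_all add: simps)
    show "u \<oplus>\<^bsub>L\<^esub> v \<in> carrier L" "u \<otimes>\<^bsub>L\<^esub> v \<in> carrier L"
      using * by (simp_all add: simps)
  qed (auto simp: simps pairs(3,6))
qed

lemma field_L: "field L"
proof -
  interpret cring L by (rule cring_L)
  show ?thesis
  proof (rule cring_fieldI2)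
    show "\<zero>\<^bsub>L\<^esub> \<noteq> \<one>\<^bsub>L\<^esub>"
      using code_eq_zero_iff[of "(1, 1)"] one_P by (simp add: one_L)
    fix u assume u: "u \<in> carrier L" "u \<noteq> \<zero>\<^bsub>L\<^esub>"
    then obtain x where x: "u = code x" "snd x \<notin> P" by (auto simp: carrier_L)
    then have fx: "fst x \<notin> P" using u code_eq_zero_iff[OF x(2)] by simp
    have "u \<otimes>\<^bsub>L\<^esub> code (snd x, fst x) = code (fmul x (snd x, fst x))"
      unfolding x(1) by (rule mult_L) (simp_all add: x fx)
    also have "\<dots> = \<one>\<^bsub>L\<^esub>"
      unfolding one_L by (rule code_eqI) (simp_all add: fmul_def x fx one_P mult_P)
    finally show "\<exists>v\<in>carrier L. u \<otimes>\<^bsub>L\<^esub> v = \<one>\<^bsub>L\<^esub>"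
      using fx by (intro bexI[of _ "code (snd x, fst x)"] code_in_L) simp_all
  qed
qed

section \<open>The canonical map and the induced automorphism\<close>

definition \<pi> :: "'r \<Rightarrow> 'b" where
  "\<pi> x = code (x, 1)"

lemma \<pi>_hom: "\<pi> \<in> ring_hom ring_of_type_algebra L"
  by (rule ring_hom_memI)
    (auto simp: \<pi>_def ring_of_type_algebra_def L_simps fadd_def fmul_def intro!: code_eqI)

lemma \<pi>_eq_zero_iff: "\<pi> x = \<zero>\<^bsub>L\<^esub> \<longleftrightarrow> x \<in> P"
  by (simp add: \<pi>_def code_eq_zero_iff one_P)

definition lift :: "('r \<Rightarrow> 'r) \<Rightarrow> 'b \<Rightarrow> 'b" where
  "lift S u = code (S (fst (decode u)), S (snd (decode u)))"

lemma lift_code: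
  assumes "rhom S" "\<And>x. S x \<in> P \<longleftrightarrow> x \<in> P" "snd x \<notin> P"
  shows "lift S (code x) = code (S (fst x), S (snd x))"
proof -
  have "S (fst (decode (code x)) * snd x - fst x * snd (decode (code x))) \<in> P"
    using decode_code(2)[OF assms(3)] assms(2) by (simp add: eqv_def)
  then show ?thesis
    using decode_code[OF assms(3)] assms
    by (simp add: lift_def code_eq_iff eqv_def rhom_diff[OF assms(1)] rhom_mult[OF assms(1)])
qed

text \<open>The invariance of \<open>P\<close> is used in both directions: one makes the induced map
  well defined, the other makes it injective and keeps denominators outside
  \<open>P\<close>.\<close>

lemma difference_field_L:
  assumes S: "rhom S" "\<And>x. S x \<in> P \<longleftrightarrow> x \<in> P" and surj: "surj S"
  shows "difference_field L (lift S)"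
proof -
  have "lift S \<in> ring_hom L L"
    by (rule ring_hom_memI)
      (auto simp: carrier_L lift_code[OF S] S(2) L_simps fadd_def fmul_def rhom_simps[OF S(1)])
  moreover have "inj_on (lift S) (carrier L)"
  proof (rule inj_onI)
    fix u v assume "u \<in> carrier L" "v \<in> carrier L" and eq: "lift S u = lift S v"
    then obtain x y where xy: "u = code x" "snd x \<notin> P" "v = code y" "snd y \<notin> P" by (auto simp: carrier_L)
    then have "S (fst x * snd y - fst y * snd x) \<in> P"
      using eq by (simp add: lift_code[OF S] code_eq_iff S(2) eqv_def rhom_simps[OF S(1)])
    then show "u = v" using xy by (simp add: code_eq_iff eqv_def S(2))
  qed
  moreover have "lift S ` carrier L = carrier L"
  proof (intro equalityI subsetI)
    fix u assume "u \<in> carrier L"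
    then obtain x where x: "u = code x" "snd x \<notin> P" by (auto simp: carrier_L)
    obtain a b where ab: "fst x = S a" "snd x = S b" using surjD[OF surj] by blast
    then have b: "b \<notin> P" using x S(2)[of b] by simp
    have "lift S (code (a, b)) = u" using b x by (simp add: lift_code[OF S] flip: ab)
    then show "u \<in> lift S ` carrier L" using b code_in_L[of "(a, b)"] by force
  qed (auto simp: carrier_L lift_code[OF S] S(2))
  ultimately show ?thesis
    using field_L by (simp add: difference_field_def ring_iso_def bij_betw_def)
qed

lemma lift_\<pi>:
  assumes "rhom S" "\<And>x. S x \<in> P \<longleftrightarrow> x \<in> P"
  shows "lift S (\<pi> x) = \<pi> (S x)"
  using lift_code[OF assms, of "(x, 1)"] by (simp add: \<pi>_def one_P rhom_1[OF assms(1)])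

end

section \<open>The rings \<open>K[X\<^sub>j : j \<in> V]\<close>\<close>

lemma pvar_eq_mvar: "pvar = mvar" and pconst_eq_mconst: "pconst = mconst"
  by (auto simp: pvar_def mvar_def pconst_def mconst_def)

lemma mpoly_ring_simps [simp]:
  "carrier (mpoly_ring V) = psub V" "\<zero>\<^bsub>mpoly_ring V\<^esub> = 0" "\<one>\<^bsub>mpoly_ring V\<^esub> = 1"
  "x \<oplus>\<^bsub>mpoly_ring V\<^esub> y = x + y" "x \<otimes>\<^bsub>mpoly_ring V\<^esub> y = x * y"
  by (simp_all add: mpoly_ring_def psub_def ring_of_type_algebra_def)

lemma ring_of_type_simps [simp]:
  "carrier ring_of_type_algebra = UNIV" "\<zero>\<^bsub>ring_of_type_algebra\<^esub> = 0" "\<one>\<^bsub>ring_of_type_algebra\<^esub> = 1"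
  "x \<oplus>\<^bsub>ring_of_type_algebra\<^esub> y = x + y" "x \<otimes>\<^bsub>ring_of_type_algebra\<^esub> y = x * y"
  by (simp_all add: ring_of_type_algebra_def)

lemma cring_mpoly_ring: "cring (mpoly_ring V :: 'a::comm_ring_1 mpoly ring)"
proof (intro cringI abelian_groupI comm_monoidI)
  fix x :: "'a mpoly"
  assume "x \<in> carrier (mpoly_ring V)"
  then show "\<exists>y\<in>carrier (mpoly_ring V). y \<oplus>\<^bsub>mpoly_ring V\<^esub> x = \<zero>\<^bsub>mpoly_ring V\<^esub>"
    by (intro bexI[of _ "- x"]) (simp_all add: psub_uminus)
qed (simp_all add: psub_add psub_mult algebra_simps)

text \<open>Ideals of a subring given as a subset of a type. Closure under negation follows from
  multiplication by \<open>- 1\<close> when \<open>A\<close> is a subring.\<close>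

definition ideal_on :: "'r::comm_ring_1 set \<Rightarrow> 'r set \<Rightarrow> bool" where
  "ideal_on A I \<longleftrightarrow> I \<subseteq> A \<and> 0 \<in> I \<and> (\<forall>x\<in>I. \<forall>y\<in>I. x + y \<in> I) \<and> (\<forall>r\<in>A. \<forall>x\<in>I. r * x \<in> I)"

lemma ideal_mpoly_ring_iff: "ideal I (mpoly_ring V) \<longleftrightarrow> ideal_on (psub V) I"
proof
  assume "ideal I (mpoly_ring V)"
  then interpret ideal I "mpoly_ring V" .
  show "ideal_on (psub V) I"
    using a_subset additive_subgroup.zero_closed[OF additive_subgroup_axioms]
      additive_subgroup.a_closed[OF additive_subgroup_axioms] I_l_closed
    by (auto simp: ideal_on_def)
next
  interpret cring "mpoly_ring V :: 'a mpoly ring" by (rule cring_mpoly_ring)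
  assume I: "ideal_on (psub V) I"
  have neg: "\<ominus>\<^bsub>mpoly_ring V\<^esub> x \<in> I" if "x \<in> I" for x
  proof -
    have x: "x \<in> psub V" using that I by (auto simp: ideal_on_def)
    then have "\<ominus>\<^bsub>mpoly_ring V\<^esub> x = - x" by (intro minus_equality) (simp_all add: psub_uminus)
    moreover have "- 1 * x \<in> I" using I that psub_uminus[OF psub_1] unfolding ideal_on_def by blast
    ultimately show ?thesis by simp
  qed
  show "ideal I (mpoly_ring V)"
  proof (rule idealI)
    show "subgroup I (add_monoid (mpoly_ring V))"
    proof (rule add.subgroupI)
      show "I \<noteq> {}" using I by (auto simp: ideal_on_def)
    qed (use I neg in \<open>auto simp: ideal_on_def a_inv_def[symmetric]\<close>)
    fix a x :: "'a mpoly" assume "a \<in> I" "x \<in> carrier (mpoly_ring V)"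
    then have "x * a \<in> I" using I by (simp add: ideal_on_def)
    then show "x \<otimes>\<^bsub>mpoly_ring V\<^esub> a \<in> I" "a \<otimes>\<^bsub>mpoly_ring V\<^esub> x \<in> I"
      by (simp_all add: mult.commute[of a x])
  qed (fact ring_axioms)
qed

lemma genideal_mpoly_ring:
  assumes "A \<subseteq> psub V"
  shows "ideal_on (psub V) (Idl\<^bsub>mpoly_ring V\<^esub> A)" "A \<subseteq> Idl\<^bsub>mpoly_ring V\<^esub> A"
    "ideal_on (psub V) I \<Longrightarrow> A \<subseteq> I \<Longrightarrow> Idl\<^bsub>mpoly_ring V\<^esub> A \<subseteq> I"
proof -
  interpret cring "mpoly_ring V :: 'a mpoly ring" by (rule cring_mpoly_ring)
  show "ideal_on (psub V) (Idl\<^bsub>mpoly_ring V\<^esub> A)" "A \<subseteq> Idl\<^bsub>mpoly_ring V\<^esub> A"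
    using genideal_ideal[of A] genideal_self[of A] assms by (simp_all add: ideal_mpoly_ring_iff)
  show "ideal_on (psub V) I \<Longrightarrow> A \<subseteq> I \<Longrightarrow> Idl\<^bsub>mpoly_ring V\<^esub> A \<subseteq> I"
    by (rule genideal_minimal) (simp_all add: ideal_mpoly_ring_iff)
qed

lemma rhom_meval: "rhom (meval v)" and meval_pconst: "meval v (pconst c) = c"
  and meval_pvar: "meval v (pvar i) = v i"
proof -
  have "meval v = ev (\<lambda>x. x) v" for v :: "nat \<Rightarrow> 'a" by (rule ext) (simp add: meval_def ev_def)
  then show "rhom (meval v)" "meval v (pconst c) = c" "meval v (pvar i) = v i" for v :: "nat \<Rightarrow> 'a" and c i
    using rhom_ev[OF rhom_id] ev_pconst[OF rhom_id] ev_pvar[OF rhom_id] by auto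
qed

text \<open>Since \<sigma> is injective, \<open>mtwist\<close> does not shrink the support, so both
  sums run over the same monomials.\<close>

lemma msubst_mtwist:
  assumes "rhom \<sigma>" "inj \<sigma>"
  shows "msubst \<tau> (mtwist \<sigma> f) = ev (\<lambda>c. pconst (\<sigma> c)) (\<lambda>i. pvar (\<tau> i)) f"
proof -
  have l: "Poly_Mapping.lookup (mtwist \<sigma> f) m = \<sigma> (Poly_Mapping.lookup f m)" for m
    by (simp add: mtwist_def Poly_Mapping.map.rep_eq when_def rhom_0[OF assms(1)])
  have "\<sigma> c = 0 \<longleftrightarrow> c = 0" for c
    using inj_eq[OF assms(2), of c 0] by (simp only: rhom_0[OF assms(1)])
  then have "Poly_Mapping.keys (mtwist \<sigma> f) = Poly_Mapping.keys f"
    by (simp only: set_eq_iff in_keys_iff l) simp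
  then show ?thesis
    unfolding msubst_def ev_def pvar_eq_mvar pconst_eq_mconst by (simp only: l)
qed

lemma difference_field_rhom:
  assumes "difference_field (ring_of_type_algebra :: 'a::field ring) \<sigma>"
  shows "rhom \<sigma>" "bij \<sigma>"
proof -
  have *: "\<sigma> \<in> ring_hom ring_of_type_algebra ring_of_type_algebra" "bij_betw \<sigma> UNIV UNIV"
    using assms by (simp_all add: difference_field_def ring_iso_def)
  show "rhom \<sigma>"
    using ring_hom_add[OF *(1)] ring_hom_mult[OF *(1)] ring_hom_one[OF *(1)] by (simp add: rhom_def)
  show "bij \<sigma>" using *(2) .
qed

lemma rhom_inv:
  assumes "rhom \<sigma>" "bij \<sigma>"
  shows "rhom (inv_into UNIV \<sigma>)"
proof -
  note b = bij_is_surj[OF assms(2), THEN surj_f_inv_f] bij_is_inj[OF assms(2), THEN inv_f_f]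
  have "inv_into UNIV \<sigma> (x + y) = inv_into UNIV \<sigma> x + inv_into UNIV \<sigma> y" "inv_into UNIV \<sigma> (x * y) = inv_into UNIV \<sigma> x * inv_into UNIV \<sigma> y" for x y
    using b(2)[of "inv_into UNIV \<sigma> x + inv_into UNIV \<sigma> y"] b(2)[of "inv_into UNIV \<sigma> x * inv_into UNIV \<sigma> y"]
    by (simp_all add: rhom_simps[OF assms(1)] b(1))
  moreover have "inv_into UNIV \<sigma> 1 = 1" using b(2)[of 1] by (simp add: rhom_1[OF assms(1)])
  ultimately show ?thesis by (simp add: rhom_def)
qed

section \<open>Generic points in difference field extensions\<close>

text \<open>Polynomials have to enter a system as terms. One term must compute the polynomial both
  in the base field and along any homomorphism from the polynomial ring into a structure on
  \<open>'b\<close>.\<close>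

definition represents :: "'b itself \<Rightarrow> ('a \<Rightarrow> 'a) \<Rightarrow> 'a dterm \<Rightarrow> 'a::field mpoly \<Rightarrow> bool" where
  "represents (_ :: 'b itself) \<sigma> p f \<longleftrightarrow>
    (\<forall>v. dterm_value (ring_of_type_algebra :: 'a ring) \<sigma> (\<lambda>x. x) v p = meval v f) \<and>
    (\<forall>(L :: 'b ring) t h v \<Phi>. \<Phi> \<in> ring_hom (ring_of_type_algebra :: 'a mpoly ring) L \<longrightarrow>
      (\<forall>c. \<Phi> (pconst c) = h c) \<longrightarrow> (\<forall>i. \<Phi> (pvar i) = v i) \<longrightarrow> dterm_value L t h v p = \<Phi> f)"

text \<open>The terms are built without \<open>Sigma_app\<close>, which is why \<open>t\<close> may
  be arbitrary in \<open>represents\<close>.\<close>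

lemma exists_represents:
  fixes f :: "'a::field mpoly"
  shows "\<exists>p. represents TYPE('b) \<sigma> p f"
proof (rule psub_induct[of f UNIV])
  show "\<exists>p. represents TYPE('b) \<sigma> p (pconst c)" for c :: 'a
    by (rule exI[of _ "Param c"]) (simp add: represents_def meval_pconst)
  show "\<exists>p. represents TYPE('b) \<sigma> p (pvar i :: 'a mpoly)" for i
    by (rule exI[of _ "Variable i"]) (simp add: represents_def meval_pvar)
  fix f g :: "'a mpoly"
  assume "\<exists>p. represents TYPE('b) \<sigma> p f" "\<exists>p. represents TYPE('b) \<sigma> p g"
  then obtain p q where pq: "represents TYPE('b) \<sigma> p f" "represents TYPE('b) \<sigma> q g" by blast
  have "represents TYPE('b) \<sigma> (Plus p q) (f + g)"
    unfolding represents_def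
  proof (intro conjI allI impI)
    fix v
    show "dterm_value ring_of_type_algebra \<sigma> (\<lambda>x. x) v (Plus p q) = meval v (f + g)"
      using pq by (simp add: represents_def rhom_add[OF rhom_meval])
  next
    fix L :: "'b ring" and t h v \<Phi>
    assume \<Phi>: "\<Phi> \<in> ring_hom (ring_of_type_algebra :: 'a mpoly ring) L" "\<forall>c. \<Phi> (pconst c) = h c"
      "\<forall>i. \<Phi> (pvar i) = v i"
    then have "dterm_value L t h v p = \<Phi> f" "dterm_value L t h v q = \<Phi> g"
      using pq unfolding represents_def by blast+
    then show "dterm_value L t h v (Plus p q) = \<Phi> (f + g)"
      using ring_hom_add[OF \<Phi>(1), of f g] by simp
  qed
  then show "\<exists>p. represents TYPE('b) \<sigma> p (f + g)" by blast
  have "represents TYPE('b) \<sigma> (Times p q) (f * g)"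
    unfolding represents_def
  proof (intro conjI allI impI)
    fix v
    show "dterm_value ring_of_type_algebra \<sigma> (\<lambda>x. x) v (Times p q) = meval v (f * g)"
      using pq by (simp add: represents_def rhom_mult[OF rhom_meval])
  next
    fix L :: "'b ring" and t h v \<Phi>
    assume \<Phi>: "\<Phi> \<in> ring_hom (ring_of_type_algebra :: 'a mpoly ring) L" "\<forall>c. \<Phi> (pconst c) = h c"
      "\<forall>i. \<Phi> (pvar i) = v i"
    then have "dterm_value L t h v p = \<Phi> f" "dterm_value L t h v q = \<Phi> g"
      using pq unfolding represents_def by blast+
    then show "dterm_value L t h v (Times p q) = \<Phi> (f * g)"
      using ring_hom_mult[OF \<Phi>(1), of f g] by simp
  qed
  then show "\<exists>p. represents TYPE('b) \<sigma> p (f * g)" by blast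
qed (simp add: psub_UNIV)

lemma solvable_if_existentially_closed:
  fixes \<sigma> :: "'a::field \<Rightarrow> 'a" and I\<^sub>0 :: "'a mpoly set"
  assumes df: "difference_field (ring_of_type_algebra :: 'a ring) \<sigma>"
    and inf: "infinite (UNIV :: 'b set)" and inj: "\<exists>g :: 'a \<Rightarrow> 'b. inj g"
    and ec: "existentially_closed TYPE('b) (ring_of_type_algebra :: 'a ring) \<sigma>"
    and mn: "m \<le> n" and tau: "\<tau> \<in> {..<m} \<rightarrow> {..<n}" "inj_on \<tau> {..<m}"
    and I0: "finite I\<^sub>0" "I\<^sub>0 \<subseteq> carrier (mpoly_ring {..<n})"
    and prime: "primeideal (Idl\<^bsub>mpoly_ring {..<n}\<^esub> I\<^sub>0) (mpoly_ring {..<n})"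
    and compat: "{msubst \<tau> (mtwist \<sigma> f) | f. f \<in> (Idl\<^bsub>mpoly_ring {..<n}\<^esub> I\<^sub>0) \<inter> carrier (mpoly_ring {..<m})} =
         (Idl\<^bsub>mpoly_ring {..<n}\<^esub> I\<^sub>0) \<inter> carrier (mpoly_ring (\<tau> ` {..<m}))"
  shows "\<exists>b :: nat \<Rightarrow> 'a. (\<forall>f\<in>I\<^sub>0. meval b f = 0) \<and> (\<forall>i<m. \<sigma> (b i) = b (\<tau> i))"
proof -
  define I where "I = Idl\<^bsub>mpoly_ring {..<n}\<^esub> I\<^sub>0"
  define \<sigma>' where "\<sigma>' = inv_into UNIV \<sigma>"
  note sig = difference_field_rhom[OF df]
  interpret partial_shift \<sigma> \<sigma>' m n \<tau>
  proof
    show "rhom \<sigma>'" using rhom_inv[OF sig] by (simp add: \<sigma>'_def)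
    show "\<sigma> (\<sigma>' x) = x" "\<sigma>' (\<sigma> x) = x" for x
      using sig(2) by (simp_all add: \<sigma>'_def surj_f_inv_f bij_is_surj inv_f_f bij_is_inj)
    show "\<tau> i < n" if "i < m" for i using tau(1) that by auto
  qed (fact sig mn tau)+
  have Tdef: "msubst \<tau> (mtwist \<sigma> f) = T f" for f
    using msubst_mtwist[OF sig(1) bij_is_inj[OF sig(2)]] by (simp add: T_def)
  have I: "ideal_on (psub {..<n}) I" "I\<^sub>0 \<subseteq> I"
    using genideal_mpoly_ring(1,2)[of I\<^sub>0 "{..<n}"] I0 by (simp_all add: I_def)
  interpret pr: primeideal I "mpoly_ring {..<n}" using prime by (simp add: I_def)
  have rT: "rhom T" by (simp add: T_def rhom_ev rhom_pconst_\<sigma>)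
  \<comment> \<open>A left inverse of \<open>T\<close> on \<open>psub {..<m}\<close>. It turns the
    equality of sets in the compatibility condition into the pointwise equivalence
    \<open>TI\<close>.\<close>
  define T' where "T' = ev (\<lambda>c. pconst (\<sigma>' c)) (\<lambda>j. pvar (inv_into {..<m} \<tau> j) :: 'a mpoly)"
  have rT': "rhom T'" by (simp add: T'_def rhom_ev rhom_pconst_\<sigma>)
  have T'T: "T' (T f) = f" if "f \<in> psub {..<m}" for f
    by (rule rhom_eq_on_psub[OF rhom_comp[OF rT' rT] rhom_id _ _ that])
      (simp_all add: T_def T'_def ev_pconst ev_pvar rhom_pconst_\<sigma> \<sigma>'\<sigma> inv_into_f_f[OF tau(2)])
  have compat': "T ` (I \<inter> psub {..<m}) = I \<inter> psub (\<tau> ` {..<m})"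
    using compat unfolding Tdef I_def[symmetric] mpoly_ring_simps Setcompr_eq_image .
  have TI: "T f \<in> I \<longleftrightarrow> f \<in> I" if f: "f \<in> psub {..<m}" for f
  proof
    have "T f \<in> psub (\<tau> ` {..<m})"
      unfolding T_def using f by (rule ev_in_psub[OF rhom_pconst_\<sigma>(1)]) (auto intro: psub_pvar)
    moreover assume "T f \<in> I"
    ultimately have "T f \<in> I \<inter> psub (\<tau> ` {..<m})" by (rule IntI[rotated])
    then have "T f \<in> T ` (I \<inter> psub {..<m})" by (simp only: compat')
    then obtain g where g: "T f = T g" "g \<in> I \<inter> psub {..<m}" by (rule imageE)
    have "T' (T f) = T' (T g)" by (rule arg_cong[OF g(1)])
    then have "f = g" unfolding T'T[OF f] T'T[OF IntD2[OF g(2)]] .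
    then show "f \<in> I" using IntD1[OF g(2)] by (rule ssubst)
  next
    assume "f \<in> I"
    then have "T f \<in> T ` (I \<inter> psub {..<m})" using f by (intro imageI IntI)
    then have "T f \<in> I \<inter> psub (\<tau> ` {..<m})" by (simp only: compat')
    then show "T f \<in> I" by (rule IntD1)
  qed
  have "1 \<notin> I"
  proof
    assume 1: "1 \<in> I"
    have "x \<in> I" if "x \<in> psub {..<n}" for x
    proof -
      have "x * 1 \<in> I" using I(1) that 1 unfolding ideal_on_def by blast
      then show ?thesis by simp
    qed
    then show False using pr.I_notcarr I(1) unfolding ideal_on_def mpoly_ring_simps by blast
  qed
  obtain Q where Q: "is_prime_ideal Q" "\<And>f. S f \<in> Q \<longleftrightarrow> f \<in> Q"
    "\<And>f. f \<in> I \<Longrightarrow> ev pconst (\<lambda>j. pvar (j, 0)) f \<in> Q"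
  proof (rule exists_invariant_prime_extending[of I])
    show "0 \<in> I" "I \<subseteq> psub {..<n}" using I(1) by (simp_all add: ideal_on_def)
    show "x + y \<in> I" if "x \<in> I" "y \<in> I" for x y using I(1) that by (simp add: ideal_on_def)
    show "r * x \<in> I" if "r \<in> psub {..<n}" "x \<in> I" for r x using I(1) that by (simp add: ideal_on_def)
    show "x \<in> I \<or> y \<in> I" if "x \<in> psub {..<n}" "y \<in> psub {..<n}" "x * y \<in> I" for x y
      using pr.I_prime[of x y] that by simp
    show "1 \<notin> I" by fact
    show "T f \<in> I \<longleftrightarrow> f \<in> I" if "f \<in> psub {..<m}" for f by (rule TI[OF that])
  qed (rule that)
  \<comment> \<open>Fractions of polynomials arise from \<open>'a\<close> and countable types by
    finitely supported maps and pairs, all of which inject into the infinite type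
    \<open>'b\<close>.\<close>
  obtain a :: "'a \<Rightarrow> 'b" where a: "inj a" using inj by blast
  obtain \<nu> :: "nat \<Rightarrow> 'b" where \<nu>: "inj \<nu>" using infinite_countable_subset[OF inf] by blast
  have "inj (\<lambda>x :: nat \<times> int. \<nu> (to_nat x))" by (rule injI) (simp add: inj_eq[OF \<nu>] del: split_paired_All)
  from inj_poly_mapping_if_infinite[OF inf this \<nu>]
  obtain e :: "(nat \<times> int \<Rightarrow>\<^sub>0 nat) \<Rightarrow> 'b" where "inj e" by blast
  from inj_poly_mapping_if_infinite[OF inf this a]
  obtain e' :: "((nat \<times> int \<Rightarrow>\<^sub>0 nat) \<Rightarrow>\<^sub>0 'a) \<Rightarrow> 'b" where "inj e'" by blast
  from inj_pair_if_infinite[OF inf this this]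
  obtain g :: "((nat \<times> int \<Rightarrow>\<^sub>0 nat) \<Rightarrow>\<^sub>0 'a) \<times> ((nat \<times> int \<Rightarrow>\<^sub>0 nat) \<Rightarrow>\<^sub>0 'a) \<Rightarrow> 'b" where g: "inj g" by blast
  interpret F: coded_fractions Q g by unfold_locales (rule Q(1), rule g)
  define h where "h c = F.\<pi> (pconst c)" for c
  define v where "v j = F.\<pi> (pvar (j, 0))" for j
  define \<Phi> where "\<Phi> f = F.\<pi> (ev pconst (\<lambda>j. pvar (j, 0)) f)" for f :: "'a mpoly"
  have \<iota>: "rhom (ev pconst (\<lambda>j. pvar (j, 0 :: int)) :: 'a mpoly \<Rightarrow> _)" by (rule rhom_ev[OF rhom_pconst])
  have \<pi>: "F.\<pi> x \<in> carrier F.L" "F.\<pi> (x + y) = F.\<pi> x \<oplus>\<^bsub>F.L\<^esub> F.\<pi> y"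
    "F.\<pi> (x * y) = F.\<pi> x \<otimes>\<^bsub>F.L\<^esub> F.\<pi> y" "F.\<pi> 1 = \<one>\<^bsub>F.L\<^esub>" for x y
    using F.\<pi>_hom by (auto simp: ring_hom_def)
  have \<Phi>: "\<Phi> \<in> ring_hom (ring_of_type_algebra :: 'a mpoly ring) F.L"
    by (rule ring_hom_memI) (simp_all add: \<Phi>_def \<pi> rhom_simps[OF \<iota>])
  have "surj S" using S_S' by (rule surjI)
  then have ext: "difference_field_extension (ring_of_type_algebra :: 'a ring) \<sigma> F.L (F.lift S) h"
    unfolding difference_field_extension_def
    using F.difference_field_L[OF rhom_S Q(2)]
    by (auto simp: h_def F.lift_\<pi>[OF rhom_S Q(2)] S_pconst \<pi> rhom_simps[OF rhom_pconst] intro!: ring_hom_memI)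
  define tm where "tm f = (SOME p. represents TYPE('b) \<sigma> p f)" for f
  have tm: "represents TYPE('b) \<sigma> (tm f) f" for f
    unfolding tm_def by (rule someI_ex[OF exists_represents])
  \<comment> \<open>A solution of these equations is exactly a point of the required kind; the
    generic point \<open>v\<close> solves them in the extension.\<close>
  define E where "E = (\<lambda>f. (tm f, Zero :: 'a dterm)) ` I\<^sub>0 \<union> (\<lambda>i. (Sigma_app (Variable i), Variable (\<tau> i))) ` {..<m}"
  have val: "dterm_value F.L (F.lift S) h v (tm f) = \<Phi> f" for f
  proof -
    have "\<forall>c. \<Phi> (pconst c) = h c" "\<forall>i. \<Phi> (pvar i) = v i"
      by (simp_all add: \<Phi>_def h_def v_def ev_pconst ev_pvar rhom_pconst)
    then show ?thesis using tm \<Phi> unfolding represents_def by blast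
  qed
  have sol: "system_solvable F.L (F.lift S) h E {}"
    unfolding system_solvable_def
  proof (intro exI[of _ v] conjI)
    show "\<forall>i. v i \<in> carrier F.L" by (simp add: v_def \<pi>)
    have "\<Phi> f = \<zero>\<^bsub>F.L\<^esub>" if "f \<in> I\<^sub>0" for f
      using Q(3) I(2) that by (auto simp: \<Phi>_def F.\<pi>_eq_zero_iff)
    moreover have "F.lift S (v i) = v (\<tau> i)" if "i < m" for i
      using that by (simp add: v_def F.lift_\<pi>[OF rhom_S Q(2)] S_pvar shift_0)
    ultimately show "\<forall>(p, q)\<in>E. dterm_value F.L (F.lift S) h v p = dterm_value F.L (F.lift S) h v q"
      by (auto simp: E_def val)
  qed simp
  have "finite E" using I0(1) by (simp add: E_def)
  moreover have "\<exists>(L :: 'b ring) t h. difference_field_extension (ring_of_type_algebra :: 'a ring) \<sigma> L t h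
      \<and> system_solvable L t h E {}"
    by (rule exI[of _ F.L], rule exI[of _ "F.lift S"], rule exI[of _ h], rule conjI[OF ext sol])
  ultimately have "system_solvable (ring_of_type_algebra :: 'a ring) \<sigma> (\<lambda>x. x) E {}"
    using ec[unfolded existentially_closed_def, THEN spec, THEN spec, of E "{}"] by (simp add: split_def)
  then obtain b where b: "\<And>p q. (p, q) \<in> E \<Longrightarrow> dterm_value (ring_of_type_algebra :: 'a ring) \<sigma> (\<lambda>x. x) b p
      = dterm_value ring_of_type_algebra \<sigma> (\<lambda>x. x) b q"
    unfolding system_solvable_def by blast
  have "meval b f = 0" if "f \<in> I\<^sub>0" for f
    using b[of "tm f" Zero] tm[of f] that by (simp add: E_def represents_def)
  moreover have "\<sigma> (b i) = b (\<tau> i)" if "i < m" for i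
    using b[of "Sigma_app (Variable i)" "Variable (\<tau> i)"] that by (simp add: E_def)
  ultimately show ?thesis by blast
qed

section \<open>Hilbert's basis theorem\<close>

definition subring_on :: "'r::comm_ring_1 set \<Rightarrow> bool" where
  "subring_on A \<longleftrightarrow> 0 \<in> A \<and> 1 \<in> A \<and> (\<forall>x\<in>A. \<forall>y\<in>A. x + y \<in> A) \<and> (\<forall>x\<in>A. \<forall>y\<in>A. x * y \<in> A) \<and> (\<forall>x\<in>A. - x \<in> A)"

text \<open>Generation is expressed by minimality among ideals, the form in which the result is
  compared with \<open>Idl\<close> later.\<close>

definition noetherian_on :: "'r::comm_ring_1 set \<Rightarrow> bool" where
  "noetherian_on A \<longleftrightarrow> (\<forall>I. ideal_on A I \<longrightarrow>
     (\<exists>F\<subseteq>I. finite F \<and> (\<forall>J. ideal_on A J \<longrightarrow> F \<subseteq> J \<longrightarrow> I \<subseteq> J)))"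

text \<open>If \<open>F\<close> is not contained in \<open>A\<close>, no ideal of \<open>A\<close>
  contains it and the empty intersection is the whole type; the factor \<open>A\<close> makes
  \<open>ideal_on_gen\<close> hold for every \<open>F\<close>.\<close>

definition gen :: "'r::comm_ring_1 set \<Rightarrow> 'r set \<Rightarrow> 'r set" where
  "gen A F = A \<inter> \<Inter>{J. ideal_on A J \<and> F \<subseteq> J}"

lemma subring_onD:
  assumes "subring_on A"
  shows "0 \<in> A" "1 \<in> A" "x \<in> A \<Longrightarrow> y \<in> A \<Longrightarrow> x + y \<in> A" "x \<in> A \<Longrightarrow> y \<in> A \<Longrightarrow> x * y \<in> A"
    "x \<in> A \<Longrightarrow> - x \<in> A"
  using assms by (auto simp: subring_on_def)

lemma ideal_onD:
  assumes "ideal_on A I"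
  shows "I \<subseteq> A" "0 \<in> I" "x \<in> I \<Longrightarrow> y \<in> I \<Longrightarrow> x + y \<in> I" "r \<in> A \<Longrightarrow> x \<in> I \<Longrightarrow> r * x \<in> I"
  using assms by (auto simp: ideal_on_def)

lemma ideal_on_uminus: "subring_on A \<Longrightarrow> ideal_on A I \<Longrightarrow> x \<in> I \<Longrightarrow> - x \<in> I"
  using ideal_onD(4)[of A I "- 1" x] subring_onD(2,5)[of A] by simp

lemma ideal_on_gen:
  assumes "subring_on A"
  shows "ideal_on A (gen A F)"
  unfolding ideal_on_def gen_def
  using subring_onD[OF assms] by (auto simp: ideal_onD)

lemma gen_incl: "F \<subseteq> A \<Longrightarrow> F \<subseteq> gen A F"
  by (auto simp: gen_def)

lemma gen_minimal: "ideal_on A J \<Longrightarrow> F \<subseteq> J \<Longrightarrow> gen A F \<subseteq> J"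
  by (auto simp: gen_def)

lemma gen_mono: "F \<subseteq> G \<Longrightarrow> gen A F \<subseteq> gen A G"
  by (auto simp: gen_def)

text \<open>Polynomial expressions in \<open>x\<close> over \<open>A\<close> of degree below
  \<open>d\<close>. As \<open>x\<close> need not be transcendental over \<open>A\<close>, degrees
  and leading coefficients are not unique, hence a relation instead of a function.\<close>

primrec poly_degree_lt :: "'r::comm_ring_1 set \<Rightarrow> 'r \<Rightarrow> nat \<Rightarrow> 'r \<Rightarrow> bool" where
  "poly_degree_lt A x 0 f \<longleftrightarrow> f = 0"
| "poly_degree_lt A x (Suc d) f \<longleftrightarrow> (\<exists>c\<in>A. poly_degree_lt A x d (f - c * x ^ d))"

definition adjoin :: "'r::comm_ring_1 set \<Rightarrow> 'r \<Rightarrow> 'r set" where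
  "adjoin A x = {f. \<exists>d. poly_degree_lt A x d f}"

context
  fixes A :: "'r::comm_ring_1 set" and x :: 'r
  assumes A: "subring_on A"
begin

lemma poly_degree_lt_Suc: "poly_degree_lt A x d f \<Longrightarrow> poly_degree_lt A x (Suc d) f"
  using subring_onD(1)[OF A] by (auto intro: bexI[of _ 0])

lemma poly_degree_lt_mono: "d \<le> e \<Longrightarrow> poly_degree_lt A x d f \<Longrightarrow> poly_degree_lt A x e f"
  by (induction e rule: dec_induct) (simp_all only: poly_degree_lt_Suc)

lemma poly_degree_lt_add: "poly_degree_lt A x d f \<Longrightarrow> poly_degree_lt A x d g \<Longrightarrow> poly_degree_lt A x d (f + g)"
proof (induction d arbitrary: f g)
  case (Suc d)
  then obtain c c' where c: "c \<in> A" "c' \<in> A" "poly_degree_lt A x d (f - c * x ^ d)" "poly_degree_lt A x d (g - c' * x ^ d)"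
    by auto
  have "poly_degree_lt A x d ((f - c * x ^ d) + (g - c' * x ^ d))" using Suc.IH c by blast
  also have "(f - c * x ^ d) + (g - c' * x ^ d) = f + g - (c + c') * x ^ d"
    by (simp add: algebra_simps)
  finally show ?case using subring_onD(3)[OF A c(1,2)] by auto
qed simp

lemma poly_degree_lt_scale: "r \<in> A \<Longrightarrow> poly_degree_lt A x d f \<Longrightarrow> poly_degree_lt A x d (r * f)"
proof (induction d arbitrary: f)
  case (Suc d)
  then obtain c where c: "c \<in> A" "poly_degree_lt A x d (f - c * x ^ d)" by auto
  have "poly_degree_lt A x d (r * (f - c * x ^ d))" using Suc.IH Suc.prems c by blast
  also have "r * (f - c * x ^ d) = r * f - (r * c) * x ^ d" by (simp add: algebra_simps)
  finally show ?case using subring_onD(4)[OF A Suc.prems(1) c(1)] by auto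
qed simp

lemma poly_degree_lt_uminus: "poly_degree_lt A x d f \<Longrightarrow> poly_degree_lt A x d (- f)"
  using poly_degree_lt_scale[of "- 1"] subring_onD(2,5)[OF A] by simp

lemma poly_degree_lt_diff: "poly_degree_lt A x d f \<Longrightarrow> poly_degree_lt A x d g \<Longrightarrow> poly_degree_lt A x d (f - g)"
  using poly_degree_lt_add[OF _ poly_degree_lt_uminus, of d f g] by simp

lemma poly_degree_lt_0: "poly_degree_lt A x d 0"
  using poly_degree_lt_mono[of 0 d 0] by simp

lemma poly_degree_lt_shift: "poly_degree_lt A x d f \<Longrightarrow> poly_degree_lt A x (e + d) (x ^ e * f)"
proof (induction e)
  case (Suc e)
  have "poly_degree_lt A x (Suc d) (x * f)" if "poly_degree_lt A x d f" for d f
    using that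
  proof (induction d arbitrary: f)
    case 0
    then show ?case using poly_degree_lt_0 by (simp del: poly_degree_lt.simps(2))
  next
    case (Suc d)
    then obtain c where c: "c \<in> A" "poly_degree_lt A x d (f - c * x ^ d)" by auto
    from Suc.IH[OF c(2)] have "poly_degree_lt A x (Suc d) (x * f - c * x ^ Suc d)"
      by (simp add: algebra_simps del: poly_degree_lt.simps(2))
    then show ?case using c(1) by (subst poly_degree_lt.simps(2)) blast
  qed
  from this[OF Suc.IH[OF Suc.prems]] show ?case by (simp add: mult.assoc del: poly_degree_lt.simps(2))
qed simp

lemma poly_degree_lt_const: "c \<in> A \<Longrightarrow> poly_degree_lt A x (Suc 0) c"
  by (auto intro: bexI[of _ c])

lemma poly_degree_lt_monomial: "c \<in> A \<Longrightarrow> poly_degree_lt A x (Suc d) (c * x ^ d)"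
  using poly_degree_lt_shift[OF poly_degree_lt_const, of c d] by (simp add: mult.commute del: poly_degree_lt.simps(2))

lemma adjoin_add: "f \<in> adjoin A x \<Longrightarrow> g \<in> adjoin A x \<Longrightarrow> f + g \<in> adjoin A x"
proof -
  assume "f \<in> adjoin A x" "g \<in> adjoin A x"
  then obtain d e where "poly_degree_lt A x d f" "poly_degree_lt A x e g" by (auto simp: adjoin_def)
  then have "poly_degree_lt A x (max d e) f" "poly_degree_lt A x (max d e) g" by (auto intro: poly_degree_lt_mono[rotated])
  then show ?thesis using poly_degree_lt_add unfolding adjoin_def by blast
qed

lemma adjoin_mult: "f \<in> adjoin A x \<Longrightarrow> g \<in> adjoin A x \<Longrightarrow> f * g \<in> adjoin A x"
proof -
  assume "f \<in> adjoin A x" and g: "g \<in> adjoin A x"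
  then obtain d where "poly_degree_lt A x d f" by (auto simp: adjoin_def)
  then show ?thesis
  proof (induction d arbitrary: f)
    case 0
    then show ?case using poly_degree_lt_0 by (auto simp: adjoin_def)
  next
    case (Suc d)
    then obtain c where c: "c \<in> A" "poly_degree_lt A x d (f - c * x ^ d)" by auto
    obtain e where "poly_degree_lt A x e g" using g by (auto simp: adjoin_def)
    then have "c * (x ^ d * g) \<in> adjoin A x"
      using poly_degree_lt_scale[OF c(1) poly_degree_lt_shift] unfolding adjoin_def by blast
    from adjoin_add[OF Suc.IH[OF c(2)] this] show ?case by (simp add: algebra_simps)
  qed
qed

lemma adjoin_incl: "A \<subseteq> adjoin A x"
  using poly_degree_lt_const unfolding adjoin_def by blast

lemma adjoin_power: "x ^ e \<in> adjoin A x"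
  using poly_degree_lt_monomial[OF subring_onD(2)[OF A], of e] unfolding adjoin_def mult_1 by blast

lemma subring_on_adjoin: "subring_on (adjoin A x)"
  unfolding subring_on_def
proof (intro conjI ballI)
  show "0 \<in> adjoin A x" "1 \<in> adjoin A x" using subring_onD(1,2)[OF A] adjoin_incl by auto
  show "- f \<in> adjoin A x" if "f \<in> adjoin A x" for f
    using that poly_degree_lt_uminus unfolding adjoin_def by blast
qed (auto intro: adjoin_add adjoin_mult)

text \<open>If \<open>I\<close> were not finitely generated, elements of least degree outside the
  ideal of the previous ones could be chosen forever. Their leading coefficients generate an ideal
  of \<open>A\<close> that is exhausted at a finite stage, and there the next leading term can be
  cancelled.\<close>

theorem hilbert_basis:
  assumes noeth: "noetherian_on A"
  shows "noetherian_on (adjoin A x)"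
  unfolding noetherian_on_def
proof (intro allI impI)
  fix I assume I: "ideal_on (adjoin A x) I"
  let ?B = "adjoin A x"
  note B = subring_on_adjoin
  show "\<exists>F\<subseteq>I. finite F \<and> (\<forall>J. ideal_on ?B J \<longrightarrow> F \<subseteq> J \<longrightarrow> I \<subseteq> J)"
  proof (rule ccontr)
    assume no: "\<not> ?thesis"
    have step: "\<exists>f d c. f \<in> I \<and> f \<notin> gen ?B F \<and> c \<in> A \<and> poly_degree_lt A x d (f - c * x ^ d) \<and>
        (\<forall>g\<in>I. g \<notin> gen ?B F \<longrightarrow> \<not> poly_degree_lt A x d g)" if F: "finite F" "F \<subseteq> I" for F
    proof -
      have "\<not> (\<forall>J. ideal_on ?B J \<longrightarrow> F \<subseteq> J \<longrightarrow> I \<subseteq> J)"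
      proof
        assume "\<forall>J. ideal_on ?B J \<longrightarrow> F \<subseteq> J \<longrightarrow> I \<subseteq> J"
        with F have "F \<subseteq> I \<and> finite F \<and> (\<forall>J. ideal_on ?B J \<longrightarrow> F \<subseteq> J \<longrightarrow> I \<subseteq> J)" by simp
        then show False by (rule no[THEN notE, OF exI[of _ F]])
      qed
      then have "\<exists>J. ideal_on ?B J \<and> F \<subseteq> J \<and> \<not> I \<subseteq> J" by (simp only: not_all not_imp)
      then obtain J where "ideal_on ?B J \<and> F \<subseteq> J \<and> \<not> I \<subseteq> J" ..
      then have J: "ideal_on ?B J" "F \<subseteq> J" "\<not> I \<subseteq> J" by simp_all
      from J(3) obtain f where "f \<in> I" "f \<notin> J" unfolding subset_iff not_all not_imp by (elim exE conjE) 
      then have f: "f \<in> I" "f \<notin> gen ?B F" using gen_minimal[OF J(1,2)] by auto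
      define Pd where "Pd d \<longleftrightarrow> (\<exists>f\<in>I. f \<notin> gen ?B F \<and> poly_degree_lt A x d f)" for d
      have "\<exists>d. Pd d" using f ideal_onD(1)[OF I] unfolding Pd_def adjoin_def by blast
      then obtain e where e: "Pd e" "\<And>d. d < e \<Longrightarrow> \<not> Pd d"
        using exists_least_iff[of Pd] by blast
      \<comment> \<open>Only zero satisfies the bound 0, and it lies in every ideal. So the least
        strict bound is a successor \<open>Suc d\<close>, and \<open>d\<close> serves as the
        degree.\<close>
      have "\<not> Pd 0" using ideal_onD(2)[OF ideal_on_gen[OF B]] by (auto simp: Pd_def)
      then obtain d where d: "e = Suc d" using e(1) by (cases e) auto
      then show ?thesis using e(1) e(2)[of d] unfolding Pd_def by auto
    qed
    define good where "good F t \<longleftrightarrow> (case t of (f, d, c) \<Rightarrow> f \<in> I \<and> f \<notin> gen ?B F \<and> c \<in> A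
        \<and> poly_degree_lt A x d (f - c * x ^ d) \<and> (\<forall>g\<in>I. g \<notin> gen ?B F \<longrightarrow> \<not> poly_degree_lt A x d g))" for F t
    define pick where "pick F = (SOME t. good F t)" for F
    define f where "f F = fst (pick F)" for F
    define d where "d F = fst (snd (pick F))" for F
    define c where "c F = snd (snd (pick F))" for F
    have N: "f F \<in> I \<and> f F \<notin> gen ?B F \<and> c F \<in> A
        \<and> poly_degree_lt A x (d F) (f F - c F * x ^ d F) \<and> (\<forall>g\<in>I. g \<notin> gen ?B F \<longrightarrow> \<not> poly_degree_lt A x (d F) g)"
      if F: "finite F" "F \<subseteq> I" for F
    proof -
      obtain f' d' c' where "good F (f', d', c')"
        using step[OF F] unfolding good_def split by blast
      then have "good F (pick F)" unfolding pick_def by (rule someI)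
      then show ?thesis by (simp add: good_def f_def d_def c_def case_prod_beta)
    qed
    define F where "F = rec_nat {} (\<lambda>_ F. insert (f F) F)"
    have F0: "F 0 = {}" and FS: "F (Suc k) = insert (f (F k)) (F k)" for k by (simp_all add: F_def)
    have FI: "finite (F k) \<and> F k \<subseteq> I" for k
      by (induction k) (auto simp: F0 FS N)
    define f' where "f' k = f (F k)" for k
    define c' where "c' k = c (F k)" for k
    define d' where "d' k = d (F k)" for k
    have f': "f' k \<in> I" "f' k \<notin> gen ?B (F k)" and c': "c' k \<in> A"
      and fc: "poly_degree_lt A x (d' k) (f' k - c' k * x ^ d' k)"
      and min: "\<And>g. g \<in> I \<Longrightarrow> g \<notin> gen ?B (F k) \<Longrightarrow> \<not> poly_degree_lt A x (d' k) g" for k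
      using N[of "F k"] FI[of k] by (auto simp: f'_def c'_def d'_def)
    have Fmono: "F j \<subseteq> F k" if "j \<le> k" for j k
      using that by (induction k rule: dec_induct) (auto simp: FS)
    have f'F: "f' j \<in> F k" if "j < k" for j k
      using Fmono[of "Suc j" k] that by (auto simp: FS f'_def)
    \<comment> \<open>\<open>f' k\<close> avoids the ideal of stage \<open>k\<close>, hence also the
      smaller one of stage \<open>j\<close>, where \<open>f' j\<close> was chosen of least
      degree.\<close>
    have dmono: "d' j \<le> d' k" if "j \<le> k" for j k
    proof (rule ccontr)
      assume "\<not> d' j \<le> d' k"
      then have "Suc (d' k) \<le> d' j" by simp
      moreover have "poly_degree_lt A x (Suc (d' k)) (f' k)" using fc[of k] c'[of k] by auto
      ultimately have "poly_degree_lt A x (d' j) (f' k)" by (rule poly_degree_lt_mono)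
      moreover have "f' k \<notin> gen ?B (F j)" using f'(2)[of k] gen_mono[OF Fmono[OF that]] by blast
      ultimately show False using min f'(1) by blast
    qed
    define LI where "LI = (\<Union>k. gen A (c' ` {..<k}))"
    have mono: "gen A (c' ` {..<j}) \<subseteq> gen A (c' ` {..<k})" if "j \<le> k" for j k
      using that by (intro gen_mono) auto
    note ig = ideal_on_gen[OF A]
    have ex: "\<exists>k. S \<subseteq> gen A (c' ` {..<k})" if "finite S" "S \<subseteq> LI" for S
      using that
    proof (induction S)
      case (insert s S)
      then obtain k l where "S \<subseteq> gen A (c' ` {..<k})" "s \<in> gen A (c' ` {..<l})" by (auto simp: LI_def)
      then show ?case using mono[of k "max k l"] mono[of l "max k l"]
        by (intro exI[of _ "max k l"]) auto
    qed simp
    have "ideal_on A LI" unfolding ideal_on_def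
    proof (intro conjI ballI)
      show "LI \<subseteq> A" "0 \<in> LI" using ideal_onD(1,2)[OF ig] by (auto simp: LI_def)
      show "r * a \<in> LI" if "r \<in> A" "a \<in> LI" for r a
        using ideal_onD(4)[OF ig that(1)] that(2) by (auto simp: LI_def)
      show "a + b \<in> LI" if ab: "a \<in> LI" "b \<in> LI" for a b
      proof -
        obtain k where "{a, b} \<subseteq> gen A (c' ` {..<k})" using ex[of "{a, b}"] ab by auto
        then have "a + b \<in> gen A (c' ` {..<k})" using ideal_onD(3)[OF ig] by blast
        then show ?thesis by (auto simp: LI_def)
      qed
    qed
    from noeth[unfolded noetherian_on_def, THEN spec, THEN mp, OF this]
    obtain S where "S \<subseteq> LI \<and> finite S \<and> (\<forall>J. ideal_on A J \<longrightarrow> S \<subseteq> J \<longrightarrow> LI \<subseteq> J)" ..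
    then have S: "S \<subseteq> LI" "finite S" "\<And>J. ideal_on A J \<Longrightarrow> S \<subseteq> J \<Longrightarrow> LI \<subseteq> J"
      by simp_all
    \<comment> \<open>The finitely many generators of the ideal of leading coefficients all appear
      by some stage \<open>k\<close>.\<close>
    obtain k where k: "S \<subseteq> gen A (c' ` {..<k})" using ex[OF S(2,1)] by blast
    have "c' ` {..<Suc k} \<subseteq> gen A (c' ` {..<Suc k})" using c' by (intro gen_incl) auto
    then have "c' k \<in> LI" unfolding LI_def by blast
    with S(3)[OF ig k] have ck: "c' k \<in> gen A (c' ` {..<k})" by blast
    \<comment> \<open>Coefficients of \<open>x ^ d' k\<close> in elements of the ideal of stage
      \<open>k\<close> of degree at most \<open>d' k\<close>. Each earlier \<open>c' j\<close> is
      among them: multiplication by a power of \<open>x\<close> raises \<open>f' j\<close> to this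
      degree, which is not below its own by \<open>dmono\<close>.\<close>
    define J where "J = {a \<in> A. \<exists>g\<in>gen ?B (F k). poly_degree_lt A x (d' k) (g - a * x ^ d' k)}"
    note iB = ideal_on_gen[OF B, of "F k"]
    have "ideal_on A J" unfolding ideal_on_def
    proof (intro conjI ballI)
      show "J \<subseteq> A" by (auto simp: J_def)
      show "0 \<in> J" using ideal_onD(2)[OF iB] subring_onD(1)[OF A] poly_degree_lt_0 by (auto simp: J_def)
      fix a assume "a \<in> J"
      then obtain g where g: "a \<in> A" "g \<in> gen ?B (F k)" "poly_degree_lt A x (d' k) (g - a * x ^ d' k)"
        by (auto simp: J_def)
      { fix b assume "b \<in> J"
        then obtain g' where g': "b \<in> A" "g' \<in> gen ?B (F k)" "poly_degree_lt A x (d' k) (g' - b * x ^ d' k)"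
          by (auto simp: J_def)
        have "poly_degree_lt A x (d' k) ((g + g') - (a + b) * x ^ d' k)"
          using poly_degree_lt_add[OF g(3) g'(3)] by (simp add: algebra_simps)
        then show "a + b \<in> J" unfolding J_def
          using subring_onD(3)[OF A g(1) g'(1)] ideal_onD(3)[OF iB g(2) g'(2)] by blast }
      { fix r assume r: "r \<in> A"
        have "poly_degree_lt A x (d' k) (r * g - (r * a) * x ^ d' k)"
          using poly_degree_lt_scale[OF r g(3)] by (simp add: algebra_simps)
        then show "r * a \<in> J" unfolding J_def
          using subring_onD(4)[OF A r g(1)] ideal_onD(4)[OF iB _ g(2), of r] r adjoin_incl by blast }
    qed
    moreover have "c' ` {..<k} \<subseteq> J"
    proof clarify
      fix j assume j: "j < k"
      define e where "e = d' k - d' j"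
      have e: "e + d' j = d' k" using dmono[of j k] j by (simp add: e_def)
      have "x ^ e * (c' j * x ^ d' j) = c' j * x ^ d' k" by (simp add: power_add flip: e)
      then have "poly_degree_lt A x (d' k) (x ^ e * f' j - c' j * x ^ d' k)"
        using poly_degree_lt_shift[OF fc[of j], of e] by (simp add: e right_diff_distrib)
      moreover have "F k \<subseteq> ?B" using FI[of k] ideal_onD(1)[OF I] by blast
      then have "x ^ e * f' j \<in> gen ?B (F k)"
        using ideal_onD(4)[OF iB adjoin_power] gen_incl f'F[OF j] by blast
      ultimately show "c' j \<in> J" using c'[of j] by (auto simp: J_def)
    qed
    ultimately have "c' k \<in> J" using gen_minimal ck by blast
    then obtain g where g: "g \<in> gen ?B (F k)" "poly_degree_lt A x (d' k) (g - c' k * x ^ d' k)"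
      by (auto simp: J_def)
    \<comment> \<open>The common leading term cancels, so the difference contradicts the minimal
      choice of \<open>f' k\<close>.\<close>
    have "poly_degree_lt A x (d' k) (f' k - g)" using poly_degree_lt_diff[OF fc[of k] g(2)] by simp
    moreover have "g \<in> I" using gen_minimal[OF I] FI[of k] g(1) by blast
    then have "f' k - g \<in> I"
      using ideal_onD(3)[OF I f'(1)[of k] ideal_on_uminus[OF B I]] by simp
    moreover have "f' k - g \<notin> gen ?B (F k)"
      using ideal_onD(3)[OF iB _ g(1), of "f' k - g"] f'(2)[of k] by auto
    ultimately show False using min by blast
  qed
qed

end

lemma subring_on_psub: "subring_on (psub V)"
  by (auto simp: subring_on_def psub_add psub_mult psub_uminus)

text \<open>The ring without variables is the field of constants, where a nonzero ideal contains 1;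
  each further variable is adjoined by \<open>hilbert_basis\<close>.\<close>

lemma noetherian_psub: "noetherian_on (psub {..<n} :: 'a::field mpoly set)"
proof (induction n)
  case 0
  have c: "f \<in> range pconst" if "f \<in> psub {}" for f :: "'a mpoly"
    using that
    by (induction rule: psub_induct) (auto simp flip: rhom_add[OF rhom_pconst] rhom_mult[OF rhom_pconst])
  show ?case unfolding noetherian_on_def
  proof (intro allI impI)
    fix I assume I: "ideal_on (psub {..<0}) (I :: 'a mpoly set)"
    show "\<exists>F\<subseteq>I. finite F \<and> (\<forall>J. ideal_on (psub {..<0}) J \<longrightarrow> F \<subseteq> J \<longrightarrow> I \<subseteq> J)"
    proof (cases "I \<subseteq> {0}")
      case True
      then show ?thesis by (intro exI[of _ "{}"]) (auto dest: ideal_onD(2))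
    next
      case False
      then obtain f where f: "f \<in> I" "f \<noteq> 0" by auto
      then obtain a where a: "f = pconst a" using c[of f] ideal_onD(1)[OF I] by auto
      with f have "a \<noteq> 0" by (auto simp: pconst_def)
      have "pconst (inverse a) * f \<in> I" by (rule ideal_onD(4)[OF I _ f(1)]) simp
      then have "1 \<in> I"
        using \<open>a \<noteq> 0\<close> by (simp add: a rhom_1[OF rhom_pconst] flip: rhom_mult[OF rhom_pconst])
      moreover have "I \<subseteq> J" if "ideal_on (psub {..<0}) J" "1 \<in> J" for J
      proof
        fix g assume "g \<in> I"
        then have "g * 1 \<in> J" using ideal_onD(1)[OF I] by (intro ideal_onD(4)[OF that(1) _ that(2)]) blast
        then show "g \<in> J" by simp
      qed
      ultimately show ?thesis by (intro exI[of _ "{1}"]) simp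
    qed
  qed
next
  case (Suc n)
  let ?A = "psub {..<n} :: 'a mpoly set"
  have A: "subring_on ?A" by (rule subring_on_psub)
  have "adjoin ?A (pvar n) = psub {..<Suc n}"
  proof (intro equalityI subsetI)
    fix f assume "f \<in> adjoin ?A (pvar n)"
    then obtain d where "poly_degree_lt ?A (pvar n) d f" by (auto simp: adjoin_def)
    then show "f \<in> psub {..<Suc n}"
    proof (induction d arbitrary: f)
      case (Suc d)
      then obtain c where c: "c \<in> ?A" "poly_degree_lt ?A (pvar n) d (f - c * pvar n ^ d)" by auto
      have "pvar n ^ d \<in> (psub {..<Suc n} :: 'a mpoly set)"
        by (induction d) (auto intro!: psub_mult psub_pvar)
      moreover have "c \<in> psub {..<Suc n}" using c(1) psub_mono[of "{..<n}" "{..<Suc n}"] by auto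
      ultimately have "(f - c * pvar n ^ d) + c * pvar n ^ d \<in> psub {..<Suc n}"
        using Suc.IH[OF c(2)] by (intro psub_add psub_mult)
      then show ?case by simp
    qed simp
  next
    fix f :: "'a mpoly" assume "f \<in> psub {..<Suc n}"
    then show "f \<in> adjoin ?A (pvar n)"
    proof (induction rule: psub_induct)
      case (pconst c)
      then show ?case using adjoin_incl[OF A] by auto
    next
      case (pvar i)
      then show ?case
        using adjoin_power[OF A, of "pvar n" 1] adjoin_incl[OF A, of "pvar n"] psub_pvar[of i "{..<n}"]
        by (cases "i = n") auto
    qed (auto intro: adjoin_add[OF A] adjoin_mult[OF A])
  qed
  then show ?case using hilbert_basis[OF A Suc.IH, of "pvar n"] by simp
qed

section \<open>Evaluation in a carrier-based ring\<close>

locale mpoly_eval = cring L for L :: "('b, 'k) ring_scheme" (structure) +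
  fixes h :: "'a::comm_ring_1 \<Rightarrow> 'b" and a :: "nat \<Rightarrow> 'b"
  assumes h: "h \<in> ring_hom ring_of_type_algebra L" and a [simp]: "\<And>i. a i \<in> carrier L"
begin

lemma h_simps [simp]: "h c \<in> carrier L" "h (c + d) = h c \<oplus> h d" "h (c * d) = h c \<otimes> h d" "h 1 = \<one>"
  using ring_hom_closed[OF h, of c] ring_hom_add[OF h, of c d] ring_hom_mult[OF h, of c d] ring_hom_one[OF h]
  by simp_all

lemma h_0 [simp]: "h 0 = \<zero>"
  using h_simps(2)[of 0 0] add.l_cancel_one[of "h 0" "h 0"] by (simp del: h_simps(2))

definition mon :: "(nat \<Rightarrow>\<^sub>0 nat) \<Rightarrow> 'b" where
  "mon m = (\<Otimes>i\<in>Poly_Mapping.keys m. a i [^] Poly_Mapping.lookup m i)"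

definition lev :: "'a mpoly \<Rightarrow> 'b" where
  "lev p = (\<Oplus>m\<in>Poly_Mapping.keys p. h (Poly_Mapping.lookup p m) \<otimes> mon m)"

lemma mon_closed [simp]: "mon m \<in> carrier L"
  by (simp add: mon_def)

lemma lev_closed [simp]: "lev p \<in> carrier L"
  by (simp add: lev_def)

lemma mon_superset:
  "finite S \<Longrightarrow> Poly_Mapping.keys m \<subseteq> S \<Longrightarrow> mon m = (\<Otimes>i\<in>S. a i [^] Poly_Mapping.lookup m i)"
  unfolding mon_def by (rule finprod_mono_neutral_cong_left) (auto simp: not_in_keys_iff_lookup_eq_zero)

lemma lev_superset:
  "finite S \<Longrightarrow> Poly_Mapping.keys p \<subseteq> S \<Longrightarrow> lev p = (\<Oplus>m\<in>S. h (Poly_Mapping.lookup p m) \<otimes> mon m)"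
  unfolding lev_def by (rule add.finprod_mono_neutral_cong_left) (auto simp: not_in_keys_iff_lookup_eq_zero)

lemma mon_add: "mon (m + m') = mon m \<otimes> mon m'"
proof -
  let ?S = "Poly_Mapping.keys m \<union> Poly_Mapping.keys m'"
  have "mon (m + m') = (\<Otimes>i\<in>?S. a i [^] Poly_Mapping.lookup m i \<otimes> a i [^] Poly_Mapping.lookup m' i)"
    using keys_add[of m m'] by (simp add: mon_superset[of ?S "m + m'"] lookup_add nat_pow_mult)
  also have "\<dots> = mon m \<otimes> mon m'"
    by (subst finprod_multf) (simp_all add: mon_superset[of ?S m] mon_superset[of ?S m'])
  finally show ?thesis .
qed

lemma lev_add: "lev (p + q) = lev p \<oplus> lev q"
proof -
  let ?S = "Poly_Mapping.keys p \<union> Poly_Mapping.keys q"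
  have "lev (p + q) = (\<Oplus>m\<in>?S. h (Poly_Mapping.lookup p m) \<otimes> mon m \<oplus> h (Poly_Mapping.lookup q m) \<otimes> mon m)"
    using keys_add[of p q] by (simp add: lev_superset[of ?S "p + q"] lookup_add l_distr)
  also have "\<dots> = lev p \<oplus> lev q"
    by (subst finsum_addf) (simp_all add: lev_superset[of ?S p] lev_superset[of ?S q])
  finally show ?thesis .
qed

lemma lev_0 [simp]: "lev 0 = \<zero>"
  by (simp add: lev_def)

lemma lev_single: "lev (Poly_Mapping.single m c) = h c \<otimes> mon m"
  by (subst lev_superset[of "{m}"]) (auto split: if_splits)

lemma lev_mult: "lev (p * q) = lev p \<otimes> lev q"
proof (induction p rule: poly_mapping_induct)
  case (single m c)
  show ?case
  proof (induction q rule: poly_mapping_induct)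
    case (single m' c')
    then show ?case by (simp add: mult_single lev_single mon_add m_ac)
  qed (simp_all add: lev_add distrib_left r_distr)
qed (simp_all add: lev_add distrib_right l_distr)

lemma lev_pconst [simp]: "lev (pconst c) = h c"
  by (simp add: pconst_def lev_single mon_def)

lemma lev_pvar [simp]: "lev (pvar i) = a i"
  by (simp add: pvar_def lev_single mon_superset[of "{i}"])

lemma lev_1 [simp]: "lev 1 = \<one>"
  using lev_pconst[of 1] by (simp add: rhom_1[OF rhom_pconst])

lemma lev_uminus: "lev (- p) = \<ominus> lev p"
proof -
  have "lev (- p) \<oplus> lev p = \<zero>" by (simp flip: lev_add)
  then show ?thesis by (simp add: minus_equality[symmetric])
qed

lemma lev_diff: "lev (p - q) = lev p \<ominus> lev q"
  using lev_add[of p "- q"] by (simp add: lev_uminus a_minus_def)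

end

section \<open>Existential closedness from the geometric axioms\<close>

lemma minus_ring_of_type: "x \<ominus>\<^bsub>ring_of_type_algebra\<^esub> y = x - (y :: 'a::comm_ring_1)"
proof -
  interpret cring "ring_of_type_algebra :: 'a ring" by (rule cring_from_type_algebra)
  have "\<ominus>\<^bsub>ring_of_type_algebra\<^esub> y = - y" by (rule minus_equality) simp_all
  then show ?thesis by (simp add: a_minus_def)
qed

primrec subterms :: "'a dterm \<Rightarrow> 'a dterm set" where
  "subterms (Variable i) = {Variable i}"
| "subterms (Param c) = {Param c}"
| "subterms Zero = {Zero}"
| "subterms One = {One}"
| "subterms (Plus p q) = insert (Plus p q) (subterms p \<union> subterms q)"
| "subterms (Minus p q) = insert (Minus p q) (subterms p \<union> subterms q)"
| "subterms (Times p q) = insert (Times p q) (subterms p \<union> subterms q)"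
| "subterms (Sigma_app p) = insert (Sigma_app p) (subterms p)"

lemma finite_subterms: "finite (subterms p)"
  by (induction p) auto

lemma subterms_refl: "p \<in> subterms p"
  by (cases p) auto

lemma subterms_trans: "q \<in> subterms p \<Longrightarrow> subterms q \<subseteq> subterms p"
  by (induction p) auto

lemma existentially_closed_if_solvable:
  fixes \<sigma> :: "'a::field \<Rightarrow> 'a"
  assumes df: "difference_field (ring_of_type_algebra :: 'a ring) \<sigma>"
    and ax: "\<And>(m::nat) (n::nat) (\<tau> :: nat \<Rightarrow> nat) (I\<^sub>0 :: 'a mpoly set).
       m \<le> n \<Longrightarrow> \<tau> \<in> {..<m} \<rightarrow> {..<n} \<Longrightarrow> inj_on \<tau> {..<m} \<Longrightarrow> finite I\<^sub>0 \<Longrightarrow>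
       I\<^sub>0 \<subseteq> carrier (mpoly_ring {..<n}) \<Longrightarrow>
       primeideal (Idl\<^bsub>mpoly_ring {..<n}\<^esub> I\<^sub>0) (mpoly_ring {..<n}) \<Longrightarrow>
       {msubst \<tau> (mtwist \<sigma> f) | f.
          f \<in> (Idl\<^bsub>mpoly_ring {..<n}\<^esub> I\<^sub>0) \<inter> carrier (mpoly_ring {..<m})} =
         (Idl\<^bsub>mpoly_ring {..<n}\<^esub> I\<^sub>0) \<inter> carrier (mpoly_ring (\<tau> ` {..<m})) \<Longrightarrow>
       \<exists>b :: nat \<Rightarrow> 'a. (\<forall>f\<in>I\<^sub>0. meval b f = 0) \<and> (\<forall>i<m. \<sigma> (b i) = b (\<tau> i))"
  shows "existentially_closed TYPE('b) (ring_of_type_algebra :: 'a ring) \<sigma>"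
  unfolding existentially_closed_def
proof (intro allI impI)
  fix E N :: "('a dterm \<times> 'a dterm) set"
  let ?R = "ring_of_type_algebra :: 'a ring"
  assume fin: "finite E" "finite N"
    and "\<exists>(L :: 'b ring) t h. difference_field_extension ?R \<sigma> L t h \<and> system_solvable L t h E N"
  then obtain L :: "'b ring" and t h v where ext: "difference_field_extension ?R \<sigma> L t h"
    and v: "\<And>i. v i \<in> carrier L" and vE: "\<forall>(p, q)\<in>E. dterm_value L t h v p = dterm_value L t h v q"
    and vN: "\<forall>(p, q)\<in>N. dterm_value L t h v p \<noteq> dterm_value L t h v q"
    unfolding system_solvable_def by blast
  note sig = difference_field_rhom[OF df]
  have h: "h \<in> ring_hom ?R L" and ht: "\<And>x. h (\<sigma> x) = t (h x)" and L: "field L" and t: "t \<in> ring_hom L L"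
    and tinj: "inj_on t (carrier L)"
    using ext by (auto simp: difference_field_extension_def difference_field_def ring_iso_def bij_betw_def)
  interpret L: field L by (rule L)
  let ?val = "dterm_value L t h v"
  have val_closed: "?val p \<in> carrier L" for p
    by (induction p) (auto simp: v ring_hom_closed[OF h] ring_hom_closed[OF t])
  define D where "D = (\<Union>(p, q)\<in>E \<union> N. subterms p \<union> subterms q)"
  \<comment> \<open>The named elements: one coordinate for every subterm and one for every
    inequation.\<close>
  define Z where "Z = Inl ` D \<union> Inr ` N"
  have "finite D"
    unfolding D_def by (rule finite_UN_I) (use fin in \<open>auto simp: finite_subterms\<close>)
  then have "finite Z" using fin by (simp add: Z_def)
  then obtain g where g: "bij_betw g Z {..<card Z}"
    using finite_same_card_bij[of Z "{..<card Z}"] by auto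
  define k where "k = card Z"
  define u where "u = case_sum ?val (\<lambda>(p, q). inv\<^bsub>L\<^esub> (?val p \<ominus>\<^bsub>L\<^esub> ?val q))"
  have Nne: "?val p \<ominus>\<^bsub>L\<^esub> ?val q \<in> Units L" if "(p, q) \<in> N" for p q
    using vN that val_closed[of p] val_closed[of q] by (auto simp: L.field_Units L.r_right_minus_eq)
  have u_closed: "u z \<in> carrier L" if "z \<in> Z" for z
    using that Nne by (auto simp: Z_def u_def val_closed)
  have gZ: "g z < k" if "z \<in> Z" for z
    using g that by (auto simp: k_def bij_betw_def)
  \<comment> \<open>Coordinates below \<open>k\<close> carry the named elements, the next
    \<open>k\<close> their images under \<open>t\<close>. The value zero beyond is a
    default.\<close>
  define a where "a i = (if i < k then u (inv_into Z g i)
    else if i < 2 * k then t (u (inv_into Z g (i - k))) else \<zero>\<^bsub>L\<^esub>)" for i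
  have gi: "inv_into Z g i \<in> Z" if "i < k" for i
    using g that by (intro inv_into_into) (auto simp: k_def bij_betw_def)
  have a_closed: "a i \<in> carrier L" for i
    using gi u_closed ring_hom_closed[OF t] by (auto simp: a_def)
  interpret ev: mpoly_eval L h a
    by unfold_locales (rule h, rule a_closed)
  have ag: "a (g z) = u z" "a (g z + k) = t (u z)" if "z \<in> Z" for z
  proof -
    have "inv_into Z g (g z) = z" using g that by (auto simp: bij_betw_def)
    then show "a (g z) = u z" "a (g z + k) = t (u z)" using gZ[OF that] by (auto simp: a_def)
  qed
  have at: "a (i + k) = t (a i)" if "i < k" for i
    using that by (simp add: a_def)
  let ?P = "psub {..<2 * k} :: 'a mpoly set"
  define I where "I = {f \<in> ?P. ev.lev f = \<zero>\<^bsub>L\<^esub>}"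
  have I: "ideal_on ?P I"
    by (auto simp: ideal_on_def I_def psub_add psub_mult ev.lev_add ev.lev_mult)
  from noetherian_psub[of "2 * k", unfolded noetherian_on_def, THEN spec, THEN mp, OF I]
  obtain I\<^sub>0 where "I\<^sub>0 \<subseteq> I \<and> finite I\<^sub>0 \<and> (\<forall>J. ideal_on ?P J \<longrightarrow> I\<^sub>0 \<subseteq> J \<longrightarrow> I \<subseteq> J)" ..
  then have I0: "I\<^sub>0 \<subseteq> I" "finite I\<^sub>0" "\<And>J. ideal_on ?P J \<Longrightarrow> I\<^sub>0 \<subseteq> J \<Longrightarrow> I \<subseteq> J"
    by simp_all
  have I0P: "I\<^sub>0 \<subseteq> ?P" using I0(1) by (auto simp: I_def)
  have Idl: "Idl\<^bsub>mpoly_ring {..<2 * k}\<^esub> I\<^sub>0 = I"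
    using genideal_mpoly_ring(3)[OF I0P I I0(1)] I0(3)[OF genideal_mpoly_ring(1,2)[OF I0P]] by (rule equalityI)
  \<comment> \<open>With \<open>m = k\<close> and \<open>n = 2 * k\<close>, translation by
    \<open>k\<close> takes the coordinate of a value to that of its image.\<close>
  define \<tau> where "\<tau> i = i + k" for i
  define T where "T = ev (\<lambda>c. pconst (\<sigma> c)) (\<lambda>i. pvar (\<tau> i) :: 'a mpoly)"
  define \<sigma>' where "\<sigma>' = inv_into UNIV \<sigma>"
  have rc: "rhom (\<lambda>c. pconst (\<sigma> c) :: 'a mpoly)" "rhom (\<lambda>c. pconst (\<sigma>' c) :: 'a mpoly)"
    using rhom_comp[OF rhom_pconst sig(1)] rhom_comp[OF rhom_pconst rhom_inv[OF sig]] by (simp_all add: \<sigma>'_def)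
  define T' where "T' = ev (\<lambda>c. pconst (\<sigma>' c)) (\<lambda>i. pvar (i - k) :: 'a mpoly)"
  have rT: "rhom T" "rhom T'" by (simp_all add: T_def T'_def rhom_ev rc)
  have Tc: "T (pconst c) = pconst (\<sigma> c)" "T (pvar i) = pvar (i + k)"
    "T' (pconst c) = pconst (\<sigma>' c)" "T' (pvar i) = pvar (i - k)" for c i
    by (simp_all add: T_def T'_def ev_pconst ev_pvar rc \<tau>_def)
  have mt: "msubst \<tau> (mtwist \<sigma> f) = T f" for f
    using msubst_mtwist[OF sig(1) bij_is_inj[OF sig(2)]] by (simp add: T_def)
  have levT: "ev.lev (T f) = t (ev.lev f)" if "f \<in> psub {..<k}" for f
    using that
  proof (induction rule: psub_induct)
    case (pconst c)
    then show ?case by (simp add: Tc ht)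
  next
    case (pvar i)
    then show ?case by (simp add: Tc at)
  qed (simp_all add: rhom_simps[OF rT(1)] ev.lev_add ev.lev_mult ring_hom_add[OF t] ring_hom_mult[OF t])
  \<comment> \<open>Injectivity of \<open>t\<close> turns \<open>levT\<close> into an equivalence of
    vanishing, from which the compatibility condition follows.\<close>
  have t0: "t x = \<zero>\<^bsub>L\<^esub> \<longleftrightarrow> x = \<zero>\<^bsub>L\<^esub>" if "x \<in> carrier L" for x
    using inj_on_eq_iff[OF tinj that L.zero_closed] ring_hom_zero[OF t L.ring_axioms L.ring_axioms] by simp
  have TT': "T (T' f) = f" if "f \<in> psub (\<tau> ` {..<k})" for f
  proof -
    have ss: "\<sigma> (\<sigma>' x) = x" for x using sig(2) by (simp add: \<sigma>'_def surj_f_inv_f bij_is_surj)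
    show ?thesis
      by (rule rhom_eq_on_psub[OF rhom_comp[OF rT] rhom_id _ _ that])
        (auto simp: Tc \<tau>_def ss)
  qed
  have kk: "{..<k} \<subseteq> {..<2 * k}" "\<tau> ` {..<k} \<subseteq> {..<2 * k}" by (auto simp: \<tau>_def)
  have Tpsub: "T f \<in> psub (\<tau> ` {..<k})" if "f \<in> psub {..<k}" for f
    unfolding T_def using that by (rule ev_in_psub[OF rc(1)]) (auto intro: psub_pvar)
  have T'psub: "T' f \<in> psub {..<k}" if "f \<in> psub (\<tau> ` {..<k})" for f
    unfolding T'_def using that by (rule ev_in_psub[OF rc(2)]) (auto intro: psub_pvar simp: \<tau>_def)
  have compat: "T ` (I \<inter> psub {..<k}) = I \<inter> psub (\<tau> ` {..<k})"
  proof (intro equalityI subsetI)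
    fix f assume "f \<in> T ` (I \<inter> psub {..<k})"
    then obtain f' where f': "f = T f'" "f' \<in> I" "f' \<in> psub {..<k}" by blast
    have p: "f \<in> psub (\<tau> ` {..<k})" using Tpsub f' by simp
    moreover have "f \<in> ?P" using psub_mono[OF kk(2)] p by (rule subsetD)
    moreover have "ev.lev f = \<zero>\<^bsub>L\<^esub>" using f' levT[OF f'(3)] t0[of "\<zero>\<^bsub>L\<^esub>"] by (simp add: I_def)
    ultimately show "f \<in> I \<inter> psub (\<tau> ` {..<k})" by (simp add: I_def)
  next
    fix f assume f: "f \<in> I \<inter> psub (\<tau> ` {..<k})"
    then have p: "T' f \<in> psub {..<k}" "T (T' f) = f" using T'psub TT' by auto
    have "t (ev.lev (T' f)) = \<zero>\<^bsub>L\<^esub>" using levT[OF p(1)] p(2) f by (simp add: I_def)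
    then have "ev.lev (T' f) = \<zero>\<^bsub>L\<^esub>" using t0 by simp
    moreover have "T' f \<in> ?P" using psub_mono[OF kk(1)] p(1) by (rule subsetD)
    ultimately have "T' f \<in> I \<inter> psub {..<k}" using p(1) by (simp add: I_def)
    then show "f \<in> T ` (I \<inter> psub {..<k})" using imageI[of "T' f" _ T] p(2) by simp
  qed
  have "\<exists>b :: nat \<Rightarrow> 'a. (\<forall>f\<in>I\<^sub>0. meval b f = 0) \<and> (\<forall>i<k. \<sigma> (b i) = b (\<tau> i))"
  proof (rule ax)
    show "k \<le> 2 * k" "\<tau> \<in> {..<k} \<rightarrow> {..<2 * k}" "inj_on \<tau> {..<k}" by (auto simp: \<tau>_def inj_on_def)
    show "finite I\<^sub>0" by (rule I0(2))
    show "I\<^sub>0 \<subseteq> carrier (mpoly_ring {..<2 * k})" using I0P by simp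
    show "primeideal (Idl\<^bsub>mpoly_ring {..<2 * k}\<^esub> I\<^sub>0) (mpoly_ring {..<2 * k})"
      unfolding Idl
    proof (rule primeidealI)
      show "ideal I (mpoly_ring {..<2 * k})" using I by (simp add: ideal_mpoly_ring_iff)
      show "cring (mpoly_ring {..<2 * k} :: 'a mpoly ring)" by (rule cring_mpoly_ring)
      have "1 \<notin> I" by (simp add: I_def)
      then show "carrier (mpoly_ring {..<2 * k}) \<noteq> I" by auto
      show "x \<in> I \<or> y \<in> I" if "x \<in> carrier (mpoly_ring {..<2 * k})" "y \<in> carrier (mpoly_ring {..<2 * k})"
        "x \<otimes>\<^bsub>mpoly_ring {..<2 * k}\<^esub> y \<in> I" for x y
        using that by (simp add: I_def ev.lev_mult L.integral_iff)
    qed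
    show "{msubst \<tau> (mtwist \<sigma> f) | f. f \<in> (Idl\<^bsub>mpoly_ring {..<2 * k}\<^esub> I\<^sub>0) \<inter> carrier (mpoly_ring {..<k})} =
         (Idl\<^bsub>mpoly_ring {..<2 * k}\<^esub> I\<^sub>0) \<inter> carrier (mpoly_ring (\<tau> ` {..<k}))"
      unfolding Idl mt mpoly_ring_simps Setcompr_eq_image by (rule compat)
  qed
  then obtain b :: "nat \<Rightarrow> 'a" where b0: "\<And>f. f \<in> I\<^sub>0 \<Longrightarrow> meval b f = 0"
    and b\<sigma>: "\<And>i. i < k \<Longrightarrow> \<sigma> (b i) = b (i + k)"
    by (auto simp: \<tau>_def)
  \<comment> \<open>The hypothesis provides zeros of the generators only. As the polynomials
    vanishing at \<open>b\<close> form an ideal, every polynomial relation satisfied by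
    \<open>a\<close> in \<open>L\<close> passes to \<open>b\<close>.\<close>
  have "ideal_on ?P {f \<in> ?P. meval b f = 0}"
    by (auto simp: ideal_on_def psub_add psub_mult rhom_simps[OF rhom_meval])
  moreover have "I\<^sub>0 \<subseteq> {f \<in> ?P. meval b f = 0}" using b0 I0P by blast
  ultimately have "I \<subseteq> {f \<in> ?P. meval b f = 0}" by (rule I0(3))
  then have b: "meval b f = 0" if "f \<in> ?P" "ev.lev f = \<zero>\<^bsub>L\<^esub>" for f
    using that by (auto simp: I_def)
  \<comment> \<open>Variables that do not occur in the system receive the value 0.\<close>
  define w where "w i = (if Inl (Variable i) \<in> Z then b (g (Inl (Variable i))) else 0)" for i
  have var: "pvar (g z) \<in> ?P" "pvar (g z + k) \<in> ?P" if "z \<in> Z" for z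
    using gZ[OF that] by (auto intro!: psub_pvar)
  note psubs = psub_diff psub_add psub_mult psub_pconst
  note levs = ev.lev_diff ev.lev_add ev.lev_mult ag u_def
  note mevals = rhom_simps[OF rhom_meval] meval_pvar meval_pconst
  have Dsub: "q \<in> D" if pq: "p \<in> D" "q \<in> subterms p" for p q
  proof -
    obtain r s where rs: "(r, s) \<in> E \<union> N" "p \<in> subterms r \<union> subterms s"
      using pq(1) unfolding D_def by blast
    then have "q \<in> subterms r \<union> subterms s"
      using pq(2) subterms_trans[of p r] subterms_trans[of p s] by auto
    then show ?thesis using rs(1) unfolding D_def by blast
  qed
  have Zl: "Inl p \<in> Z \<longleftrightarrow> p \<in> D" for p by (auto simp: Z_def)
  \<comment> \<open>Every constructor is a polynomial relation between the coordinate of a term and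
    those of its immediate subterms, true in \<open>L\<close> and hence at \<open>b\<close>. For
    \<open>Sigma_app\<close> the relation involves the coordinate translated by \<open>k\<close>,
    which \<open>b\<sigma>\<close> identifies with an image under \<sigma>.\<close>
  have wval: "dterm_value ?R \<sigma> (\<lambda>x. x) w p = b (g (Inl p))" if "p \<in> D" for p
    using that
  proof (induction p)
    case (Variable i)
    then show ?case by (simp add: w_def Zl)
  next
    case (Param c)
    then have "Inl (Param c) \<in> Z" by (simp add: Zl)
    then show ?case
      using b[of "pvar (g (Inl (Param c))) - pconst c"]
      by (simp add: psubs var levs mevals L.r_right_minus_eq ring_hom_closed[OF h])
  next
    case Zero
    then have "Inl Zero \<in> Z" by (simp add: Zl)
    then show ?case using b[of "pvar (g (Inl Zero))"] by (simp add: psubs var levs mevals)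
  next
    case One
    then have "Inl One \<in> Z" by (simp add: Zl)
    then show ?case using b[of "pvar (g (Inl One)) - 1"]
      by (simp add: psubs var levs mevals L.r_right_minus_eq)
  next
    case (Plus p q)
    then have D: "p \<in> D" "q \<in> D" using Dsub[OF Plus.prems] subterms_refl by auto
    then have "Inl (Plus p q) \<in> Z" "Inl p \<in> Z" "Inl q \<in> Z" using Plus.prems by (simp_all add: Zl)
    then show ?case
      using b[of "pvar (g (Inl (Plus p q))) - (pvar (g (Inl p)) + pvar (g (Inl q)))"] Plus.IH D
      by (simp add: psubs var levs mevals L.r_right_minus_eq val_closed)
  next
    case (Minus p q)
    then have D: "p \<in> D" "q \<in> D" using Dsub[OF Minus.prems] subterms_refl by auto
    then have "Inl (Minus p q) \<in> Z" "Inl p \<in> Z" "Inl q \<in> Z" using Minus.prems by (simp_all add: Zl)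
    then show ?case
      using b[of "pvar (g (Inl (Minus p q))) - (pvar (g (Inl p)) - pvar (g (Inl q)))"] Minus.IH D
      by (simp add: psubs var levs mevals L.r_right_minus_eq val_closed minus_ring_of_type)
  next
    case (Times p q)
    then have D: "p \<in> D" "q \<in> D" using Dsub[OF Times.prems] subterms_refl by auto
    then have "Inl (Times p q) \<in> Z" "Inl p \<in> Z" "Inl q \<in> Z" using Times.prems by (simp_all add: Zl)
    then show ?case
      using b[of "pvar (g (Inl (Times p q))) - (pvar (g (Inl p)) * pvar (g (Inl q)))"] Times.IH D
      by (simp add: psubs var levs mevals L.r_right_minus_eq val_closed)
  next
    case (Sigma_app p)
    then have D: "p \<in> D" using Dsub[OF Sigma_app.prems] subterms_refl by auto
    then have z: "Inl (Sigma_app p) \<in> Z" "Inl p \<in> Z" using Sigma_app.prems by (simp_all add: Zl)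
    then show ?case
      using b[of "pvar (g (Inl (Sigma_app p))) - pvar (g (Inl p) + k)"] Sigma_app.IH D b\<sigma>[OF gZ[OF z(2)]]
      by (simp add: psubs var levs mevals L.r_right_minus_eq val_closed ring_hom_closed[OF t])
  qed
  have inD: "p \<in> D" "q \<in> D" if "(p, q) \<in> E \<union> N" for p q
    using that subterms_refl[of p] subterms_refl[of q] by (auto simp: D_def)
  show "system_solvable ?R \<sigma> (\<lambda>x. x) E N"
    unfolding system_solvable_def
  proof (intro exI[of _ w] conjI ballI)
    show "\<forall>i. w i \<in> carrier ?R" by simp
    fix e assume "e \<in> E"
    then obtain p q where e: "e = (p, q)" "(p, q) \<in> E" by (cases e) auto
    then have z: "Inl p \<in> Z" "Inl q \<in> Z" and D: "p \<in> D" "q \<in> D" using inD[of p q] by (simp_all add: Zl)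
    have "?val p = ?val q" using vE e by auto
    then have "b (g (Inl p)) = b (g (Inl q))"
      using b[of "pvar (g (Inl p)) - pvar (g (Inl q))"] z
      by (simp add: psubs var levs mevals L.r_right_minus_eq val_closed)
    then show "case e of (p, q) \<Rightarrow> dterm_value ?R \<sigma> (\<lambda>x. x) w p = dterm_value ?R \<sigma> (\<lambda>x. x) w q"
      using e D by (simp add: wval)
  next
    fix e assume "e \<in> N"
    then obtain p q where e: "e = (p, q)" "(p, q) \<in> N" by (cases e) auto
    then have z: "Inl p \<in> Z" "Inl q \<in> Z" "Inr (p, q) \<in> Z" and D: "p \<in> D" "q \<in> D"
      using inD[of p q] by (simp_all add: Zl Z_def)
    \<comment> \<open>The additional coordinate is the inverse of the difference of the two sides,
      so this relation holds in \<open>L\<close>. Transferred to \<open>b\<close>, it prevents the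
      difference from vanishing.\<close>
    have "ev.lev (pvar (g (Inr (p, q))) * (pvar (g (Inl p)) - pvar (g (Inl q))) - 1) = \<zero>\<^bsub>L\<^esub>"
      using z Nne[OF e(2)] by (simp add: levs)
    then have "b (g (Inr (p, q))) * (b (g (Inl p)) - b (g (Inl q))) - 1 = 0"
      using b[of "pvar (g (Inr (p, q))) * (pvar (g (Inl p)) - pvar (g (Inl q))) - 1"] z
      by (simp add: psubs var mevals)
    then have "b (g (Inl p)) \<noteq> b (g (Inl q))" by auto
    then show "case e of (p, q) \<Rightarrow> dterm_value ?R \<sigma> (\<lambda>x. x) w p \<noteq> dterm_value ?R \<sigma> (\<lambda>x. x) w q"
      using e D by (simp add: wval)
  qed
qed

theorem theorem4p2:
  fixes \<sigma> :: "'a::field \<Rightarrow> 'a"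
  assumes "difference_field (ring_of_type_algebra :: 'a ring) \<sigma>"
    and "infinite (UNIV :: 'b set)"
    and "\<exists>g :: 'a \<Rightarrow> 'b. inj g"
  shows "existentially_closed TYPE('b) (ring_of_type_algebra :: 'a ring) \<sigma> \<longleftrightarrow>
    (\<forall>(m::nat) (n::nat) (\<tau> :: nat \<Rightarrow> nat) (I\<^sub>0 :: 'a mpoly set).
       m \<le> n \<longrightarrow>
       \<tau> \<in> {..<m} \<rightarrow> {..<n} \<longrightarrow>
       inj_on \<tau> {..<m} \<longrightarrow>
       finite I\<^sub>0 \<longrightarrow>
       I\<^sub>0 \<subseteq> carrier (mpoly_ring {..<n}) \<longrightarrow>
       primeideal (Idl\<^bsub>mpoly_ring {..<n}\<^esub> I\<^sub>0) (mpoly_ring {..<n}) \<longrightarrow>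
       {msubst \<tau> (mtwist \<sigma> f) | f.
          f \<in> (Idl\<^bsub>mpoly_ring {..<n}\<^esub> I\<^sub>0) \<inter> carrier (mpoly_ring {..<m})} =
         (Idl\<^bsub>mpoly_ring {..<n}\<^esub> I\<^sub>0) \<inter> carrier (mpoly_ring (\<tau> ` {..<m})) \<longrightarrow>
       (\<exists>b :: nat \<Rightarrow> 'a.
          (\<forall>f\<in>I\<^sub>0. meval b f = 0) \<and> (\<forall>i<m. \<sigma> (b i) = b (\<tau> i))))"
proof (rule iffI, intro allI impI)
  fix m n :: nat and \<tau> :: "nat \<Rightarrow> nat" and I\<^sub>0 :: "'a mpoly set"
  assume "existentially_closed TYPE('b) (ring_of_type_algebra :: 'a ring) \<sigma>"
    and "m \<le> n" "\<tau> \<in> {..<m} \<rightarrow> {..<n}" "inj_on \<tau> {..<m}" "finite I\<^sub>0" "I\<^sub>0 \<subseteq> carrier (mpoly_ring {..<n})"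
      "primeideal (Idl\<^bsub>mpoly_ring {..<n}\<^esub> I\<^sub>0) (mpoly_ring {..<n})"
      "{msubst \<tau> (mtwist \<sigma> f) | f.
          f \<in> (Idl\<^bsub>mpoly_ring {..<n}\<^esub> I\<^sub>0) \<inter> carrier (mpoly_ring {..<m})} =
         (Idl\<^bsub>mpoly_ring {..<n}\<^esub> I\<^sub>0) \<inter> carrier (mpoly_ring (\<tau> ` {..<m}))"
  then show "\<exists>b :: nat \<Rightarrow> 'a. (\<forall>f\<in>I\<^sub>0. meval b f = 0) \<and> (\<forall>i<m. \<sigma> (b i) = b (\<tau> i))"
    by (rule solvable_if_existentially_closed[OF assms])
next
  assume ax: "\<forall>(m::nat) (n::nat) (\<tau> :: nat \<Rightarrow> nat) (I\<^sub>0 :: 'a mpoly set).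
       m \<le> n \<longrightarrow>
       \<tau> \<in> {..<m} \<rightarrow> {..<n} \<longrightarrow>
       inj_on \<tau> {..<m} \<longrightarrow>
       finite I\<^sub>0 \<longrightarrow>
       I\<^sub>0 \<subseteq> carrier (mpoly_ring {..<n}) \<longrightarrow>
       primeideal (Idl\<^bsub>mpoly_ring {..<n}\<^esub> I\<^sub>0) (mpoly_ring {..<n}) \<longrightarrow>
       {msubst \<tau> (mtwist \<sigma> f) | f.
          f \<in> (Idl\<^bsub>mpoly_ring {..<n}\<^esub> I\<^sub>0) \<inter> carrier (mpoly_ring {..<m})} =
         (Idl\<^bsub>mpoly_ring {..<n}\<^esub> I\<^sub>0) \<inter> carrier (mpoly_ring (\<tau> ` {..<m})) \<longrightarrow>
       (\<exists>b :: nat \<Rightarrow> 'a.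
          (\<forall>f\<in>I\<^sub>0. meval b f = 0) \<and> (\<forall>i<m. \<sigma> (b i) = b (\<tau> i)))"
  show "existentially_closed TYPE('b) (ring_of_type_algebra :: 'a ring) \<sigma>"
    by (rule existentially_closed_if_solvable[OF assms(1)])
      (rule ax[THEN spec, THEN spec, THEN spec, THEN spec, THEN mp, THEN mp, THEN mp, THEN mp, THEN mp, THEN mp, THEN mp])
qed

end
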